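(* Assume the setting and hypotheses (A1)–(A3) described in the context, and assume that $\sup_{\omega\in\Omega_0}\|h\|_{{\rm C}^2_b(\mathbb{R}^n)}<\infty$. Let $\nu_0>0$ and, for $\nu\in(0,\nu_0]$, let $y_\nu$ be the $\mathcal{F}^B_t$-adapted ${\rm C}^{\frac{\beta}{2},2}_b$-solution of \[ y(t,x) = h(x) + \int_0^t \big[\nu \Delta y(s,x) - (y,\nabla)y(s,x) + f(s,x,y(s,x))\big]\,ds + \int_0^t g(s,x)\,dB_s . \] Then there exists a stopping time $S$, positive a.s., such that on $[0,S]$ there exists an $\mathcal{F}^B_t$-adapted ${\rm C}^{\frac{\beta}{2},1}_b$-solution $y_0(t,x)$ of the inviscid stochastic Burgers equation \[ y(t,x) = h(x) + \int_0^t \big[f(s,x,y(s,x)) - (y,\nabla)y(s,x)\big]\,ds + \int_0^t g(s,x)\,dB_s . \] Moreover, if $\tilde y_0$ is another solution of the inviscid equation on $[0,\tilde S]$ for a stopping time $\tilde S>0$, then a.s. $\tilde y_0=y_0$ on $[0,S\wedge\tilde S]$. Furthermore, there exists a version of the ${\rm C}_b([0,S]\times\mathbb{R}^n)$-valued process $[0,\nu_0]\times\Omega\ni(\nu,\omega)\mapsto y_\nu$ which is continuous in $\nu$; for this version, a.s., $\lim_{\nu\to0}y_\nu(t,x)=y_0(t,x)$ uniformly in $(t,x)\in[0,S]\times\mathbb{R}^n$.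
   Context: Fix $T>0$, integers $n,d\ge1$, $\beta\in(0,1)$. $(\Omega,\mathcal{F},\mathbb{P})$ carries a $d$-dimensional Brownian motion $B_t$; $\mathcal{F}_0$ is a $\sigma$-algebra independent of the natural filtration of $B$; $\mathcal{F}^B_t=\sigma\{B_s,s\le t\}\vee\mathcal{F}_0\vee\mathcal{N}$ ($\mathcal{N}$ = null sets). $(y,\nabla)y=\sum_jy_j\partial_{x_j}y$. ${\rm C}^{\frac{\beta}{2},l}_b([0,T]\times\mathbb{R}^m)$: functions bounded and continuous with their spatial derivatives up to order $l$, and $\frac\beta2$-Hölder in $t$ uniformly in the spatial variable. ${\rm C}^{2+\beta}_b(\mathbb{R}^n)$: ${\rm C}^2_b$ functions with $\beta$-Hölder (on scales $<1$) second derivatives. (A1) $f$ deterministic $\mathbb{R}^n$-valued, of class ${\rm C}^{\frac{\beta}{2},2}_b([0,T]\times\mathbb{R}^{2n})$; $|f(t,x,y)|\le L(1+|y|)$, $|f(t,x,y)-f(t,x,y')|\le L|y-y'|$; first and second derivatives in $x,y$ bounded on $[0,T]\times\mathbb{R}^n\times[-D,D]^n$ for each $D>0$; $f(0,\cdot,0)$ compactly supported. (A2) $g=(g_1,\dots,g_d)$ $\mathcal{F}^B_t$-adapted with values in $H^k(\mathbb{R}^{d\times n})$, $k=[\frac n2]+5$, $\mathbb{E}\int_0^T\|g(s,\cdot)\|^p_{H^k}ds<\infty$ for some $p>\frac{4}{1-\beta}$; pointwise values via $H^k\hookrightarrow{\rm C}^4_b$. (A3) each $h(x)$ is $\mathcal{F}_0$-measurable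 and $h(\cdot,\omega)\in{\rm C}^{2+\beta}_b(\mathbb{R}^n)$ for all $\omega$. $\Omega_0$ denotes a set of full $\mathbb{P}$-measure on which a version $\eta(t,x)$ of $\int_0^tg(s,x)dB_s$ belongs to ${\rm C}^{\frac\beta2,4}_b([0,T]\times\mathbb{R}^n)$. *)

theory Defs
  imports "HOL-Probability.Probability"
begin

definition pd :: "'x::euclidean_space \<Rightarrow> ('x \<Rightarrow> 'b::real_normed_vector) \<Rightarrow> 'x \<Rightarrow> 'b" where
  "pd i u x = vector_derivative (\<lambda>s. u (x + s *\<^sub>R i)) (at 0)"

fun pds :: "'x::euclidean_space list \<Rightarrow> ('x \<Rightarrow> 'b::real_normed_vector) \<Rightarrow> 'x \<Rightarrow> 'b" where
  "pds [] u = u"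
| "pds (i # is) u = pd i (pds is u)"

definition has_pds_upto :: "nat \<Rightarrow> ('x::euclidean_space \<Rightarrow> 'b::real_normed_vector) \<Rightarrow> bool" where
  "has_pds_upto l u \<longleftrightarrow>
     (\<forall>\<alpha> i x. set \<alpha> \<subseteq> Basis \<and> i \<in> Basis \<and> length \<alpha> < l \<longrightarrow>
        ((\<lambda>s. pds \<alpha> u (x + s *\<^sub>R i)) has_vector_derivative pds (i # \<alpha>) u x) (at 0))"

definition Cb_hoelder :: "real \<Rightarrow> nat \<Rightarrow> real \<Rightarrow> real \<Rightarrow>
    (real \<Rightarrow> 'x::euclidean_space \<Rightarrow> 'b::real_normed_vector) \<Rightarrow> bool" where
  "Cb_hoelder \<beta> l a b u \<longleftrightarrow>
     (\<forall>t\<in>{a..b}. has_pds_upto l (u t)) \<and>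
     (\<forall>\<alpha>. set \<alpha> \<subseteq> Basis \<and> length \<alpha> \<le> l \<longrightarrow>
        continuous_on ({a..b} \<times> UNIV) (\<lambda>(t,x). pds \<alpha> (u t) x) \<and>
        bounded ((\<lambda>(t,x). pds \<alpha> (u t) x) ` ({a..b} \<times> UNIV))) \<and>
     (\<exists>C. \<forall>t\<in>{a..b}. \<forall>s\<in>{a..b}. \<forall>x. norm (u t x - u s x) \<le> C * \<bar>t - s\<bar> powr (\<beta> / 2))"

definition C2beta_b :: "real \<Rightarrow> ('x::euclidean_space \<Rightarrow> 'b::real_normed_vector) \<Rightarrow> bool" where
  "C2beta_b \<beta> u \<longleftrightarrow>
     has_pds_upto 2 u \<and>
     (\<forall>\<alpha>. set \<alpha> \<subseteq> Basis \<and> length \<alpha> \<le> 2 \<longrightarrow> continuous_on UNIV (pds \<alpha> u) \<and> bounded (range (pds \<alpha> u))) \<and>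
     (\<exists>C. \<forall>\<alpha>. set \<alpha> \<subseteq> Basis \<and> length \<alpha> = 2 \<longrightarrow>
        (\<forall>x y. dist x y < 1 \<longrightarrow> norm (pds \<alpha> u x - pds \<alpha> u y) \<le> C * dist x y powr \<beta>))"

definition test_fun :: "('x::euclidean_space \<Rightarrow> real) \<Rightarrow> bool" where
  "test_fun \<phi> \<longleftrightarrow> (\<forall>l. has_pds_upto l \<phi>) \<and>
     (\<forall>\<alpha>. set \<alpha> \<subseteq> Basis \<longrightarrow> continuous_on UNIV (pds \<alpha> \<phi>)) \<and>
     compact (closure {x. \<phi> x \<noteq> 0})"

definition weak_deriv :: "'x::euclidean_space list \<Rightarrow> ('x \<Rightarrow> 'b::euclidean_space) \<Rightarrow> ('x \<Rightarrow> 'b) \<Rightarrow> bool" where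
  "weak_deriv \<alpha> u v \<longleftrightarrow> v \<in> borel_measurable lborel \<and>
     (\<forall>\<phi>. test_fun \<phi> \<longrightarrow>
        integrable lborel (\<lambda>x. pds \<alpha> \<phi> x *\<^sub>R u x) \<and> integrable lborel (\<lambda>x. \<phi> x *\<^sub>R v x) \<and>
        (\<integral>x. pds \<alpha> \<phi> x *\<^sub>R u x \<partial>lborel) = (-1) ^ length \<alpha> *\<^sub>R (\<integral>x. \<phi> x *\<^sub>R v x \<partial>lborel))"

definition multi_indices :: "nat \<Rightarrow> 'x::euclidean_space list set" where
  "multi_indices k = {\<alpha>. set \<alpha> \<subseteq> Basis \<and> length \<alpha> \<le> k}"

definition in_Hk :: "nat \<Rightarrow> ('x::euclidean_space \<Rightarrow> 'b::euclidean_space) \<Rightarrow> bool" where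
  "in_Hk k u \<longleftrightarrow> (\<forall>\<alpha>\<in>multi_indices k. \<exists>v. weak_deriv \<alpha> u v \<and>
        integrable lborel (\<lambda>x. (norm (v x))\<^sup>2))"

text \<open>(An equivalent version of) the \<open>H^k\<close> norm.\<close>
definition Hk_norm :: "nat \<Rightarrow> ('x::euclidean_space \<Rightarrow> 'b::euclidean_space) \<Rightarrow> real" where
  "Hk_norm k u = sqrt (\<Sum>\<alpha>\<in>multi_indices k.
      (\<integral>x. (norm ((SOME v. weak_deriv \<alpha> u v) x))\<^sup>2 \<partial>lborel))"

definition std_BM_1d :: "'w measure \<Rightarrow> (real \<Rightarrow> 'w \<Rightarrow> real) \<Rightarrow> bool" where
  "std_BM_1d M W \<longleftrightarrow>
     (\<forall>t. W t \<in> borel_measurable M) \<and>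
     (\<forall>\<omega>\<in>space M. W 0 \<omega> = 0 \<and> continuous_on {0..} (\<lambda>t. W t \<omega>)) \<and>
     (\<forall>s t. 0 \<le> s \<and> s < t \<longrightarrow>
        distributed M lborel (\<lambda>\<omega>. W t \<omega> - W s \<omega>) (normal_density 0 (sqrt (t - s))) \<and>
        prob_space.indep_set M
          (sigma_sets (space M) {(\<lambda>\<omega>. W t \<omega> - W s \<omega>) -` A \<inter> space M | A. A \<in> sets borel})
          (sigma_sets (space M) {W r -` A \<inter> space M | r A. 0 \<le> r \<and> r \<le> s \<and> A \<in> sets borel}))"

definition std_BM :: "'w measure \<Rightarrow> (real \<Rightarrow> 'w \<Rightarrow> real^'d) \<Rightarrow> bool" where
  "std_BM M B \<longleftrightarrow> prob_space M \<and>
     (\<forall>j. std_BM_1d M (\<lambda>t \<omega>. B t \<omega> $ j)) \<and>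
     prob_space.indep_sets M
       (\<lambda>j. sigma_sets (space M) {(\<lambda>\<omega>. B t \<omega> $ j) -` A \<inter> space M | t A. 0 \<le> t \<and> A \<in> sets borel}) UNIV"

definition nat_sets :: "'w measure \<Rightarrow> (real \<Rightarrow> 'w \<Rightarrow> real^'d) \<Rightarrow> real \<Rightarrow> 'w set set" where
  "nat_sets M B t = {B s -` A \<inter> space M | s A. 0 \<le> s \<and> s \<le> t \<and> A \<in> sets borel}"

definition FB :: "'w measure \<Rightarrow> (real \<Rightarrow> 'w \<Rightarrow> real^'d) \<Rightarrow> 'w set set \<Rightarrow> real \<Rightarrow> 'w measure" where
  "FB M B F0 t = sigma (space M) (nat_sets M B t \<union> F0 \<union> null_sets M)"

definition simple_adm :: "(real \<Rightarrow> 'w measure) \<Rightarrow> real \<Rightarrow> real list \<Rightarrow> (nat \<Rightarrow> 'w \<Rightarrow> real) \<Rightarrow> bool" where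
  "simple_adm F T ts \<xi> \<longleftrightarrow> sorted_wrt (<) ts \<and> set ts \<subseteq> {0..T} \<and>
     (\<forall>i < length ts. \<xi> i \<in> borel_measurable (F (ts ! i)) \<and> (\<exists>C. \<forall>\<omega>. \<bar>\<xi> i \<omega>\<bar> \<le> C))"

definition simple_val :: "real list \<Rightarrow> (nat \<Rightarrow> 'w \<Rightarrow> real) \<Rightarrow> real \<Rightarrow> 'w \<Rightarrow> real" where
  "simple_val ts \<xi> s \<omega> = (\<Sum>i < length ts - 1. if ts ! i < s \<and> s \<le> ts ! (i+1) then \<xi> i \<omega> else 0)"

definition simple_int :: "(real \<Rightarrow> 'w \<Rightarrow> real) \<Rightarrow> real list \<Rightarrow> (nat \<Rightarrow> 'w \<Rightarrow> real) \<Rightarrow> real \<Rightarrow> 'w \<Rightarrow> real" where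
  "simple_int W ts \<xi> t \<omega> = (\<Sum>i < length ts - 1.
       \<xi> i \<omega> * (W (min t (ts ! (i+1))) \<omega> - W (min t (ts ! i)) \<omega>))"

definition is_ito_integral :: "'w measure \<Rightarrow> (real \<Rightarrow> 'w measure) \<Rightarrow> (real \<Rightarrow> 'w \<Rightarrow> real) \<Rightarrow> real \<Rightarrow>
    (real \<Rightarrow> 'w \<Rightarrow> real) \<Rightarrow> (real \<Rightarrow> 'w \<Rightarrow> real) \<Rightarrow> bool" where
  "is_ito_integral M F W T H I \<longleftrightarrow>
     (\<forall>t\<in>{0..T}. I t \<in> borel_measurable M) \<and>
     (\<exists>ts \<xi>. (\<forall>k. simple_adm F T (ts k) (\<xi> k)) \<and>
        ((\<lambda>k. \<integral>\<^sup>+\<omega>. (\<integral>\<^sup>+s\<in>{0..T}. ennreal ((H s \<omega> - simple_val (ts k) (\<xi> k) s \<omega>)\<^sup>2) \<partial>lborel) \<partial>M)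
           \<longlonglongrightarrow> 0) \<and>
        (\<forall>t\<in>{0..T}. (\<lambda>k. \<integral>\<^sup>+\<omega>. ennreal ((I t \<omega> - simple_int W (ts k) (\<xi> k) t \<omega>)\<^sup>2) \<partial>M) \<longlonglongrightarrow> 0))"

definition is_stoch_int_version :: "'w measure \<Rightarrow> (real \<Rightarrow> 'w measure) \<Rightarrow> (real \<Rightarrow> 'w \<Rightarrow> real^'d) \<Rightarrow> real \<Rightarrow>
    ('w \<Rightarrow> real \<Rightarrow> real^'n \<Rightarrow> real^'n^'d) \<Rightarrow> ('w \<Rightarrow> real \<Rightarrow> real^'n \<Rightarrow> real^'n) \<Rightarrow> bool" where
  "is_stoch_int_version M F B T g \<eta> \<longleftrightarrow>
     (\<forall>x i. \<exists>I. (\<forall>j. is_ito_integral M F (\<lambda>t \<omega>. B t \<omega> $ j) T (\<lambda>s \<omega>. g \<omega> s x $ j $ i) (I j)) \<and>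
        (\<forall>t\<in>{0..T}. AE \<omega> in M. \<eta> \<omega> t x $ i = (\<Sum>j\<in>UNIV. I j t \<omega>)))"

definition lap :: "(real^'n \<Rightarrow> real^'n) \<Rightarrow> real^'n \<Rightarrow> real^'n" where
  "lap u x = (\<Sum>i\<in>Basis. pd i (pd i u) x)"

definition adv :: "(real^'n \<Rightarrow> real^'n) \<Rightarrow> real^'n \<Rightarrow> real^'n" where
  "adv u x = (\<Sum>i\<in>Basis. (u x \<bullet> i) *\<^sub>R pd i u x)"

text \<open>y is an \<open>\<F>^B_t\<close>-adapted \<open>C_b^{\<beta>/2,l}\<close>-solution on the random interval [0,S] of
  \<open>y(t,x) = h(x) + \<integral>_0^t [\<nu>\<Delta>y - (y,\<nabla>)y + f(s,x,y)] ds + \<integral>_0^t g dB\<close>, where the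
  stochastic integral is represented by its regular version \<eta>.\<close>
definition burgers_sol :: "'w measure \<Rightarrow> (real \<Rightarrow> 'w measure) \<Rightarrow> real \<Rightarrow> real \<Rightarrow> nat \<Rightarrow> real \<Rightarrow>
    (real \<Rightarrow> real^'n \<Rightarrow> real^'n \<Rightarrow> real^'n) \<Rightarrow> ('w \<Rightarrow> real^'n \<Rightarrow> real^'n) \<Rightarrow>
    ('w \<Rightarrow> real \<Rightarrow> real^'n \<Rightarrow> real^'n) \<Rightarrow> ('w \<Rightarrow> real) \<Rightarrow> ('w \<Rightarrow> real \<Rightarrow> real^'n \<Rightarrow> real^'n) \<Rightarrow> bool" where
  "burgers_sol M F T \<beta> l \<nu> f h \<eta> S y \<longleftrightarrow>
     (\<forall>t\<in>{0..T}. \<forall>x. (\<lambda>\<omega>. if t \<le> S \<omega> then y \<omega> t x else 0) \<in> borel_measurable (F t)) \<and>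
     (AE \<omega> in M. Cb_hoelder \<beta> l 0 (S \<omega>) (y \<omega>) \<and>
        (\<forall>t\<in>{0..S \<omega>}. \<forall>x. y \<omega> t x = h \<omega> x
            + integral {0..t} (\<lambda>s. \<nu> *\<^sub>R lap (y \<omega> s) x - adv (y \<omega> s) x + f s x (y \<omega> s x))
            + \<eta> \<omega> t x))"

end

theory Submission
  imports Defs
begin

text \<open>
  The argument is pathwise. For \<open>u = y - \<eta>\<close> the equation is a parabolic system without noise, and
  any bounded \<open>w\<close> with \<open>|w\<^sub>t - \<nu> \<Delta>w + (b, \<nabla>)w| \<le> A\<close> satisfies \<open>|w(t)| \<le> sup |w(0)| + A t\<close> whatever
  \<open>\<nu> \<ge> 0\<close> and the bounded drift \<open>b\<close> are. Since solutions have only two spatial derivatives, the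
  principle is applied to first and second difference quotients of \<open>u\<close> instead of derivatives. This bounds
  \<open>\<nabla>y\<^sub>\<nu>\<close> and \<open>\<nabla>\<^sup>2y\<^sub>\<nu>\<close> uniformly in \<open>\<nu>\<close> up to the first time \<open>S\<close> at which \<open>100 t R(t)\<^sup>3 = 1\<close>, where \<open>R(t)\<close>
  is a constant plus the supremum over \<open>[0,t]\<close> of the derivatives of \<open>\<eta>\<close> of order at most 3.
  Applied to a difference of two solutions the principle gives \<open>|y\<^sub>\<nu> - y\<^sub>\<mu>| \<le> C |\<nu> - \<mu>|\<close> on \<open>[0,S]\<close>,
  also for \<open>\<nu> = 0\<close>: hence uniqueness, and uniform convergence as \<open>\<mu> \<rightarrow> 0\<close>. By
  interpolation the gradients converge too, so the limit solves the inviscid equation. As each \<open>y\<^sub>\<nu>\<close> solves its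
  equation only outside a null set depending on \<open>\<nu>\<close>, the version continuous in \<open>\<nu>\<close> is built as a limit
  along rational viscosities.
\<close>

section \<open>A parabolic maximum principle\<close>

text \<open>The obstacle is the quadratic transport term: first differences of \<open>u\<close> obey
  an inequality whose right side is quadratic in the gradient, so the gradient is controlled only
  for a short time, by continuation from time 0. The other estimates are affine in the quantity to
  be bounded and close by absorption. This decides which noise derivatives enter \<open>S\<close>:
  the gradient estimate contains the Laplacian of first differences of \<eta>, that is three
  derivatives, while fourth derivatives occur only in the Hessian estimate, where any finite bound
  will do. The cube of \<open>R(t)\<close> comes from the worst gradient term, a velocity increment
  times a gradient, both of size \<open>R\<close>, times the dimension, which is at most
  \<open>R\<close> too; 100 leaves room for all numerical factors. When two solutions are compared,
  the drift is the velocity of the first, so that the residual contains derivatives of the second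
  only. Hence only one of them needs a bounded Hessian, and the other may be inviscid.\<close>

lemma second_derivative_at_max_nonpos:
  fixes \<phi> \<phi>' :: "real \<Rightarrow> real"
  assumes d: "\<And>s. (\<phi> has_real_derivative \<phi>' s) (at s)"
    and d2: "(\<phi>' has_real_derivative D) (at 0)"
    and mx: "\<And>s. \<phi> s \<le> \<phi> 0"
  shows "\<phi>' 0 = 0" "D \<le> 0"
proof -
  show z: "\<phi>' 0 = 0"
    using DERIV_local_max[OF d[of 0], of 1] mx by auto
  show "D \<le> 0"
  proof (rule ccontr)
    assume "\<not> D \<le> 0"
    then obtain e where e: "e > 0" "\<And>h. h > 0 \<Longrightarrow> h < e \<Longrightarrow> \<phi>' 0 < \<phi>' (0 + h)"
      using has_real_derivative_pos_inc_right[OF d2] by auto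
    have "\<phi> 0 < \<phi> (e/2)"
      using DERIV_pos_imp_increasing_open[of 0 "e/2" \<phi>] d e z
      by (metis (no_types, lifting) DERIV_continuous_on add_0 dual_order.strict_trans field_sum_of_halves
          half_gt_zero less_add_same_cancel1 has_field_derivative_at_within)
    with mx[of "e/2"] show False by simp
  qed
qed

text \<open>Subtracting a small multiple of \<open>exp (l * s) * (1 + x \<bullet> x)\<close>
  compensates for the unbounded space: as \<open>p\<close> is bounded above, a positive supremum of
  the corrected function is attained in a ball, and there the conditions of first and second order
  contradict the inequality. Second derivatives are requested only for \<open>0 < \<nu>\<close>, so
  that \<open>\<nu> = 0\<close> covers pure transport.\<close>

lemma scalar_max_principle:
  fixes p :: "real \<Rightarrow> 'x::euclidean_space \<Rightarrow> real"
  assumes \<nu>: "0 \<le> \<nu>"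
    and cont: "continuous_on ({0..\<tau>} \<times> UNIV) (\<lambda>(t,x). p t x)"
    and bdd: "\<And>t x. t \<in> {0..\<tau>} \<Longrightarrow> p t x \<le> C"
    and dt: "\<And>t x. t \<in> {0..\<tau>} \<Longrightarrow> ((\<lambda>s. p s x) has_real_derivative pt t x) (at t within {0..\<tau>})"
    and d1: "\<And>t x i. t \<in> {0..\<tau>} \<Longrightarrow> i \<in> Basis \<Longrightarrow>
        ((\<lambda>s. p t (x + s *\<^sub>R i)) has_real_derivative p1 i t x) (at 0)"
    and d2: "\<And>t x i. 0 < \<nu> \<Longrightarrow> t \<in> {0..\<tau>} \<Longrightarrow> i \<in> Basis \<Longrightarrow>
        ((\<lambda>s. p1 i t (x + s *\<^sub>R i)) has_real_derivative p2 i t x) (at 0)"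
    and b: "\<And>t x. t \<in> {0..\<tau>} \<Longrightarrow> norm (b t x) \<le> bm"
    and eq: "\<And>t x. t \<in> {0..\<tau>} \<Longrightarrow>
        pt t x \<le> \<nu> * (\<Sum>i\<in>Basis. p2 i t x) - (\<Sum>i\<in>Basis. (b t x \<bullet> i) * p1 i t x) + A"
    and init: "\<And>x. p 0 x \<le> P0"
    and t0: "t0 \<in> {0..\<tau>}"
  shows "p t0 x0 \<le> P0 + A * t0"
proof (rule ccontr)
  assume "\<not> ?thesis"
  then have gap: "p t0 x0 - P0 - A * t0 > 0" by simp
  have bm0: "bm \<ge> 0" using b[OF t0, of x0] norm_ge_zero order_trans by blast
  \<comment> \<open>The first summand beats \<nu> times the Laplacian of the quadratic weight, the
    second the drift acting on it, and the 1 leaves a strict gap.\<close>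
  define l where "l = 2 * real DIM('x) * \<nu> + bm + 1"
  have l0: "l > 0" using bm0 \<nu> by (simp add: l_def add_nonneg_pos)
  \<comment> \<open>Chosen so that the correction uses up exactly half of the assumed excess at
    \<open>(t0, x0)\<close>.\<close>
  define \<epsilon> where "\<epsilon> = (p t0 x0 - P0 - A * t0) / (2 * (exp (l * t0) * (1 + x0 \<bullet> x0)))"
  have pos: "exp (l * t0) * (1 + x0 \<bullet> x0) > 0"
    by (intro mult_pos_pos) (auto simp: add_pos_nonneg)
  have \<epsilon>: "\<epsilon> > 0" using gap pos by (simp add: \<epsilon>_def)
  define q where "q s x = p s x - P0 - A * s - \<epsilon> * exp (l * s) * (1 + x \<bullet> x)" for s x
  have "\<epsilon> * (exp (l * t0) * (1 + x0 \<bullet> x0)) = (p t0 x0 - P0 - A * t0) / 2"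
  proof -
    have "e * W = g / 2" if "e = g / (2 * W)" "W > 0" for e g W :: real using that by simp
    from this[OF \<epsilon>_def pos] show ?thesis .
  qed
  moreover have "0 < a - c" if "c = a / 2" "0 < a" for a c :: real using that by simp
  ultimately have q0: "q t0 x0 > 0" using gap unfolding q_def mult.assoc by blast
  \<comment> \<open>Beyond this radius the weight outgrows all bounded contributions and
    \<open>q\<close> is negative.\<close>
  define \<rho> where "\<rho> = (\<bar>C\<bar> + \<bar>P0\<bar> + \<bar>A\<bar> * \<tau>) / \<epsilon> + 1"
  have tau0: "\<tau> \<ge> 0" using t0 by auto
  have rho1: "\<rho> \<ge> 1" using \<epsilon> tau0 by (simp add: \<rho>_def)
  have far: "q s x < 0" if s: "s \<in> {0..\<tau>}" and x: "norm x > \<rho>" for s x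
  proof -
    have "x \<bullet> x \<ge> \<rho> * \<rho>" using x rho1 by (simp add: dot_square_norm power2_eq_square mult_mono)
    then have "x \<bullet> x \<ge> \<rho>" using rho1 by (smt (verit) mult_le_cancel_right1)
    then have "\<epsilon> * (1 + x \<bullet> x) > \<epsilon> * \<rho>" using \<epsilon> by simp
    moreover have "\<epsilon> * \<rho> \<ge> \<bar>C\<bar> + \<bar>P0\<bar> + \<bar>A\<bar> * \<tau>" using \<epsilon> by (simp add: \<rho>_def field_simps)
    moreover have "\<epsilon> * exp (l * s) * (1 + x \<bullet> x) \<ge> \<epsilon> * (1 + x \<bullet> x)"
    proof -
      have "exp (l * s) \<ge> 1" using l0 s by simp
      then show ?thesis using \<epsilon> mult_right_mono[of 1 "exp (l * s)" "\<epsilon> * (1 + x \<bullet> x)"]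
        by (simp add: mult.assoc mult.left_commute)
    qed
    moreover have "- A * s \<le> \<bar>A\<bar> * \<tau>"
    proof -
      have "- A * s \<le> \<bar>A\<bar> * s" using s by (intro mult_right_mono) auto
      also have "\<dots> \<le> \<bar>A\<bar> * \<tau>" using s by (intro mult_left_mono) auto
      finally show ?thesis .
    qed
    moreover have "p s x \<le> C" using bdd s by blast
    ultimately show ?thesis unfolding q_def by linarith
  qed
  have qc: "continuous_on ({0..\<tau>} \<times> cball 0 \<rho>) (\<lambda>z. q (fst z) (snd z))"
    unfolding q_def
    by (intro continuous_intros continuous_on_subset[OF cont[unfolded case_prod_beta]]) auto
  have "compact ({0..\<tau>} \<times> cball (0::'x) \<rho>)" by (intro compact_Times) auto
  moreover have "{0..\<tau>} \<times> cball (0::'x) \<rho> \<noteq> {}" using tau0 rho1 by auto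
  ultimately obtain z where z: "z \<in> {0..\<tau>} \<times> cball (0::'x) \<rho>"
    "\<And>z'. z' \<in> {0..\<tau>} \<times> cball (0::'x) \<rho> \<Longrightarrow> q (fst z') (snd z') \<le> q (fst z) (snd z)"
    using continuous_attains_sup[OF _ _ qc] by blast
  obtain t1 x1 where tx: "z = (t1, x1)" by force
  have t1: "t1 \<in> {0..\<tau>}" using z tx by auto
  have x0in: "norm x0 \<le> \<rho>" using far[OF t0, of x0] q0 by fastforce
  have q1: "q t1 x1 > 0" using z(2)[of "(t0,x0)"] x0in t0 q0 tx by auto
  have mx: "q s x \<le> q t1 x1" if "s \<in> {0..\<tau>}" for s x
  proof (cases "norm x \<le> \<rho>")
    case True then show ?thesis using z(2)[of "(s,x)"] that tx by auto
  next
    case False then show ?thesis using far[OF that, of x] q1 by simp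
  qed
  have t1pos: "t1 > 0"
  proof (rule ccontr)
    assume "\<not> t1 > 0"
    then have "t1 = 0" using t1 by auto
    moreover have "\<epsilon> * (1 + x1 \<bullet> x1) > 0" using \<epsilon> by (simp add: add_pos_nonneg)
    ultimately have "q t1 x1 < 0" using init[of x1] by (simp add: q_def)
    with q1 show False by simp
  qed
  define E where "E = \<epsilon> * exp (l * t1)"
  have E0: "E > 0" using \<epsilon> by (simp add: E_def)
  \<comment> \<open>Since \<open>t1\<close> may equal \<tau>, only earlier times are available for
    comparison; a one-sided derivative from the left already has the required sign.\<close>
  have time: "pt t1 x1 \<ge> A + E * l * (1 + x1 \<bullet> x1)"
  proof (rule ccontr)
    assume neg: "\<not> ?thesis"
    have "((\<lambda>s. q s x1) has_real_derivative pt t1 x1 - A - E * l * (1 + x1 \<bullet> x1)) (at t1 within {0..\<tau>})"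
      unfolding q_def E_def by (rule derivative_eq_intros dt t1 refl | simp)+
    from has_real_derivative_neg_dec_left[OF this] neg obtain e where
      e: "e > 0" "\<And>h. h > 0 \<Longrightarrow> t1 - h \<in> {0..\<tau>} \<Longrightarrow> h < e \<Longrightarrow> q t1 x1 < q (t1 - h) x1" by auto
    define k where "k = min (e/2) t1"
    have "k > 0" "k < e" "t1 - k \<in> {0..\<tau>}" using e t1pos t1 by (auto simp: k_def min_def)
    with e(2)[of k] mx[of "t1 - k" x1] show False by auto
  qed
  have sp: "((\<lambda>s. q t1 (x1 + s *\<^sub>R i)) has_real_derivative
        p1 i t1 (x1 + r *\<^sub>R i) - E * (2 * ((x1 + r *\<^sub>R i) \<bullet> i))) (at r)" if i: "i \<in> Basis" for i r
  proof -
    have "((\<lambda>s. p t1 (x1 + (s + r) *\<^sub>R i)) has_real_derivative p1 i t1 (x1 + r *\<^sub>R i)) (at 0)"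
      using d1[OF t1 i, of "x1 + r *\<^sub>R i"] by (simp add: algebra_simps)
    then have 1: "((\<lambda>s. p t1 (x1 + s *\<^sub>R i)) has_real_derivative p1 i t1 (x1 + r *\<^sub>R i)) (at r)"
      using DERIV_shift[of "\<lambda>s. p t1 (x1 + s *\<^sub>R i)" _ 0 r] by (simp add: add.commute)
    have ii: "i \<bullet> i = 1" using i by simp
    have 2: "((\<lambda>s. (x1 + s *\<^sub>R i) \<bullet> (x1 + s *\<^sub>R i)) has_real_derivative 2 * ((x1 + r *\<^sub>R i) \<bullet> i)) (at r)"
      unfolding inner_add_left inner_add_right inner_scaleR_left inner_scaleR_right ii
      by (rule derivative_eq_intros refl | simp add: inner_commute)+
    show ?thesis unfolding q_def E_def
      by (rule derivative_eq_intros 1 2 refl | simp)+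
  qed
  have grad: "p1 i t1 x1 = 2 * E * (x1 \<bullet> i)" if i: "i \<in> Basis" for i
    using DERIV_local_max[OF sp[OF i, of 0], of 1] mx[OF t1] by auto
  have hess: "p2 i t1 x1 \<le> 2 * E" if i: "i \<in> Basis" and "\<nu> > 0" for i
  proof -
    have ii: "i \<bullet> i = 1" using i by simp
    have "((\<lambda>r. p1 i t1 (x1 + r *\<^sub>R i) - E * (2 * ((x1 + r *\<^sub>R i) \<bullet> i))) has_real_derivative
        p2 i t1 x1 - 2 * E) (at 0)"
      unfolding inner_add_left inner_scaleR_left ii
      by (rule derivative_eq_intros d2 t1 i that refl | simp)+
    from second_derivative_at_max_nonpos(2)[OF sp[OF i] this] mx[OF t1] show ?thesis by simp
  qed
  have "\<nu> * (\<Sum>i\<in>Basis. p2 i t1 x1) \<le> \<nu> * (real DIM('x) * (2 * E))"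
  proof (cases "\<nu> = 0")
    case False
    then show ?thesis using \<nu> hess sum_bounded_above[of Basis "\<lambda>i. p2 i t1 x1" "2 * E"]
      by (intro mult_left_mono) auto
  qed simp
  moreover have "(\<Sum>i\<in>Basis. (b t1 x1 \<bullet> i) * p1 i t1 x1) = 2 * E * (b t1 x1 \<bullet> x1)"
    unfolding euclidean_inner[of "b t1 x1" x1] sum_distrib_left
    by (intro sum.cong refl) (simp add: grad)
  moreover have "- (2 * (b t1 x1 \<bullet> x1)) \<le> bm * (1 + x1 \<bullet> x1)"
  proof -
    have "\<bar>b t1 x1 \<bullet> x1\<bar> \<le> bm * norm x1"
      using Cauchy_Schwarz_ineq2[of "b t1 x1" x1] b[OF t1, of x1] mult_right_mono[OF _ norm_ge_zero[of x1]]
      by (meson order_trans)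
    moreover have "2 * norm x1 \<le> 1 + x1 \<bullet> x1"
      using zero_le_power2[of "norm x1 - 1"] by (simp add: power2_diff dot_square_norm)
    then have "bm * (2 * norm x1) \<le> bm * (1 + x1 \<bullet> x1)" using bm0 by (rule mult_left_mono)
    ultimately show ?thesis by (simp add: abs_le_iff)
  qed
  then have "E * - (2 * (b t1 x1 \<bullet> x1)) \<le> E * (bm * (1 + x1 \<bullet> x1))"
    using E0 by (intro mult_left_mono) auto
  moreover have "\<nu> * (real DIM('x) * (2 * E)) \<le> E * (2 * real DIM('x) * \<nu>) * (1 + x1 \<bullet> x1)"
  proof -
    have "E * (2 * real DIM('x) * \<nu>) * 1 \<le> E * (2 * real DIM('x) * \<nu>) * (1 + x1 \<bullet> x1)"
      using E0 \<nu> by (intro mult_left_mono) auto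
    then show ?thesis by (simp add: mult_ac)
  qed
  moreover have "E * l * (1 + x1 \<bullet> x1) = E * (2 * real DIM('x) * \<nu>) * (1 + x1 \<bullet> x1)
     + E * (bm * (1 + x1 \<bullet> x1)) + E * (1 + x1 \<bullet> x1)"
    by (simp add: l_def algebra_simps)
  moreover have "E * (1 + x1 \<bullet> x1) > 0" using E0 by (simp add: add_pos_nonneg)
  ultimately show False using time eq[OF t1, of x1] by (simp add: mult.assoc)
qed

section \<open>Directional differences and directional derivatives\<close>

lemma has_vector_derivative_along_line:
  fixes u :: "'x::real_vector \<Rightarrow> 'b::real_normed_vector"
  assumes "((\<lambda>s. u ((x + r *\<^sub>R i) + s *\<^sub>R i)) has_vector_derivative D) (at (0::real))"
  shows "((\<lambda>s. u (x + s *\<^sub>R i)) has_vector_derivative D) (at r)"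
proof -
  have "((\<lambda>s::real. s - r) has_vector_derivative 1) (at r)"
    by (auto intro!: derivative_eq_intros simp: has_real_derivative_iff_has_vector_derivative[symmetric])
  from vector_diff_chain_at[OF this, of "\<lambda>s. u ((x + r *\<^sub>R i) + s *\<^sub>R i)" D] assms
  have "((\<lambda>s. u ((x + r *\<^sub>R i) + (s - r) *\<^sub>R i)) has_vector_derivative D) (at r)" by (simp add: o_def)
  moreover have "(x + r *\<^sub>R i) + (s - r) *\<^sub>R i = x + s *\<^sub>R i" for s by (simp add: algebra_simps)
  ultimately show ?thesis by simp
qed

lemma directional_mean_value_bound:
  fixes u :: "'x::real_vector \<Rightarrow> 'b::real_normed_vector"
  assumes d: "\<And>x. ((\<lambda>s. u (x + s *\<^sub>R i)) has_vector_derivative u' x) (at 0)"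
    and b: "\<And>x. norm (u' x) \<le> C"
  shows "norm (u (x + s *\<^sub>R i) - u x) \<le> C * \<bar>s\<bar>"
proof -
  have "norm ((\<lambda>r. u (x + r *\<^sub>R i)) s - (\<lambda>r. u (x + r *\<^sub>R i)) 0) \<le> C * norm (s - 0)"
  proof (rule differentiable_bound[of UNIV _ "\<lambda>r h. h *\<^sub>R u' (x + r *\<^sub>R i)"])
    show "((\<lambda>r. u (x + r *\<^sub>R i)) has_derivative (\<lambda>h. h *\<^sub>R u' (x + r *\<^sub>R i))) (at r within UNIV)" for r
      using has_vector_derivative_along_line[OF d] by (simp add: has_vector_derivative_def)
    show "onorm (\<lambda>h. h *\<^sub>R u' (x + r *\<^sub>R i)) \<le> C" for r
      using mult_left_mono[OF b[of "x + r *\<^sub>R i"] abs_ge_zero] by (intro onorm_le) (simp add: mult.commute)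
  qed auto
  then show ?thesis by simp
qed

text \<open>The mean value bound for \<open>u'\<close> along the segment gives the constant
  \<open>C\<close> without the factor one half, which is precise enough here.\<close>

lemma directional_taylor_bound:
  fixes u :: "'x::real_vector \<Rightarrow> 'b::real_normed_vector"
  assumes d: "\<And>x. ((\<lambda>s. u (x + s *\<^sub>R i)) has_vector_derivative u' x) (at 0)"
    and d2: "\<And>x. ((\<lambda>s. u' (x + s *\<^sub>R i)) has_vector_derivative u'' x) (at 0)"
    and b: "\<And>x. norm (u'' x) \<le> C"
  shows "norm (u (x + s *\<^sub>R i) - u x - s *\<^sub>R u' x) \<le> C * s\<^sup>2"
proof -
  have C0: "C \<ge> 0" using b norm_ge_zero order_trans by blast
  have "norm ((\<lambda>r. u (x + r *\<^sub>R i)) s - (\<lambda>r. u (x + r *\<^sub>R i)) 0 - (s - 0) *\<^sub>R u' (x + 0 *\<^sub>R i))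
      \<le> norm (s - 0) * (C * \<bar>s\<bar>)"
  proof (rule vector_differentiable_bound_linearization[where S="closed_segment 0 s"])
    show "((\<lambda>r. u (x + r *\<^sub>R i)) has_vector_derivative u' (x + r *\<^sub>R i)) (at r within closed_segment 0 s)" for r
      using has_vector_derivative_along_line[OF d] by (rule has_vector_derivative_at_within)
    show "norm (u' (x + r *\<^sub>R i) - u' (x + 0 *\<^sub>R i)) \<le> C * \<bar>s\<bar>" if "r \<in> closed_segment 0 s" for r
    proof -
      have "\<bar>r\<bar> \<le> \<bar>s\<bar>" using that by (auto simp: closed_segment_eq_real_ivl split: if_splits)
      then have "C * \<bar>r\<bar> \<le> C * \<bar>s\<bar>" using C0 by (rule mult_left_mono)
      then show ?thesis using directional_mean_value_bound[OF d2 b, of x r] by simp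
    qed
  qed auto
  then show ?thesis by (simp add: power2_eq_square mult.left_commute)
qed

text \<open>Landau's inequality along one direction: the increment of \<open>u\<close> over a step
  \<open>s\<close> is \<open>s *\<^sub>R u' x\<close> up to a remainder of order
  \<open>s\<^sup>2\<close>. Taking first \<open>s\<close> and then \<open>a\<close> small, smallness
  of a function with bounded second derivative passes to its first derivative.\<close>

lemma interpolation_bound:
  fixes u :: "'x::real_vector \<Rightarrow> 'b::real_normed_vector"
  assumes d: "\<And>x. ((\<lambda>s. u (x + s *\<^sub>R i)) has_vector_derivative u' x) (at 0)"
    and d2: "\<And>x. ((\<lambda>s. u' (x + s *\<^sub>R i)) has_vector_derivative u'' x) (at 0)"
    and a: "\<And>x. norm (u x) \<le> a" and b: "\<And>x. norm (u'' x) \<le> C" and s: "s > 0"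
  shows "norm (u' x) \<le> 2 * a / s + C * s"
proof -
  have "norm v \<le> norm c + norm d + norm (c - d - v)" for c d v :: 'b by norm
  then have "norm (s *\<^sub>R u' x) \<le> norm (u (x + s *\<^sub>R i)) + norm (u x) + norm (u (x + s *\<^sub>R i) - u x - s *\<^sub>R u' x)"
    by blast
  also have "\<dots> \<le> a + a + C * s\<^sup>2"
    using a directional_taylor_bound[OF d d2 b] by (intro add_mono) auto
  finally have "s * norm (u' x) \<le> 2 * a + C * s\<^sup>2" using s by simp
  then show ?thesis using s by (simp add: field_simps power2_eq_square)
qed

text \<open>The increment is telescoped over the coordinates, changing one at a time; the dimension
  counts these changes.\<close>

lemma lipschitz_of_bounded_partials:
  fixes u :: "'x::euclidean_space \<Rightarrow> 'b::real_normed_vector"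
  assumes d: "\<And>x i. i \<in> Basis \<Longrightarrow> ((\<lambda>s. u (x + s *\<^sub>R i)) has_vector_derivative u' i x) (at 0)"
    and b: "\<And>x i. i \<in> Basis \<Longrightarrow> norm (u' i x) \<le> C"
  shows "norm (u (x + a) - u x) \<le> real DIM('x) * C * norm a"
proof -
  have C0: "C \<ge> 0" using b[OF SOME_Basis] norm_ge_zero order_trans by blast
  have "norm (u (x + (\<Sum>i\<in>B. (a \<bullet> i) *\<^sub>R i)) - u x) \<le> (\<Sum>i\<in>B. C * \<bar>a \<bullet> i\<bar>)" if "B \<subseteq> Basis" for B
    using finite_subset[OF that finite_Basis] that
  proof (induction B rule: finite_induct)
    case (insert j B)
    let ?y = "x + (\<Sum>i\<in>B. (a \<bullet> i) *\<^sub>R i)"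
    have j: "j \<in> Basis" using insert by auto
    have "norm (u (?y + (a \<bullet> j) *\<^sub>R j) - u ?y) \<le> C * \<bar>a \<bullet> j\<bar>"
      by (rule directional_mean_value_bound[OF d[OF j] b[OF j]])
    moreover have "norm (u ?y - u x) \<le> (\<Sum>i\<in>B. C * \<bar>a \<bullet> i\<bar>)" using insert by auto
    moreover have "norm (u (?y + (a \<bullet> j) *\<^sub>R j) - u x)
        \<le> norm (u (?y + (a \<bullet> j) *\<^sub>R j) - u ?y) + norm (u ?y - u x)" by norm
    ultimately show ?case using insert by (simp add: add_ac)
  qed simp
  from this[of Basis] have "norm (u (x + a) - u x) \<le> (\<Sum>i\<in>Basis. C * \<bar>a \<bullet> i\<bar>)"
    by (simp add: euclidean_representation)
  also have "\<dots> \<le> (\<Sum>i\<in>(Basis::'x set). C * norm a)"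
    using C0 by (intro sum_mono mult_left_mono) (auto simp: Basis_le_norm)
  finally show ?thesis by (simp add: mult.assoc)
qed

text \<open>The Lipschitz bound is used twice: on each partial derivative, and then on the increment
  \<open>u (x + a) - u x\<close>, whose partial derivatives the first use has made small.\<close>

lemma second_difference_bound:
  fixes u :: "'x::euclidean_space \<Rightarrow> 'b::real_normed_vector"
  assumes d: "\<And>x i. i \<in> Basis \<Longrightarrow> ((\<lambda>s. u (x + s *\<^sub>R i)) has_vector_derivative u' i x) (at 0)"
    and d2: "\<And>x i j. i \<in> Basis \<Longrightarrow> j \<in> Basis \<Longrightarrow>
        ((\<lambda>s. u' i (x + s *\<^sub>R j)) has_vector_derivative u'' j i x) (at 0)"
    and b: "\<And>x i j. i \<in> Basis \<Longrightarrow> j \<in> Basis \<Longrightarrow> norm (u'' j i x) \<le> C"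
  shows "norm ((u (x + c + a) - u (x + c)) - (u (x + a) - u x)) \<le> (real DIM('x))\<^sup>2 * C * norm a * norm c"
proof -
  have "norm ((\<lambda>x. u (x + a) - u x) (x + c) - (\<lambda>x. u (x + a) - u x) x)
      \<le> real DIM('x) * (real DIM('x) * C * norm a) * norm c"
  proof (rule lipschitz_of_bounded_partials[where u'="\<lambda>i x. u' i (x + a) - u' i x"])
    fix x i :: 'x assume i: "i \<in> Basis"
    show "((\<lambda>s. u (x + s *\<^sub>R i + a) - u (x + s *\<^sub>R i)) has_vector_derivative u' i (x + a) - u' i x) (at 0)"
      using has_vector_derivative_diff[OF d[OF i, of "x + a"] d[OF i, of x]] by (simp add: add_ac)
    show "norm (u' i (x + a) - u' i x) \<le> real DIM('x) * C * norm a"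
      using i by (intro lipschitz_of_bounded_partials[where u'="\<lambda>j. u'' j i"] d2 b)
  qed
  then show ?thesis by (simp add: power2_eq_square mult_ac)
qed

text \<open>Along two fixed directions the same argument costs no factor of the dimension, so that
  bounds on derivatives of the data carry over to differences with the same constant.\<close>

lemma directional_second_difference_bound:
  fixes u :: "'x::real_vector \<Rightarrow> 'b::real_normed_vector"
  assumes d: "\<And>x. ((\<lambda>s. u (x + s *\<^sub>R i)) has_vector_derivative u' x) (at 0)"
    and d2: "\<And>x. ((\<lambda>s. u' (x + s *\<^sub>R j)) has_vector_derivative u'' x) (at 0)"
    and b: "\<And>x. norm (u'' x) \<le> C"
  shows "norm ((u (x + r *\<^sub>R j + s *\<^sub>R i) - u (x + r *\<^sub>R j)) - (u (x + s *\<^sub>R i) - u x)) \<le> C * \<bar>s\<bar> * \<bar>r\<bar>"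
proof -
  have "norm ((\<lambda>x. u (x + r *\<^sub>R j) - u x) (x + s *\<^sub>R i) - (\<lambda>x. u (x + r *\<^sub>R j) - u x) x)
      \<le> (C * \<bar>r\<bar>) * \<bar>s\<bar>"
  proof (rule directional_mean_value_bound[where u'="\<lambda>x. u' (x + r *\<^sub>R j) - u' x"])
    fix x
    show "((\<lambda>s. u (x + s *\<^sub>R i + r *\<^sub>R j) - u (x + s *\<^sub>R i)) has_vector_derivative
        u' (x + r *\<^sub>R j) - u' x) (at 0)"
      using has_vector_derivative_diff[OF d[of "x + r *\<^sub>R j"] d[of x]] by (simp add: add_ac)
    show "norm (u' (x + r *\<^sub>R j) - u' x) \<le> C * \<bar>r\<bar>"
      by (rule directional_mean_value_bound[OF d2 b])
  qed
  then show ?thesis by (simp add: algebra_simps)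
qed

text \<open>The way back from differences to derivatives: the maximum principle yields Lipschitz
  bounds for finite steps, and these become bounds for partial derivatives.\<close>

lemma partial_bound_of_difference_bound:
  fixes u :: "'x::real_vector \<Rightarrow> 'b::real_normed_vector"
  assumes d: "((\<lambda>s. u (x + s *\<^sub>R i)) has_vector_derivative D) (at 0)"
    and b: "\<And>s. s > 0 \<Longrightarrow> norm (u (x + s *\<^sub>R i) - u x) \<le> C * s"
  shows "norm D \<le> C"
proof (rule field_le_epsilon)
  fix e :: real assume e: "e > 0"
  from d e obtain \<delta> where \<delta>: "\<delta> > 0"
    "\<And>s. \<bar>s\<bar> < \<delta> \<Longrightarrow> norm (u (x + s *\<^sub>R i) - u x - s *\<^sub>R D) \<le> e * \<bar>s\<bar>"
    unfolding has_vector_derivative_def has_derivative_at_alt by (auto simp: mult.commute)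
  define s where "s = \<delta> / 2"
  have s: "s > 0" "\<bar>s\<bar> < \<delta>" using \<delta> by (auto simp: s_def)
  have "norm v \<le> norm c + norm (c - v)" for c v :: 'b by norm
  then have "norm (s *\<^sub>R D) \<le> norm (u (x + s *\<^sub>R i) - u x) + norm (u (x + s *\<^sub>R i) - u x - s *\<^sub>R D)"
    by blast
  also have "\<dots> \<le> C * s + e * s" using b[OF s(1)] \<delta>(2)[OF s(2)] s by (intro add_mono) auto
  finally show "norm D \<le> C + e" using s by (simp add: distrib_right[symmetric] mult.commute)
qed

text \<open>The number of summands is counted as one more factor \<open>R\<close>, so that later
  estimates become polynomials in \<open>R\<close> alone.\<close>

lemma norm_sum_Basis_le:
  fixes a :: "'x::euclidean_space" and v :: "'x \<Rightarrow> 'b::real_normed_vector"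
  assumes v: "\<And>k. k \<in> Basis \<Longrightarrow> norm (v k) \<le> V" and a: "norm a \<le> A"
    and n: "real DIM('x) \<le> R"
  shows "norm (\<Sum>k\<in>Basis. (a \<bullet> k) *\<^sub>R v k) \<le> R * (A * V)" "norm (\<Sum>k\<in>Basis. v k) \<le> R * V"
proof -
  have V: "V \<ge> 0" using v[OF SOME_Basis] norm_ge_zero order_trans by blast
  have A: "A \<ge> 0" using a norm_ge_zero order_trans by blast
  have "norm (\<Sum>k\<in>Basis. (a \<bullet> k) *\<^sub>R v k) \<le> (\<Sum>k\<in>(Basis::'x set). A * V)"
  proof (intro order_trans[OF norm_sum] sum_mono)
    fix k :: 'x assume k: "k \<in> Basis"
    have "\<bar>a \<bullet> k\<bar> \<le> A" using Basis_le_norm[OF k, of a] a by simp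
    then show "norm ((a \<bullet> k) *\<^sub>R v k) \<le> A * V" using v[OF k] A by (simp add: mult_mono)
  qed
  also have "\<dots> \<le> R * (A * V)" using n V A by (simp add: mult_right_mono)
  finally show "norm (\<Sum>k\<in>Basis. (a \<bullet> k) *\<^sub>R v k) \<le> R * (A * V)" .
  have "norm (\<Sum>k\<in>Basis. v k) \<le> (\<Sum>k\<in>(Basis::'x set). V)"
    using v by (intro order_trans[OF norm_sum] sum_mono) auto
  also have "\<dots> \<le> R * V" using n V by (simp add: mult_right_mono)
  finally show "norm (\<Sum>k\<in>Basis. v k) \<le> R * V" .
qed

text \<open>The step is applied to the supremum over \<open>Z\<close>, which is finite thanks to
  \<open>C\<close>. As \<open>C\<close> does not appear in the conclusion, a bound that may depend
  on the solution turns into one that depends on \<open>a\<close> and \<theta> only.\<close>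

lemma absorb_bound:
  fixes \<phi> :: "'z \<Rightarrow> real"
  assumes b: "\<And>z. z \<in> Z \<Longrightarrow> \<phi> z \<le> C" and \<theta>: "\<theta> < 1"
    and step: "\<And>U z. (\<And>z. z \<in> Z \<Longrightarrow> \<phi> z \<le> U) \<Longrightarrow> z \<in> Z \<Longrightarrow> \<phi> z \<le> a + \<theta> * U"
    and z: "z \<in> Z"
  shows "\<phi> z \<le> a / (1 - \<theta>)"
proof -
  define U where "U = Sup (\<phi> ` Z)"
  have bdd: "bdd_above (\<phi> ` Z)" using b by (auto intro!: bdd_aboveI[of _ C])
  have U: "\<phi> z \<le> U" if "z \<in> Z" for z
    unfolding U_def using that bdd by (intro cSup_upper) auto
  have "\<phi> y \<le> a + \<theta> * U" if "y \<in> Z" for y using step[OF U that] .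
  then have "Sup (\<phi> ` Z) \<le> a + \<theta> * U" using z by (intro cSup_least) auto
  then have "U \<le> a + \<theta> * U" by (simp only: U_def[symmetric])
  then have "U \<le> a / (1 - \<theta>)" using \<theta> by (simp add: field_simps)
  with U[OF z] show ?thesis by simp
qed

text \<open>The derivatives are parameters rather than expressions in \<open>w\<close>, so that for
  shifts and differences of evolutions they are again shifts and differences. Only pure second
  derivatives occur, being all that the Laplacian involves, and for \<open>\<nu> = 0\<close> nothing
  is asked of \<open>w2\<close>.\<close>

definition regular_evolution :: "real \<Rightarrow> real \<Rightarrow> (real \<Rightarrow> 'x::euclidean_space \<Rightarrow> 'b::real_inner) \<Rightarrow>
    ('x \<Rightarrow> real \<Rightarrow> 'x \<Rightarrow> 'b) \<Rightarrow> ('x \<Rightarrow> real \<Rightarrow> 'x \<Rightarrow> 'b) \<Rightarrow> (real \<Rightarrow> 'x \<Rightarrow> 'b) \<Rightarrow> bool" where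
  "regular_evolution \<nu> \<tau> w w1 w2 wt \<longleftrightarrow>
     continuous_on ({0..\<tau>} \<times> UNIV) (\<lambda>(t,x). w t x) \<and>
     (\<exists>C. \<forall>t\<in>{0..\<tau>}. \<forall>x. norm (w t x) \<le> C) \<and>
     (\<forall>t\<in>{0..\<tau>}. \<forall>x. ((\<lambda>s. w s x) has_vector_derivative wt t x) (at t within {0..\<tau>})) \<and>
     (\<forall>t\<in>{0..\<tau>}. \<forall>x. \<forall>i\<in>Basis. ((\<lambda>s. w t (x + s *\<^sub>R i)) has_vector_derivative w1 i t x) (at 0)) \<and>
     (0 < \<nu> \<longrightarrow> (\<forall>t\<in>{0..\<tau>}. \<forall>x. \<forall>i\<in>Basis.
        ((\<lambda>s. w1 i t (x + s *\<^sub>R i)) has_vector_derivative w2 i t x) (at 0)))"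

lemma regular_evolution_diff:
  assumes "regular_evolution \<nu> \<tau> u u1 u2 ut" "regular_evolution \<nu> \<tau> v v1 v2 vt"
  shows "regular_evolution \<nu> \<tau> (\<lambda>t x. u t x - v t x) (\<lambda>i t x. u1 i t x - v1 i t x)
     (\<lambda>i t x. u2 i t x - v2 i t x) (\<lambda>t x. ut t x - vt t x)"
proof -
  obtain C D where "\<And>t x. t \<in> {0..\<tau>} \<Longrightarrow> norm (u t x) \<le> C" "\<And>t x. t \<in> {0..\<tau>} \<Longrightarrow> norm (v t x) \<le> D"
    using assms unfolding regular_evolution_def by metis
  then have "\<forall>t\<in>{0..\<tau>}. \<forall>x. norm (u t x - v t x) \<le> C + D"
    by (meson add_mono norm_triangle_ineq4 order_trans)
  moreover have "continuous_on ({0..\<tau>} \<times> UNIV) (\<lambda>(t,x). u t x - v t x)"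
    using assms unfolding regular_evolution_def case_prod_beta by (intro continuous_on_diff) auto
  ultimately show ?thesis
    unfolding regular_evolution_def
  proof (intro conjI impI ballI allI exI[of _ "C + D"])
    fix t x assume t: "t \<in> {0..\<tau>}"
    show "((\<lambda>s. u s x - v s x) has_vector_derivative ut t x - vt t x) (at t within {0..\<tau>})"
      using assms t unfolding regular_evolution_def by (intro has_vector_derivative_diff) blast+
    fix i :: 'a assume i: "i \<in> Basis"
    show "((\<lambda>s. u t (x + s *\<^sub>R i) - v t (x + s *\<^sub>R i)) has_vector_derivative u1 i t x - v1 i t x) (at 0)"
      using assms t i unfolding regular_evolution_def by (intro has_vector_derivative_diff) blast+
    assume \<nu>: "0 < \<nu>"
    show "((\<lambda>s. u1 i t (x + s *\<^sub>R i) - v1 i t (x + s *\<^sub>R i)) has_vector_derivative u2 i t x - v2 i t x) (at 0)"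
      using assms t i \<nu> unfolding regular_evolution_def by (intro has_vector_derivative_diff) blast+
  qed simp_all
qed

lemma regular_evolution_shift:
  assumes "regular_evolution \<nu> \<tau> u u1 u2 ut"
  shows "regular_evolution \<nu> \<tau> (\<lambda>t x. u t (x + \<delta>)) (\<lambda>i t x. u1 i t (x + \<delta>))
     (\<lambda>i t x. u2 i t (x + \<delta>)) (\<lambda>t x. ut t (x + \<delta>))"
proof -
  have c: "continuous_on ({0..\<tau>} \<times> UNIV) (\<lambda>z. u (fst z) (snd z))"
    using assms unfolding regular_evolution_def case_prod_beta by auto
  have "continuous_on ({0..\<tau>} \<times> UNIV) (\<lambda>z. u (fst z) (snd z + \<delta>))"
    using continuous_on_compose2[OF c, of "{0..\<tau>} \<times> UNIV" "\<lambda>z. (fst z, snd z + \<delta>)"]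
    by (force intro!: continuous_intros)
  moreover have sh: "x + s *\<^sub>R i + \<delta> = (x + \<delta>) + s *\<^sub>R i" for x i and s :: real by simp
  moreover obtain C where "\<forall>t\<in>{0..\<tau>}. \<forall>x. norm (u t x) \<le> C"
    using assms unfolding regular_evolution_def by blast
  ultimately show ?thesis
    unfolding regular_evolution_def case_prod_beta sh
    by (intro conjI exI[of _ C])
      (use assms in \<open>simp_all add: regular_evolution_def\<close>)
qed

lemma regular_evolution_subinterval:
  assumes "regular_evolution \<nu> \<tau> u u1 u2 ut" "\<tau>' \<le> \<tau>"
  shows "regular_evolution \<nu> \<tau>' u u1 u2 ut"
proof -
  have sub: "{0..\<tau>'} \<subseteq> {0..\<tau>}" using assms by auto
  then have "{0..\<tau>'} \<times> (UNIV::'a set) \<subseteq> {0..\<tau>} \<times> UNIV" by auto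
  then have c: "continuous_on ({0..\<tau>'} \<times> UNIV) (\<lambda>(t,x). u t x)"
    using assms(1) continuous_on_subset unfolding regular_evolution_def by blast
  have d: "((\<lambda>s. u s x) has_vector_derivative ut t x) (at t within {0..\<tau>'})" if "t \<in> {0..\<tau>'}" for t x
    using assms(1) sub that has_vector_derivative_within_subset[of _ _ t "{0..\<tau>}" "{0..\<tau>'}"]
    unfolding regular_evolution_def by blast
  obtain C where C: "\<forall>t\<in>{0..\<tau>}. \<forall>x. norm (u t x) \<le> C"
    using assms(1) unfolding regular_evolution_def by blast
  show ?thesis
    unfolding regular_evolution_def
  proof (intro conjI impI ballI allI exI[of _ C])
    fix t x assume t: "t \<in> {0..\<tau>'}"
    then have t': "t \<in> {0..\<tau>}" using sub by blast
    show "norm (u t x) \<le> C" using C t' by blast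
    fix i :: 'a assume i: "i \<in> Basis"
    show "((\<lambda>s. u t (x + s *\<^sub>R i)) has_vector_derivative u1 i t x) (at 0)"
      using assms(1) t' i unfolding regular_evolution_def by blast
    assume "0 < \<nu>"
    then show "((\<lambda>s. u1 i t (x + s *\<^sub>R i)) has_vector_derivative u2 i t x) (at 0)"
      using assms(1) t' i unfolding regular_evolution_def by blast
  qed (use c d in auto)
qed

text \<open>The operator acts on every component by the same scalar expression. Pairing with the
  unit vector that points along \<open>w t x\<close> at the chosen point therefore reduces the claim
  to the scalar principle, with no factor of the dimension lost.\<close>

lemma vector_max_principle:
  fixes w :: "real \<Rightarrow> 'x::euclidean_space \<Rightarrow> 'b::real_inner"
  assumes \<nu>: "0 \<le> \<nu>"
    and reg: "regular_evolution \<nu> \<tau> w w1 w2 wt"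
    and b: "\<And>t x. t \<in> {0..\<tau>} \<Longrightarrow> norm (b t x) \<le> bm"
    and eq: "\<And>t x. t \<in> {0..\<tau>} \<Longrightarrow>
        norm (wt t x - \<nu> *\<^sub>R (\<Sum>i\<in>Basis. w2 i t x) + (\<Sum>i\<in>Basis. (b t x \<bullet> i) *\<^sub>R w1 i t x)) \<le> A"
    and init: "\<And>x. norm (w 0 x) \<le> W0"
    and t: "t \<in> {0..\<tau>}"
  shows "norm (w t x) \<le> W0 + A * t"
proof (cases "w t x = 0")
  case True
  have "A \<ge> 0" using eq[OF t] norm_ge_zero order_trans by blast
  moreover have "W0 \<ge> 0" using init norm_ge_zero order_trans by blast
  ultimately show ?thesis using True t by simp
next
  case False
  define e where "e = w t x /\<^sub>R norm (w t x)"
  have e1: "norm e = 1" using False by (simp add: e_def)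
  have le: "v \<bullet> e \<le> norm v" for v using norm_cauchy_schwarz[of v e] e1 by simp
  have der: "((\<lambda>s. g s \<bullet> e) has_real_derivative g' \<bullet> e) F" if "(g has_vector_derivative g') F"
    for g :: "real \<Rightarrow> 'b" and g' F
    using bounded_linear.has_vector_derivative[OF bounded_linear_inner_left that, of e]
    by (simp add: has_real_derivative_iff_has_vector_derivative)
  obtain C where C: "\<And>t x. t \<in> {0..\<tau>} \<Longrightarrow> norm (w t x) \<le> C"
    using reg unfolding regular_evolution_def by metis
  have "w t x \<bullet> e \<le> W0 + A * t"
  proof (rule scalar_max_principle[where p="\<lambda>t x. w t x \<bullet> e" and pt="\<lambda>t x. wt t x \<bullet> e"
        and ?p1.0="\<lambda>i t x. w1 i t x \<bullet> e" and ?p2.0="\<lambda>i t x. w2 i t x \<bullet> e", OF \<nu> _ _ _ _ _ b _ _ t])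
    show "continuous_on ({0..\<tau>} \<times> UNIV) (\<lambda>(t, x). w t x \<bullet> e)"
      using reg unfolding regular_evolution_def case_prod_beta by (intro continuous_intros) auto
    show "w t x \<bullet> e \<le> C" if "t \<in> {0..\<tau>}" for t x using le C that order_trans by blast
    show "w 0 x \<bullet> e \<le> W0" for x using le init order_trans by blast
    show "((\<lambda>s. w s x \<bullet> e) has_real_derivative wt t x \<bullet> e) (at t within {0..\<tau>})" if "t \<in> {0..\<tau>}" for t x
      using reg that unfolding regular_evolution_def by (intro der) auto
    show "((\<lambda>s. w t (x + s *\<^sub>R i) \<bullet> e) has_real_derivative w1 i t x \<bullet> e) (at 0)"
      if "t \<in> {0..\<tau>}" "i \<in> Basis" for t x i
      using reg that unfolding regular_evolution_def by (intro der) auto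
    show "((\<lambda>s. w1 i t (x + s *\<^sub>R i) \<bullet> e) has_real_derivative w2 i t x \<bullet> e) (at 0)"
      if "0 < \<nu>" "t \<in> {0..\<tau>}" "i \<in> Basis" for t x i
      using reg that unfolding regular_evolution_def by (intro der) auto
    show "wt t x \<bullet> e \<le> \<nu> * (\<Sum>i\<in>Basis. w2 i t x \<bullet> e) - (\<Sum>i\<in>Basis. (b t x \<bullet> i) * (w1 i t x \<bullet> e)) + A"
      if "t \<in> {0..\<tau>}" for t x
      using order_trans[OF le eq[OF that, of x]]
      by (simp add: inner_add_left inner_diff_left inner_sum_left)
  qed
  moreover have "w t x \<bullet> e = norm (w t x)"
    using False by (simp add: e_def dot_square_norm power2_eq_square)
  ultimately show ?thesis by simp
qed

section \<open>Hoelder spaces and the pathwise equation\<close>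

lemma Cb_hoelder_subinterval:
  assumes "Cb_hoelder \<beta> l a b u" "b' \<le> b"
  shows "Cb_hoelder \<beta> l a b' u"
proof -
  have sub: "{a..b'} \<subseteq> {a..b}" using assms by auto
  then have sub2: "{a..b'} \<times> (UNIV::'a set) \<subseteq> {a..b} \<times> UNIV" by auto
  obtain C where C: "\<forall>t\<in>{a..b}. \<forall>s\<in>{a..b}. \<forall>x. norm (u t x - u s x) \<le> C * \<bar>t - s\<bar> powr (\<beta> / 2)"
    using assms(1) unfolding Cb_hoelder_def by blast
  show ?thesis unfolding Cb_hoelder_def
  proof (intro conjI allI impI ballI exI[of _ C])
    show "has_pds_upto l (u t)" if "t \<in> {a..b'}" for t
      using assms(1) sub that unfolding Cb_hoelder_def by blast
    fix \<alpha> :: "'a list" assume "set \<alpha> \<subseteq> Basis \<and> length \<alpha> \<le> l"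
    then have 1: "continuous_on ({a..b} \<times> UNIV) (\<lambda>(t,x). pds \<alpha> (u t) x)"
       "bounded ((\<lambda>(t,x). pds \<alpha> (u t) x) ` ({a..b} \<times> UNIV))"
      using assms(1) unfolding Cb_hoelder_def by blast+
    show "continuous_on ({a..b'} \<times> UNIV) (\<lambda>(t,x). pds \<alpha> (u t) x)"
      using 1(1) sub2 by (rule continuous_on_subset)
    show "bounded ((\<lambda>(t,x). pds \<alpha> (u t) x) ` ({a..b'} \<times> UNIV))"
      using 1(2) image_mono[OF sub2] by (rule bounded_subset)
  next
    show "norm (u t x - u s x) \<le> C * \<bar>t - s\<bar> powr (\<beta> / 2)" if "t \<in> {a..b'}" "s \<in> {a..b'}" for t s x
      using C that sub by blast
  qed
qed

lemma Cb_hoelder_deriv: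
  assumes "Cb_hoelder \<beta> l a b u" "t \<in> {a..b}" "set \<alpha> \<subseteq> Basis" "i \<in> Basis" "length \<alpha> < l"
  shows "((\<lambda>s. pds \<alpha> (u t) (x + s *\<^sub>R i)) has_vector_derivative pds (i # \<alpha>) (u t) x) (at 0)"
  using assms unfolding Cb_hoelder_def has_pds_upto_def by blast

lemma Cb_hoelder_cont:
  assumes "Cb_hoelder \<beta> l a b u" "set \<alpha> \<subseteq> Basis" "length \<alpha> \<le> l"
  shows "continuous_on ({a..b} \<times> UNIV) (\<lambda>(t,x). pds \<alpha> (u t) x)"
    and "continuous_on {a..b} (\<lambda>t. pds \<alpha> (u t) x)"
proof -
  show 1: "continuous_on ({a..b} \<times> UNIV) (\<lambda>(t,x). pds \<alpha> (u t) x)"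
    using assms unfolding Cb_hoelder_def by blast
  show "continuous_on {a..b} (\<lambda>t. pds \<alpha> (u t) x)"
    using continuous_on_compose2[OF 1, of "{a..b}" "\<lambda>t. (t, x)"]
    by (force intro!: continuous_intros)
qed

lemma Cb_hoelder_bound:
  fixes u :: "real \<Rightarrow> 'x::euclidean_space \<Rightarrow> 'b::real_normed_vector"
  assumes "Cb_hoelder \<beta> l a b u"
  obtains C where "C \<ge> 0"
    "\<And>\<alpha> t x. set \<alpha> \<subseteq> Basis \<Longrightarrow> length \<alpha> \<le> l \<Longrightarrow> t \<in> {a..b} \<Longrightarrow> norm (pds \<alpha> (u t) x) \<le> C"
proof -
  let ?I = "{\<alpha> :: 'x list. set \<alpha> \<subseteq> Basis \<and> length \<alpha> \<le> l}"
  have fin: "finite ?I" by (rule finite_lists_length_le) simp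
  have "\<exists>c. \<forall>t\<in>{a..b}. \<forall>x. norm (pds \<alpha> (u t) x) \<le> c" if "\<alpha> \<in> ?I" for \<alpha>
  proof -
    have "bounded ((\<lambda>(t,x). pds \<alpha> (u t) x) ` ({a..b} \<times> UNIV))"
      using assms that unfolding Cb_hoelder_def by blast
    then obtain c where "\<And>z. z \<in> (\<lambda>(t,x). pds \<alpha> (u t) x) ` ({a..b} \<times> UNIV) \<Longrightarrow> norm z \<le> c"
      unfolding bounded_iff by metis
    then have "norm (pds \<alpha> (u t) x) \<le> c" if "t \<in> {a..b}" for t x
      using that by (metis (mono_tags, lifting) SigmaI UNIV_I case_prod_conv image_eqI)
    then show ?thesis by blast
  qed
  then obtain c where c: "\<And>\<alpha> t x. \<alpha> \<in> ?I \<Longrightarrow> t \<in> {a..b} \<Longrightarrow> norm (pds \<alpha> (u t) x) \<le> c \<alpha>" by metis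
  show ?thesis
  proof
    show "0 \<le> (\<Sum>\<alpha>\<in>?I. \<bar>c \<alpha>\<bar>)" by (intro sum_nonneg) auto
    fix \<alpha> :: "'x list" and t x assume a: "set \<alpha> \<subseteq> Basis" "length \<alpha> \<le> l" "t \<in> {a..b}"
    then have "norm (pds \<alpha> (u t) x) \<le> \<bar>c \<alpha>\<bar>" using c[of \<alpha> t x] by force
    also have "\<dots> \<le> (\<Sum>\<alpha>\<in>?I. \<bar>c \<alpha>\<bar>)" using a fin by (intro member_le_sum) auto
    finally show "norm (pds \<alpha> (u t) x) \<le> (\<Sum>\<alpha>\<in>?I. \<bar>c \<alpha>\<bar>)" .
  qed
qed

text \<open>Only \<open>u\<close> itself is assumed Hoelder in time uniformly in space; interpolation with the
  derivative of one order higher gives uniform continuity in time of the lower derivatives.\<close>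
lemma Cb_hoelder_uniform_in_time:
  fixes u :: "real \<Rightarrow> 'x::euclidean_space \<Rightarrow> 'b::real_normed_vector"
  assumes u: "Cb_hoelder \<beta> l a b u" and \<beta>: "0 < \<beta>" and "set \<alpha> \<subseteq> Basis" "length \<alpha> < l" "e > 0"
  shows "\<exists>d>0. \<forall>s\<in>{a..b}. \<forall>t\<in>{a..b}. \<bar>t - s\<bar> < d \<longrightarrow> (\<forall>x. norm (pds \<alpha> (u t) x - pds \<alpha> (u s) x) \<le> e)"
  using assms(3-5)
proof (induction \<alpha> arbitrary: e)
  case Nil
  obtain C where C: "\<forall>t\<in>{a..b}. \<forall>s\<in>{a..b}. \<forall>x. norm (u t x - u s x) \<le> C * \<bar>t - s\<bar> powr (\<beta> / 2)"
    using u unfolding Cb_hoelder_def by blast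
  define D where "D = \<bar>C\<bar> + 1"
  define d where "d = (e / D) powr (2 / \<beta>)"
  have D: "D > 0" "C \<le> D" by (auto simp: D_def)
  have d: "d > 0" using Nil D by (simp add: d_def)
  have "norm (u t x - u s x) \<le> e" if "s \<in> {a..b}" "t \<in> {a..b}" "\<bar>t - s\<bar> < d" for s t x
  proof -
    have "norm (u t x - u s x) \<le> C * \<bar>t - s\<bar> powr (\<beta> / 2)" using C that by blast
    also have "\<dots> \<le> D * \<bar>t - s\<bar> powr (\<beta> / 2)" using D by (intro mult_right_mono) auto
    also have "\<dots> \<le> D * d powr (\<beta> / 2)" using that D \<beta> by (intro mult_left_mono powr_mono2) auto
    also have "\<dots> = e" using Nil D \<beta> by (simp add: d_def powr_powr)
    finally show ?thesis .
  qed
  with d show ?case by auto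
next
  case (Cons i \<alpha>)
  obtain B where B: "B \<ge> 0"
    "\<And>\<alpha> t x. set \<alpha> \<subseteq> Basis \<Longrightarrow> length \<alpha> \<le> l \<Longrightarrow> t \<in> {a..b} \<Longrightarrow> norm (pds \<alpha> (u t) x) \<le> B"
    using Cb_hoelder_bound[OF u] by blast
  have i: "i \<in> Basis" and \<alpha>: "set \<alpha> \<subseteq> Basis" "length \<alpha> < l" "length (i # \<alpha>) < l" using Cons.prems by auto
  \<comment> \<open>With this interpolation step the second derivatives contribute at most
    \<open>e / 2\<close>; the tolerance \<open>e * r / 4\<close> asked of the lower derivative
    contributes the other half.\<close>
  define r where "r = e / (2 * (2 * B + 1))"
  have r: "r > 0" "2 * B * r \<le> e / 2" using B Cons.prems by (auto simp: r_def field_simps)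
  from Cons.IH[of "e * r / 4"] \<alpha> r Cons.prems obtain d where d: "d > 0"
    "\<And>s t x. s \<in> {a..b} \<Longrightarrow> t \<in> {a..b} \<Longrightarrow> \<bar>t - s\<bar> < d \<Longrightarrow> norm (pds \<alpha> (u t) x - pds \<alpha> (u s) x) \<le> e * r / 4"
    by auto
  have "norm (pds (i # \<alpha>) (u t) x - pds (i # \<alpha>) (u s) x) \<le> e"
    if st: "s \<in> {a..b}" "t \<in> {a..b}" "\<bar>t - s\<bar> < d" for s t x
  proof -
    have "norm (pds (i # \<alpha>) (u t) x - pds (i # \<alpha>) (u s) x) \<le> 2 * (e * r / 4) / r + (2 * B) * r"
    proof (rule interpolation_bound[where u="\<lambda>x. pds \<alpha> (u t) x - pds \<alpha> (u s) x"
          and u''="\<lambda>x. pds (i # i # \<alpha>) (u t) x - pds (i # i # \<alpha>) (u s) x"])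
      show "norm (pds (i # i # \<alpha>) (u t) x - pds (i # i # \<alpha>) (u s) x) \<le> 2 * B" for x
      proof -
        have "norm (pds (i # i # \<alpha>) (u t) x) \<le> B" "norm (pds (i # i # \<alpha>) (u s) x) \<le> B"
          using B(2)[of "i # i # \<alpha>"] i \<alpha> st by auto
        then show ?thesis
          using norm_triangle_ineq4[of "pds (i # i # \<alpha>) (u t) x" "pds (i # i # \<alpha>) (u s) x"] by linarith
      qed
      show "((\<lambda>s'. pds \<alpha> (u t) (x + s' *\<^sub>R i) - pds \<alpha> (u s) (x + s' *\<^sub>R i)) has_vector_derivative
          pds (i # \<alpha>) (u t) x - pds (i # \<alpha>) (u s) x) (at 0)" for x
        using i \<alpha> st by (intro has_vector_derivative_diff Cb_hoelder_deriv[OF u])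
      show "((\<lambda>s'. pds (i # \<alpha>) (u t) (x + s' *\<^sub>R i) - pds (i # \<alpha>) (u s) (x + s' *\<^sub>R i)) has_vector_derivative
          pds (i # i # \<alpha>) (u t) x - pds (i # i # \<alpha>) (u s) x) (at 0)" for x
      proof -
        have "set (i # \<alpha>) \<subseteq> Basis" using i \<alpha> by simp
        then show ?thesis using i \<alpha> st by (intro has_vector_derivative_diff Cb_hoelder_deriv[OF u])
      qed
      show "norm (pds \<alpha> (u t) x - pds \<alpha> (u s) x) \<le> e * r / 4" for x by (rule d(2)[OF st])
    qed (rule r)
    also have "\<dots> \<le> e" using r by (simp add: field_simps)
    finally show ?thesis .
  qed
  with d(1) show ?case by blast
qed

section \<open>The equation along a fixed noise path\<close>

definition burgers_drift :: "(real \<Rightarrow> real^'n \<Rightarrow> real^'n \<Rightarrow> real^'n) \<Rightarrow> real \<Rightarrow>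
    (real \<Rightarrow> real^'n \<Rightarrow> real^'n) \<Rightarrow> real \<Rightarrow> real^'n \<Rightarrow> real^'n" where
  "burgers_drift f \<nu> y s x = \<nu> *\<^sub>R lap (y s) x - adv (y s) x + f s x (y s x)"

definition burgers_path_sol :: "real \<Rightarrow> (real \<Rightarrow> real^'n \<Rightarrow> real^'n \<Rightarrow> real^'n) \<Rightarrow> (real^'n \<Rightarrow> real^'n) \<Rightarrow>
    (real \<Rightarrow> real^'n \<Rightarrow> real^'n) \<Rightarrow> real \<Rightarrow> nat \<Rightarrow> real \<Rightarrow> (real \<Rightarrow> real^'n \<Rightarrow> real^'n) \<Rightarrow> bool" where
  "burgers_path_sol \<beta> f h \<eta> \<tau> l \<nu> y \<longleftrightarrow> Cb_hoelder \<beta> l 0 \<tau> y \<and>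
     (\<forall>t\<in>{0..\<tau>}. \<forall>x. y t x = h x + integral {0..t} (\<lambda>s. burgers_drift f \<nu> y s x) + \<eta> t x)"

lemma burgers_path_sol_subinterval:
  assumes "burgers_path_sol \<beta> f h \<eta> \<tau> l \<nu> y" "\<tau>' \<le> \<tau>"
  shows "burgers_path_sol \<beta> f h \<eta> \<tau>' l \<nu> y"
proof -
  have "{0..\<tau>'} \<subseteq> {0..\<tau>}" using assms(2) by auto
  then show ?thesis
    using assms Cb_hoelder_subinterval[of \<beta> l 0 \<tau> y \<tau>'] unfolding burgers_path_sol_def by blast
qed

lemma continuous_on_burgers_drift:
  assumes f_cont: "continuous_on ({0..\<tau>} \<times> UNIV) (\<lambda>(t, p). f t (fst p) (snd p))"
    and y: "Cb_hoelder \<beta> l 0 \<tau> y" and l: "1 \<le> l" "\<nu> \<noteq> 0 \<Longrightarrow> 2 \<le> l"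
  shows "continuous_on {0..\<tau>} (\<lambda>s. burgers_drift f \<nu> y s x)"
proof -
  have 0: "continuous_on {0..\<tau>} (\<lambda>s. y s x)" using Cb_hoelder_cont(2)[OF y, of "[]"] by simp
  have 1: "continuous_on {0..\<tau>} (\<lambda>s. pd i (y s) x)" if "i \<in> Basis" for i
    using Cb_hoelder_cont(2)[OF y, of "[i]"] that l by simp
  have "continuous_on {0..\<tau>} (\<lambda>s. \<nu> *\<^sub>R lap (y s) x)"
  proof (cases "\<nu> = 0")
    case False
    have "continuous_on {0..\<tau>} (\<lambda>s. pd i (pd i (y s)) x)" if "i \<in> Basis" for i
      using Cb_hoelder_cont(2)[OF y, of "[i,i]"] that l False by simp
    then show ?thesis unfolding lap_def by (intro continuous_intros)
  qed simp
  moreover have "continuous_on {0..\<tau>} (\<lambda>s. f s x (y s x))"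
    using continuous_on_compose2[OF f_cont, of "{0..\<tau>}" "\<lambda>s. (s, (x, y s x))"] 0
    by (force intro!: continuous_intros)
  moreover have "continuous_on {0..\<tau>} (\<lambda>s. adv (y s) x)"
    unfolding adv_def by (intro continuous_intros 0 1)
  ultimately show ?thesis unfolding burgers_drift_def
    by (intro continuous_on_add continuous_on_diff)
qed

text \<open>One constant \<open>R\<close> dominates everything that limits the length of the time
  interval, including the dimension and the largest viscosity, and \<open>small\<close> is the only
  smallness condition. \<open>f\<close> and \<open>h\<close> are controlled through first and second
  differences, the form in which the maximum principle consumes them. \<open>N4\<close> stands
  apart: it enters only the Hessian bound and may be large compared with
  \<open>1 / \<tau>\<close>.\<close>

locale burgers_path =
  fixes \<tau> R N4 \<beta> \<nu>0 :: real
    and f :: "real \<Rightarrow> real^'n \<Rightarrow> real^'n \<Rightarrow> real^'n"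
    and h :: "real^'n \<Rightarrow> real^'n"
    and \<eta> :: "real \<Rightarrow> real^'n \<Rightarrow> real^'n"
  assumes tau: "0 \<le> \<tau>" and R1: "1 \<le> R" and small: "100 * \<tau> * R^3 \<le> 1"
    and nu0R: "\<nu>0 \<le> R" and dimR: "real DIM(real^'n) \<le> R" and beta: "0 < \<beta>" "\<beta> < 2"
    and f_bd: "t \<in> {0..\<tau>} \<Longrightarrow> norm (f t x z) \<le> R"
    and f_lip: "t \<in> {0..\<tau>} \<Longrightarrow> norm (f t x z - f t x' z') \<le> R * (norm (x - x') + norm (z - z'))"
    and f_lip2: "t \<in> {0..\<tau>} \<Longrightarrow> norm ((f t (x + a) (z + c) - f t x z) - (f t (x' + a) (z' + c) - f t x' z'))
        \<le> R * (norm a + norm c) * (norm (x - x') + norm (z - z'))"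
    and f_cont: "continuous_on ({0..\<tau>} \<times> UNIV) (\<lambda>(t, p). f t (fst p) (snd p))"
    and h_bd: "norm (h x) \<le> R"
    and h_lip: "i \<in> Basis \<Longrightarrow> norm (h (x + s *\<^sub>R i) - h x) \<le> R * \<bar>s\<bar>"
    and h_lip2: "i \<in> Basis \<Longrightarrow> j \<in> Basis \<Longrightarrow>
        norm ((h (x + r *\<^sub>R j + s *\<^sub>R i) - h (x + r *\<^sub>R j)) - (h (x + s *\<^sub>R i) - h x)) \<le> R * \<bar>s\<bar> * \<bar>r\<bar>"
    and eta_reg: "Cb_hoelder \<beta> 4 0 \<tau> \<eta>"
    and eta3: "set \<alpha> \<subseteq> Basis \<Longrightarrow> length \<alpha> \<le> 3 \<Longrightarrow> t \<in> {0..\<tau>} \<Longrightarrow> norm (pds \<alpha> (\<eta> t) x) \<le> R"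
    and eta4: "set \<alpha> \<subseteq> Basis \<Longrightarrow> length \<alpha> \<le> 4 \<Longrightarrow> t \<in> {0..\<tau>} \<Longrightarrow> norm (pds \<alpha> (\<eta> t) x) \<le> N4"
begin

abbreviation "drift \<equiv> burgers_drift f"

abbreviation "path_sol \<equiv> burgers_path_sol \<beta> f h \<eta> \<tau>"

lemma path_sol_initial: "path_sol l \<nu> y \<Longrightarrow> y 0 x - \<eta> 0 x = h x"
  using tau unfolding burgers_path_sol_def by auto

text \<open>What remains after removing \<eta> is the time integral of a continuous function, so
  there is a classical time derivative, equal to the drift of \<open>y\<close> itself. The inviscid
  case \<open>\<nu> = 0\<close>, \<open>l = 1\<close> is included.\<close>

lemma path_sol_evolution:
  assumes sol: "path_sol l \<nu> y" and l: "1 \<le> l" "\<nu> \<noteq> 0 \<Longrightarrow> 2 \<le> l"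
  shows "regular_evolution \<nu> \<tau> (\<lambda>t x. y t x - \<eta> t x) (\<lambda>i t x. pd i (y t) x - pd i (\<eta> t) x)
     (\<lambda>i t x. pd i (pd i (y t)) x - pd i (pd i (\<eta> t)) x) (drift \<nu> y)"
proof -
  have y: "Cb_hoelder \<beta> l 0 \<tau> y" using sol by (simp add: burgers_path_sol_def)
  obtain C where "0 \<le> C"
    and C: "\<And>\<alpha> t x. set \<alpha> \<subseteq> Basis \<Longrightarrow> length \<alpha> \<le> l \<Longrightarrow> t \<in> {0..\<tau>} \<Longrightarrow> norm (pds \<alpha> (y t) x) \<le> C"
    using Cb_hoelder_bound[OF y] by blast
  show ?thesis unfolding regular_evolution_def
  proof (intro conjI impI ballI allI exI[of _ "C + R"])
    show "continuous_on ({0..\<tau>} \<times> UNIV) (\<lambda>(t, x). y t x - \<eta> t x)"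
      using Cb_hoelder_cont(1)[OF y, of "[]"] Cb_hoelder_cont(1)[OF eta_reg, of "[]"]
      unfolding case_prod_beta by (intro continuous_on_diff) auto
    fix t x assume t: "t \<in> {0..\<tau>}"
    have "norm (y t x) \<le> C" "norm (\<eta> t x) \<le> R" using C[of "[]"] eta3[of "[]"] t by auto
    then show "norm (y t x - \<eta> t x) \<le> C + R" by (meson add_mono norm_triangle_ineq4 order_trans)
    have "((\<lambda>s. h x + integral {0..s} (\<lambda>s. drift \<nu> y s x)) has_vector_derivative 0 + drift \<nu> y t x) (at t within {0..\<tau>})"
      by (intro has_vector_derivative_add has_vector_derivative_const integral_has_vector_derivative
          continuous_on_burgers_drift[OF f_cont y l] t)
    then have D: "((\<lambda>s. h x + integral {0..s} (\<lambda>s. drift \<nu> y s x)) has_vector_derivative drift \<nu> y t x) (at t within {0..\<tau>})"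
      by simp
    have eq: "y s x - \<eta> s x = h x + integral {0..s} (\<lambda>s. drift \<nu> y s x)" if "s \<in> {0..\<tau>}" for s
    proof -
      have "y s x = h x + integral {0..s} (\<lambda>s. drift \<nu> y s x) + \<eta> s x"
        using sol that unfolding burgers_path_sol_def by blast
      then show ?thesis by simp
    qed
    show "((\<lambda>s. y s x - \<eta> s x) has_vector_derivative drift \<nu> y t x) (at t within {0..\<tau>})"
      by (rule has_vector_derivative_transform[OF t eq D])
    fix i :: "real^'n" assume i: "i \<in> Basis"
    show "((\<lambda>s. y t (x + s *\<^sub>R i) - \<eta> t (x + s *\<^sub>R i)) has_vector_derivative pd i (y t) x - pd i (\<eta> t) x) (at 0)"
      using Cb_hoelder_deriv[OF y t, of "[]" i x] Cb_hoelder_deriv[OF eta_reg t, of "[]" i x] i l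
      by (auto intro: has_vector_derivative_diff)
    assume "0 < \<nu>"
    then show "((\<lambda>s. pd i (y t) (x + s *\<^sub>R i) - pd i (\<eta> t) (x + s *\<^sub>R i)) has_vector_derivative
        pd i (pd i (y t)) x - pd i (pd i (\<eta> t)) x) (at 0)"
      using Cb_hoelder_deriv[OF y t, of "[i]" i x] Cb_hoelder_deriv[OF eta_reg t, of "[i]" i x] i l
      by (auto intro: has_vector_derivative_diff)
  qed
qed

lemma R_small: "\<tau> * R \<le> 1 / 100" "\<tau> * R^2 \<le> 1 / 100" "\<tau> * R^3 \<le> 1 / 100"
proof -
  show 3: "\<tau> * R^3 \<le> 1 / 100" using small by simp
  have "R \<le> R^3" "R^2 \<le> R^3" using R1 power_increasing[of 1 3 R] power_increasing[of 2 3 R] by auto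
  then have "\<tau> * R \<le> \<tau> * R^3" "\<tau> * R^2 \<le> \<tau> * R^3" using tau by (auto intro!: mult_left_mono)
  then show "\<tau> * R \<le> 1 / 100" "\<tau> * R^2 \<le> 1 / 100" using 3 by auto
qed

end

section \<open>Pathwise a priori estimates\<close>

text \<open>\<open>Y\<close>, \<open>y1\<close>, \<open>y2\<close> stand for the value and the
  derivatives of a solution at a point, primes for the shifted point, \<open>e1\<close>,
  \<open>e2\<close> for derivatives of the noise. With the drift taken at the shifted point all
  second derivatives of the solution cancel, and the transport term leaves the product of a velocity
  increment and a gradient.\<close>

lemma first_difference_residual:
  fixes Y Y' :: "'x::euclidean_space" and y1 y1' y2 y2' e1 e1' e2 e2' :: "'x \<Rightarrow> 'b::real_normed_vector"
  shows "((\<nu> *\<^sub>R (\<Sum>k\<in>Basis. y2' k) - (\<Sum>k\<in>Basis. (Y' \<bullet> k) *\<^sub>R y1' k) + F')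
       - (\<nu> *\<^sub>R (\<Sum>k\<in>Basis. y2 k) - (\<Sum>k\<in>Basis. (Y \<bullet> k) *\<^sub>R y1 k) + F))
     - \<nu> *\<^sub>R (\<Sum>k\<in>Basis. (y2' k - e2' k) - (y2 k - e2 k))
     + (\<Sum>k\<in>Basis. (Y' \<bullet> k) *\<^sub>R ((y1' k - e1' k) - (y1 k - e1 k)))
   = \<nu> *\<^sub>R (\<Sum>k\<in>Basis. e2' k - e2 k) - (\<Sum>k\<in>Basis. (Y' \<bullet> k) *\<^sub>R (e1' k - e1 k))
     - (\<Sum>k\<in>Basis. ((Y' - Y) \<bullet> k) *\<^sub>R y1 k) + (F' - F)"
  by (simp add: sum_subtractf sum.distrib scaleR_diff_right scaleR_diff_left scaleR_add_right
      inner_diff_left algebra_simps)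

text \<open>The discrete product rule for a mixed second difference over the corners of a
  parallelogram; the digits tell which of the two shifts are applied. Each remaining product
  contains at most one second-order quantity of the solution, either a second difference of the
  velocity or a first difference of a gradient. This makes the Hessian estimate affine.\<close>

lemma second_difference_residual:
  fixes Y00 Y10 Y01 Y11 :: "'x::euclidean_space"
    and y00 y10 y01 y11 z00 z10 z01 z11 d00 d10 d01 d11 e00 e10 e01 e11 :: "'x \<Rightarrow> 'b::real_normed_vector"
  shows "(((\<nu> *\<^sub>R (\<Sum>k\<in>Basis. z11 k) - (\<Sum>k\<in>Basis. (Y11 \<bullet> k) *\<^sub>R y11 k) + F11)
        - (\<nu> *\<^sub>R (\<Sum>k\<in>Basis. z01 k) - (\<Sum>k\<in>Basis. (Y01 \<bullet> k) *\<^sub>R y01 k) + F01))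
       - ((\<nu> *\<^sub>R (\<Sum>k\<in>Basis. z10 k) - (\<Sum>k\<in>Basis. (Y10 \<bullet> k) *\<^sub>R y10 k) + F10)
        - (\<nu> *\<^sub>R (\<Sum>k\<in>Basis. z00 k) - (\<Sum>k\<in>Basis. (Y00 \<bullet> k) *\<^sub>R y00 k) + F00)))
     - \<nu> *\<^sub>R (\<Sum>k\<in>Basis. ((z11 k - e11 k) - (z01 k - e01 k)) - ((z10 k - e10 k) - (z00 k - e00 k)))
     + (\<Sum>k\<in>Basis. (Y11 \<bullet> k) *\<^sub>R (((y11 k - d11 k) - (y01 k - d01 k)) - ((y10 k - d10 k) - (y00 k - d00 k))))
   = \<nu> *\<^sub>R (\<Sum>k\<in>Basis. (e11 k - e01 k) - (e10 k - e00 k))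
     - (\<Sum>k\<in>Basis. (Y11 \<bullet> k) *\<^sub>R ((d11 k - d01 k) - (d10 k - d00 k)))
     - (\<Sum>k\<in>Basis. ((Y11 - Y01) \<bullet> k) *\<^sub>R (y01 k - y00 k))
     - (\<Sum>k\<in>Basis. ((Y11 - Y10) \<bullet> k) *\<^sub>R (y10 k - y00 k))
     - (\<Sum>k\<in>Basis. (((Y11 - Y01) - (Y10 - Y00)) \<bullet> k) *\<^sub>R y00 k)
     + ((F11 - F01) - (F10 - F00))"
  by (simp add: sum_subtractf sum.distrib scaleR_diff_right scaleR_diff_left scaleR_add_right
      inner_diff_left algebra_simps)

text \<open>With the velocity of the first solution as drift, only derivatives of the second
  survive, its Laplacian merely with the factor \<open>\<nu> - \<mu>\<close>; the noise terms
  cancel.\<close>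

lemma viscosity_difference_residual:
  fixes Y Z :: "'x::euclidean_space" and y1 z1 y2 z2 e1 e2 :: "'x \<Rightarrow> 'b::real_normed_vector"
  shows "((\<nu> *\<^sub>R (\<Sum>k\<in>Basis. y2 k) - (\<Sum>k\<in>Basis. (Y \<bullet> k) *\<^sub>R y1 k) + F)
       - (\<mu> *\<^sub>R (\<Sum>k\<in>Basis. z2 k) - (\<Sum>k\<in>Basis. (Z \<bullet> k) *\<^sub>R z1 k) + G))
     - \<nu> *\<^sub>R (\<Sum>k\<in>Basis. (y2 k - e2 k) - (z2 k - e2 k))
     + (\<Sum>k\<in>Basis. (Y \<bullet> k) *\<^sub>R ((y1 k - e1 k) - (z1 k - e1 k)))
   = (\<nu> - \<mu>) *\<^sub>R (\<Sum>k\<in>Basis. z2 k) - (\<Sum>k\<in>Basis. ((Y - Z) \<bullet> k) *\<^sub>R z1 k) + (F - G)"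
  by (simp add: sum_subtractf sum.distrib scaleR_diff_right scaleR_diff_left scaleR_add_right
      inner_diff_left algebra_simps)

lemma norm_scaleR_le:
  fixes v :: "'b::real_normed_vector"
  assumes "0 \<le> \<nu>" "\<nu> \<le> R" "norm v \<le> V"
  shows "norm (\<nu> *\<^sub>R v) \<le> R * V"
  using assms by (simp add: mult_mono')

section \<open>Bounds uniform in the viscosity\<close>

context burgers_path
begin

text \<open>Besides bounded terms the forcing of \<open>u\<close> is the transport of \<eta> by
  \<open>y\<close>, which is affine in the supremum \<open>U\<close> of \<open>u\<close>. Its slope
  times the length of the interval is \<theta>, at most 1/100, and is absorbed.\<close>

lemma path_sol_sup_bound:
  assumes sol: "path_sol 2 \<nu> y" and \<nu>: "0 < \<nu>" "\<nu> \<le> \<nu>0" and t: "t \<in> {0..\<tau>}"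
  shows "norm (y t x - \<eta> t x) \<le> 2 * R"
proof -
  have reg: "regular_evolution \<nu> \<tau> (\<lambda>t x. y t x - \<eta> t x) (\<lambda>i t x. pd i (y t) x - pd i (\<eta> t) x)
     (\<lambda>i t x. pd i (pd i (y t)) x - pd i (pd i (\<eta> t)) x) (drift \<nu> y)"
    using path_sol_evolution[OF sol] by simp
  then obtain C where C: "\<And>t x. t \<in> {0..\<tau>} \<Longrightarrow> norm (y t x - \<eta> t x) \<le> C"
    unfolding regular_evolution_def by metis
  define \<theta> where "\<theta> = \<tau> * R^2"
  have R0: "R \<ge> 0" using R1 by simp
  have "(\<lambda>z. norm (y (fst z) (snd z) - \<eta> (fst z) (snd z))) (t, x) \<le> (R + \<tau> * (2 * R^3 + R)) / (1 - \<theta>)"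
  proof (rule absorb_bound[where Z="{0..\<tau>} \<times> UNIV" and C=C])
    show "\<theta> < 1" using R_small by (simp add: \<theta>_def)
    fix U and z :: "real \<times> (real^'n)"
    assume "\<And>z. z \<in> {0..\<tau>} \<times> UNIV \<Longrightarrow> norm (y (fst z) (snd z) - \<eta> (fst z) (snd z)) \<le> U"
      and z: "z \<in> {0..\<tau>} \<times> UNIV"
    then have U: "norm (y t x - \<eta> t x) \<le> U" if "t \<in> {0..\<tau>}" for t x using that by force
    have U0: "0 \<le> U" using U[of 0 0] tau norm_ge_zero order_trans by (metis atLeastAtMost_iff order_refl)
    have yU: "norm (y t x) \<le> U + R" if "t \<in> {0..\<tau>}" for t x
      using U[OF that, of x] eta3[of "[]" t x] that norm_triangle_sub[of "y t x" "\<eta> t x"] by simp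
    define A where "A = R * (R * R) + R * ((U + R) * R) + R"
    have A0: "A \<ge> 0" using R0 U0 by (simp add: A_def)
    obtain s w where sw: "z = (s, w)" "s \<in> {0..\<tau>}" using z by force
    have "norm (y s w - \<eta> s w) \<le> R + A * s"
    proof (rule vector_max_principle[OF _ reg, where b=y])
      fix t x assume t: "t \<in> {0..\<tau>}"
      show "norm (y t x) \<le> U + R" by (rule yU[OF t])
      have e1: "norm (pd k (\<eta> t) x) \<le> R" and e2: "norm (pd k (pd k (\<eta> t)) x) \<le> R" if "k \<in> Basis" for k
        using eta3[of "[k]" t x] eta3[of "[k,k]" t x] t that by auto
      have 1: "norm (\<nu> *\<^sub>R (\<Sum>k\<in>Basis. pd k (pd k (\<eta> t)) x)) \<le> R * (R * R)"
        using \<nu> nu0R by (intro norm_scaleR_le norm_sum_Basis_le(2)[OF e2 order_refl dimR]) auto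
      have 2: "norm (\<Sum>k\<in>Basis. (y t x \<bullet> k) *\<^sub>R pd k (\<eta> t) x) \<le> R * ((U + R) * R)"
        by (intro norm_sum_Basis_le(1)[OF e1 yU[OF t] dimR])
      have tri: "norm (a - b + c) \<le> norm a + norm b + norm c" for a b c :: "real^'n" by norm
      have eq: "drift \<nu> y t x - \<nu> *\<^sub>R (\<Sum>k\<in>Basis. pd k (pd k (y t)) x - pd k (pd k (\<eta> t)) x)
          + (\<Sum>k\<in>Basis. (y t x \<bullet> k) *\<^sub>R (pd k (y t) x - pd k (\<eta> t) x))
        = \<nu> *\<^sub>R (\<Sum>k\<in>Basis. pd k (pd k (\<eta> t)) x) - (\<Sum>k\<in>Basis. (y t x \<bullet> k) *\<^sub>R pd k (\<eta> t) x) + f t x (y t x)"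
        unfolding burgers_drift_def lap_def adv_def
        by (simp add: sum_subtractf scaleR_diff_right algebra_simps)
      show "norm (drift \<nu> y t x - \<nu> *\<^sub>R (\<Sum>k\<in>Basis. pd k (pd k (y t)) x - pd k (pd k (\<eta> t)) x)
          + (\<Sum>k\<in>Basis. (y t x \<bullet> k) *\<^sub>R (pd k (y t) x - pd k (\<eta> t) x))) \<le> A"
        unfolding eq A_def by (rule order_trans[OF tri add_mono[OF add_mono[OF 1 2] f_bd[OF t]]])
    qed (use \<nu> sw h_bd path_sol_initial[OF sol] in auto)
    also have "\<dots> \<le> R + \<tau> * A" using sw A0 mult_left_mono[of s \<tau> A] by (simp add: mult.commute)
    also have "\<dots> = (R + \<tau> * (2 * R^3 + R)) + \<theta> * U"
      by (simp add: A_def \<theta>_def algebra_simps power2_eq_square power3_eq_cube)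
    finally show "norm (y (fst z) (snd z) - \<eta> (fst z) (snd z)) \<le> (R + \<tau> * (2 * R^3 + R)) + \<theta> * U"
      by (simp add: sw)
  qed (use C t in auto)
  also have "\<dots> \<le> 2 * R"
  proof -
    have "R + \<tau> * (2 * R^3 + R) \<le> R + 3/100" using R_small by (simp add: algebra_simps)
    also have "\<dots> \<le> 2 * R * (1 - 1/100)" using R1 by simp
    also have "\<dots> \<le> 2 * R * (1 - \<theta>)" using R_small R0 by (intro mult_left_mono) (auto simp: \<theta>_def)
    finally show ?thesis using R_small by (simp add: \<theta>_def pos_divide_le_eq)
  qed
  finally show ?thesis by simp
qed

lemma path_sol_sup_bound':
  assumes "path_sol 2 \<nu> y" "0 < \<nu>" "\<nu> \<le> \<nu>0" "t \<in> {0..\<tau>}"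
  shows "norm (y t x) \<le> 3 * R"
  using path_sol_sup_bound[OF assms, of x] eta3[of "[]" t x] assms norm_triangle_sub[of "y t x" "\<eta> t x"]
  by simp

lemma eta_difference:
  assumes "set \<alpha> \<subseteq> Basis" "length \<alpha> < 3" "t \<in> {0..\<tau>}" "i \<in> Basis"
  shows "norm (pds \<alpha> (\<eta> t) (x + s *\<^sub>R i) - pds \<alpha> (\<eta> t) x) \<le> R * \<bar>s\<bar>"
  using assms
  by (intro directional_mean_value_bound[where u'="pds (i # \<alpha>) (\<eta> t)"] Cb_hoelder_deriv[OF eta_reg] eta3) auto

lemma eta_second_difference:
  assumes "set \<alpha> \<subseteq> Basis" "length \<alpha> < 3" "t \<in> {0..\<tau>}" "i \<in> Basis" "j \<in> Basis"
    and c: "\<And>x. norm (pds (j # i # \<alpha>) (\<eta> t) x) \<le> C"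
  shows "norm ((pds \<alpha> (\<eta> t) (x + r *\<^sub>R j + s *\<^sub>R i) - pds \<alpha> (\<eta> t) (x + r *\<^sub>R j))
     - (pds \<alpha> (\<eta> t) (x + s *\<^sub>R i) - pds \<alpha> (\<eta> t) x)) \<le> C * \<bar>s\<bar> * \<bar>r\<bar>"
  using assms(1-5)
  by (intro directional_second_difference_bound[where u'="pds (i # \<alpha>) (\<eta> t)" and u''="pds (j # i # \<alpha>) (\<eta> t)"]
      Cb_hoelder_deriv[OF eta_reg] c) auto

text \<open>The improving half of a continuation argument: \<open>4 * R\<close> as a provisional
  bound returns \<open>2 * R\<close>. Absorption would fail here, since the product of the velocity
  increment and the gradient is quadratic in the unknown bound.\<close>

lemma path_sol_gradient_step:
  assumes sol: "path_sol 2 \<nu> y" and \<nu>: "0 < \<nu>" "\<nu> \<le> \<nu>0" and \<tau>': "0 \<le> \<tau>'" "\<tau>' \<le> \<tau>"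
    and pre: "\<And>t x k. t \<in> {0..\<tau>'} \<Longrightarrow> k \<in> Basis \<Longrightarrow> norm (pd k (y t) x - pd k (\<eta> t) x) \<le> 4 * R"
    and t: "t \<in> {0..\<tau>'}" and i: "i \<in> Basis"
  shows "norm (pd i (y t) x - pd i (\<eta> t) x) \<le> 2 * R"
proof -
  have R0: "R \<ge> 0" using R1 by simp
  have y: "Cb_hoelder \<beta> 2 0 \<tau> y" using sol by (simp add: burgers_path_sol_def)
  define u where "u = (\<lambda>t x. y t x - \<eta> t x)"
  define u1 where "u1 = (\<lambda>i t x. pd i (y t) x - pd i (\<eta> t) x)"
  define u2 where "u2 = (\<lambda>i t x. pd i (pd i (y t)) x - pd i (pd i (\<eta> t)) x)"
  have reg: "regular_evolution \<nu> \<tau> u u1 u2 (drift \<nu> y)"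
    using path_sol_evolution[OF sol] by (simp add: u_def u1_def u2_def)
  have sub: "t \<in> {0..\<tau>}" if "t \<in> {0..\<tau>'}" for t using that \<tau>' by auto
  have y1: "norm (pd k (y t) x) \<le> 5 * R" if "t \<in> {0..\<tau>'}" "k \<in> Basis" for t x k
    using pre[OF that, of x] eta3[of "[k]" t x] that sub norm_triangle_sub[of "pd k (y t) x" "pd k (\<eta> t) x"] by simp
  have Dy: "norm (y t (x + s *\<^sub>R i) - y t x) \<le> 5 * R * \<bar>s\<bar>" if "t \<in> {0..\<tau>'}" for t x s
    using that Cb_hoelder_deriv[OF y, of t "[]" i] sub i y1
    by (intro directional_mean_value_bound[where u'="pd i (y t)"]) auto
  have diff: "norm (u t (x + s *\<^sub>R i) - u t x) \<le> 2 * R * s" if s: "s > 0" and t: "t \<in> {0..\<tau>'}" for s t x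
  proof -
    \<comment> \<open>35 collects 1 + 3 + 25 from the viscous term, the transport of the noise and
      the velocity increment times the gradient, and 5 + 1 from \<open>f\<close>, with lower powers
      of \<open>R\<close> raised to \<open>R^3\<close>.\<close>
    have "norm (u t (x + s *\<^sub>R i) - u t x) \<le> R * s + (35 * R^3 * s) * t"
    proof (rule vector_max_principle[OF _ regular_evolution_subinterval[OF regular_evolution_diff[OF
              regular_evolution_shift[OF reg] reg] \<tau>'(2)], where b="\<lambda>t x. y t (x + s *\<^sub>R i)"])
      fix t x assume t: "t \<in> {0..\<tau>'}"
      show yb: "norm (y t (x + s *\<^sub>R i)) \<le> 3 * R" by (rule path_sol_sup_bound'[OF sol \<nu> sub[OF t]])
      have e1: "norm (pd k (\<eta> t) (x + s *\<^sub>R i) - pd k (\<eta> t) x) \<le> R * s"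
        and e2: "norm (pd k (pd k (\<eta> t)) (x + s *\<^sub>R i) - pd k (pd k (\<eta> t)) x) \<le> R * s" if "k \<in> Basis" for k
        using eta_difference[of "[k]" t i x s] eta_difference[of "[k,k]" t i x s] sub t that s i by auto
      have f: "norm (f t (x + s *\<^sub>R i) (y t (x + s *\<^sub>R i)) - f t x (y t x)) \<le> R * (s + 5 * R * s)"
        using f_lip[OF sub[OF t], of "x + s *\<^sub>R i" "y t (x + s *\<^sub>R i)" x "y t x"] Dy[OF t, of x s] i s R0
        by (smt (verit) add_diff_cancel_left' mult_left_mono norm_Basis norm_scaleR mult_cancel_left2)
      have 1: "norm (\<nu> *\<^sub>R (\<Sum>k\<in>Basis. pd k (pd k (\<eta> t)) (x + s *\<^sub>R i) - pd k (pd k (\<eta> t)) x)) \<le> R * (R * (R * s))"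
        using \<nu> nu0R by (intro norm_scaleR_le norm_sum_Basis_le(2)[OF e2 order_refl dimR]) auto
      have 2: "norm (\<Sum>k\<in>Basis. (y t (x + s *\<^sub>R i) \<bullet> k) *\<^sub>R (pd k (\<eta> t) (x + s *\<^sub>R i) - pd k (\<eta> t) x))
          \<le> R * ((3 * R) * (R * s))"
        by (intro norm_sum_Basis_le(1)[OF e1 yb dimR])
      have 3: "norm (\<Sum>k\<in>Basis. ((y t (x + s *\<^sub>R i) - y t x) \<bullet> k) *\<^sub>R pd k (y t) x) \<le> R * ((5 * R * s) * (5 * R))"
        using Dy[OF t, of x s] s by (intro norm_sum_Basis_le(1)[OF y1[OF t] _ dimR]) auto
      have tri: "norm (a - b - c + d) \<le> norm a + norm b + norm c + norm d" for a b c d :: "real^'n" by norm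
      have "norm (drift \<nu> y t (x + s *\<^sub>R i) - drift \<nu> y t x
          - \<nu> *\<^sub>R (\<Sum>k\<in>Basis. u2 k t (x + s *\<^sub>R i) - u2 k t x)
          + (\<Sum>k\<in>Basis. (y t (x + s *\<^sub>R i) \<bullet> k) *\<^sub>R (u1 k t (x + s *\<^sub>R i) - u1 k t x)))
        \<le> R * (R * (R * s)) + R * ((3 * R) * (R * s)) + R * ((5 * R * s) * (5 * R)) + R * (s + 5 * R * s)"
        unfolding burgers_drift_def lap_def adv_def u1_def u2_def first_difference_residual
        by (rule order_trans[OF tri add_mono[OF add_mono[OF add_mono[OF 1 2] 3] f]])
      also have "\<dots> = (29 * R^3 + 5 * R^2 + R) * s"
        by (simp add: algebra_simps power2_eq_square power3_eq_cube)
      also have "\<dots> \<le> 35 * R^3 * s"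
      proof -
        have "R \<le> R^3" "R^2 \<le> R^3" using R1 power_increasing[of 1 3 R] power_increasing[of 2 3 R] by auto
        then show ?thesis using s by (intro mult_right_mono) auto
      qed
      finally show "norm (drift \<nu> y t (x + s *\<^sub>R i) - drift \<nu> y t x
          - \<nu> *\<^sub>R (\<Sum>k\<in>Basis. u2 k t (x + s *\<^sub>R i) - u2 k t x)
          + (\<Sum>k\<in>Basis. (y t (x + s *\<^sub>R i) \<bullet> k) *\<^sub>R (u1 k t (x + s *\<^sub>R i) - u1 k t x))) \<le> 35 * R^3 * s" .
    next
      show "norm (u 0 (x + s *\<^sub>R i) - u 0 x) \<le> R * s" for x
        using h_lip[OF i, of x s] s by (simp add: u_def path_sol_initial[OF sol])
    qed (use \<nu> t in auto)
    also have "\<dots> \<le> R * s + (35 * R^3 * s) * \<tau>"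
      using t \<tau>' R0 s by (intro add_left_mono mult_left_mono) auto
    also have "\<dots> = (R + 35 * (\<tau> * R^3)) * s" by (simp add: algebra_simps)
    also have "\<dots> \<le> 2 * R * s" using R_small R1 s by (intro mult_right_mono) auto
    finally show ?thesis .
  qed
  have "((\<lambda>s. u t (x + s *\<^sub>R i)) has_vector_derivative u1 i t x) (at 0)"
    using reg sub[OF t] i unfolding regular_evolution_def by blast
  from partial_bound_of_difference_bound[OF this diff[OF _ t]] show ?thesis by (simp add: u1_def)
qed

text \<open>The continuation itself. The time step \<delta> is such that no partial derivative of
  \<open>u\<close> changes by more than 2 during it, uniformly in space. From \<open>2 * R\<close>
  at the end of one step this gives \<open>4 * R\<close> on the next, as \<open>R \<ge> 1\<close>,
  and the improvement restores \<open>2 * R\<close>. The step may depend on the solution, because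
  the bound does not deteriorate with the number of steps.\<close>

lemma path_sol_gradient_bound:
  assumes sol: "path_sol 2 \<nu> y" and \<nu>: "0 < \<nu>" "\<nu> \<le> \<nu>0"
    and t: "t \<in> {0..\<tau>}" and k: "k \<in> Basis"
  shows "norm (pd k (y t) x - pd k (\<eta> t) x) \<le> 2 * R"
proof -
  have y: "Cb_hoelder \<beta> 2 0 \<tau> y" using sol by (simp add: burgers_path_sol_def)
  have "\<exists>d>0. \<forall>s\<in>{0..\<tau>}. \<forall>t\<in>{0..\<tau>}. \<bar>t - s\<bar> < d \<longrightarrow>
      (\<forall>x. norm ((pd k (y t) x - pd k (\<eta> t) x) - (pd k (y s) x - pd k (\<eta> s) x)) \<le> 2)" if k: "k \<in> Basis" for k
  proof -
    obtain d1 where d1: "d1 > 0" "\<And>s t x. s \<in> {0..\<tau>} \<Longrightarrow> t \<in> {0..\<tau>} \<Longrightarrow> \<bar>t - s\<bar> < d1 \<Longrightarrow>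
        norm (pd k (y t) x - pd k (y s) x) \<le> 1"
      using Cb_hoelder_uniform_in_time[OF y beta(1), of "[k]" 1] k by auto
    obtain d2 where d2: "d2 > 0" "\<And>s t x. s \<in> {0..\<tau>} \<Longrightarrow> t \<in> {0..\<tau>} \<Longrightarrow> \<bar>t - s\<bar> < d2 \<Longrightarrow>
        norm (pd k (\<eta> t) x - pd k (\<eta> s) x) \<le> 1"
      using Cb_hoelder_uniform_in_time[OF eta_reg beta(1), of "[k]" 1] k by auto
    have "norm ((a - b) - (c - d)) \<le> norm (a - c) + norm (b - d)" for a b c d :: "real^'n" by norm
    then have "norm ((pd k (y t) x - pd k (\<eta> t) x) - (pd k (y s) x - pd k (\<eta> s) x)) \<le> 2"
      if "s \<in> {0..\<tau>}" "t \<in> {0..\<tau>}" "\<bar>t - s\<bar> < min d1 d2" for s t x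
      using d1(2)[of s t x] d2(2)[of s t x] that by (smt (verit))
    then show ?thesis using d1 d2 by (intro exI[of _ "min d1 d2"]) auto
  qed
  then obtain d where d: "\<And>k. k \<in> Basis \<Longrightarrow> d k > (0::real)"
    "\<And>k s t x. k \<in> Basis \<Longrightarrow> s \<in> {0..\<tau>} \<Longrightarrow> t \<in> {0..\<tau>} \<Longrightarrow> \<bar>t - s\<bar> < d k \<Longrightarrow>
      norm ((pd k (y t) x - pd k (\<eta> t) x) - (pd k (y s) x - pd k (\<eta> s) x)) \<le> 2"
    by metis
  \<comment> \<open>Halving turns \<open>\<bar>t - s\<bar> \<le> \<delta>\<close> into the strict
    inequality that each \<open>d k\<close> requires.\<close>
  define \<delta> where "\<delta> = Min (d ` (Basis :: (real^'n) set)) / 2"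
  have \<delta>: "\<delta> > 0" "\<And>k. k \<in> Basis \<Longrightarrow> \<delta> < d k"
  proof -
    have "Min (d ` (Basis :: (real^'n) set)) > 0" using d(1) by (subst Min_gr_iff) auto
    then show "\<delta> > 0" by (simp add: \<delta>_def)
    show "\<delta> < d k" if "k \<in> Basis" for k
    proof -
      have "Min (d ` (Basis :: (real^'n) set)) \<le> d k" using that by (intro Min_le) auto
      then show ?thesis using \<open>\<delta> > 0\<close> unfolding \<delta>_def by linarith
    qed
  qed
  have "\<forall>t\<in>{0..min \<tau> (real m * \<delta>)}. \<forall>x. \<forall>k\<in>Basis. norm (pd k (y t) x - pd k (\<eta> t) x) \<le> 2 * R" for m
  proof (induction m)
    case 0
    have "norm (pd k (y 0) x - pd k (\<eta> 0) x) \<le> R" if k: "k \<in> Basis" for k x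
    proof (rule partial_bound_of_difference_bound)
      show "((\<lambda>s. y 0 (x + s *\<^sub>R k) - \<eta> 0 (x + s *\<^sub>R k)) has_vector_derivative pd k (y 0) x - pd k (\<eta> 0) x) (at 0)"
        using path_sol_evolution[OF sol] k tau unfolding regular_evolution_def by auto
      show "norm (y 0 (x + s *\<^sub>R k) - \<eta> 0 (x + s *\<^sub>R k) - (y 0 x - \<eta> 0 x)) \<le> R * s" if "s > 0" for s
        using h_lip[OF k, of x s] that by (simp add: path_sol_initial[OF sol])
    qed
    then have z: "norm (pd k (y 0) x - pd k (\<eta> 0) x) \<le> 2 * R" if "k \<in> Basis" for k x
      using that R1 by (smt (verit))
    show ?case
    proof (intro ballI allI)
      fix t x and k :: "real^'n" assume "t \<in> {0..min \<tau> (real 0 * \<delta>)}" and k: "k \<in> Basis"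
      then have "t = 0" by auto
      then show "norm (pd k (y t) x - pd k (\<eta> t) x) \<le> 2 * R" using z[OF k] by simp
    qed
  next
    case (Suc m)
    let ?\<tau>' = "min \<tau> (real (Suc m) * \<delta>)"
    have \<tau>': "0 \<le> ?\<tau>'" "?\<tau>' \<le> \<tau>" using tau \<delta> by auto
    have "norm (pd k (y t) x - pd k (\<eta> t) x) \<le> 4 * R" if t: "t \<in> {0..?\<tau>'}" and k: "k \<in> Basis" for t x k
    proof -
      define s where "s = min t (min \<tau> (real m * \<delta>))"
      have s: "s \<in> {0..min \<tau> (real m * \<delta>)}" "s \<in> {0..\<tau>}" using t \<delta> tau by (auto simp: s_def)
      have "\<bar>t - s\<bar> \<le> \<delta>" using t \<delta>(1) by (auto simp: s_def min_def algebra_simps split: if_splits)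
      then have "\<bar>t - s\<bar> < d k" using \<delta>(2)[OF k] by simp
      then have "norm ((pd k (y t) x - pd k (\<eta> t) x) - (pd k (y s) x - pd k (\<eta> s) x)) \<le> 2"
        using d(2)[OF k, of s t x] s t \<tau>' by auto
      moreover have "norm (pd k (y s) x - pd k (\<eta> s) x) \<le> 2 * R" using Suc.IH s k by blast
      moreover have "norm a \<le> norm (a - b) + norm b" for a b :: "real^'n" by norm
      ultimately show ?thesis using R1 by (smt (verit))
    qed
    then show ?case using path_sol_gradient_step[OF sol \<nu> \<tau>'] by blast
  qed
  moreover obtain m where "\<tau> \<le> real m * \<delta>" using ex_less_of_nat_mult[OF \<delta>(1), of \<tau>] less_imp_le by blast
  ultimately show ?thesis using t k by (metis min.absorb1)
qed

lemma path_sol_gradient_bound':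
  assumes "path_sol 2 \<nu> y" "0 < \<nu>" "\<nu> \<le> \<nu>0" "t \<in> {0..\<tau>}" "k \<in> Basis"
  shows "norm (pd k (y t) x) \<le> 3 * R"
  using path_sol_gradient_bound[OF assms, of x] eta3[of "[k]" t x] assms
    norm_triangle_sub[of "pd k (y t) x" "pd k (\<eta> t) x"]
  by simp


text \<open>The fraction is what absorption yields for the second derivatives of \<open>u\<close>;
  the final \<open>R\<close> accounts for those of \<eta>. The individual viscosity does not
  occur.\<close>

definition hess_const :: real where
  "hess_const = (R + \<tau> * (R^2 * N4 + 29 * R^3)) / (1 - 10 * (\<tau> * R^2)) + R"

lemma N4_nonneg: "0 \<le> N4"
proof -
  have "norm (pds [] (\<eta> 0) 0) \<le> N4" by (rule eta4) (use tau in auto)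
  then show ?thesis using norm_ge_zero order_trans by blast
qed

text \<open>With the gradient already bounded, the mixed second difference of \<open>u\<close> obeys
  an inequality that is affine in the supremum \<open>U\<close> of the Hessian, with slope
  \<open>10 * (\<tau> * R^2)\<close> below 1. The constant \<open>C\<close> only makes that supremum
  finite.\<close>

lemma path_sol_hessian_bound:
  assumes sol: "path_sol 2 \<nu> y" and \<nu>: "0 < \<nu>" "\<nu> \<le> \<nu>0"
    and t: "t \<in> {0..\<tau>}" and ij: "i \<in> Basis" "j \<in> Basis"
  shows "norm (pd j (pd i (y t)) x) \<le> hess_const"
proof -
  have R0: "R \<ge> 0" using R1 by simp
  have y: "Cb_hoelder \<beta> 2 0 \<tau> y" using sol by (simp add: burgers_path_sol_def)
  define u where "u = (\<lambda>t x. y t x - \<eta> t x)"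
  define u1 where "u1 = (\<lambda>i t x. pd i (y t) x - pd i (\<eta> t) x)"
  define u2 where "u2 = (\<lambda>i t x. pd i (pd i (y t)) x - pd i (pd i (\<eta> t)) x)"
  define v where "v = (\<lambda>i j t x. pd j (pd i (y t)) x - pd j (pd i (\<eta> t)) x)"
  have reg: "regular_evolution \<nu> \<tau> u u1 u2 (drift \<nu> y)"
    using path_sol_evolution[OF sol] by (simp add: u_def u1_def u2_def)
  obtain C where "C \<ge> 0"
    and C: "\<And>\<alpha> t x. set \<alpha> \<subseteq> Basis \<Longrightarrow> length \<alpha> \<le> 2 \<Longrightarrow> t \<in> {0..\<tau>} \<Longrightarrow> norm (pds \<alpha> (y t) x) \<le> C"
    using Cb_hoelder_bound[OF y] by blast
  have eta2: "norm (pd j (pd i (\<eta> t)) x) \<le> R" if "t \<in> {0..\<tau>}" "i \<in> Basis" "j \<in> Basis" for t i j x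
    using eta3[of "[j,i]" t x] that by simp
  have dy: "((\<lambda>s. y t (x + s *\<^sub>R i)) has_vector_derivative pd i (y t) x) (at 0)"
    if "t \<in> {0..\<tau>}" "i \<in> Basis" for t i x
    using Cb_hoelder_deriv[OF y, of t "[]" i] that by simp
  have dy2: "((\<lambda>s. pd i (y t) (x + s *\<^sub>R j)) has_vector_derivative pd j (pd i (y t)) x) (at 0)"
    if "t \<in> {0..\<tau>}" "i \<in> Basis" "j \<in> Basis" for t i j x
    using Cb_hoelder_deriv[OF y, of t "[i]" j] that by simp
  have y1: "norm (pd k (y t) x) \<le> 3 * R" if "t \<in> {0..\<tau>}" "k \<in> Basis" for t x k
    using path_sol_gradient_bound'[OF sol \<nu>] that by blast
  have Dy: "norm (y t (x + s *\<^sub>R i) - y t x) \<le> 3 * R * \<bar>s\<bar>" if "t \<in> {0..\<tau>}" "i \<in> Basis" for t x s i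
    using directional_mean_value_bound[OF dy[OF that] y1[OF that]] .
  have "(\<lambda>(t,x,i,j). norm (v i j t x)) (t,x,i,j)
      \<le> (R + \<tau> * (R^2 * N4 + 29 * R^3)) / (1 - 10 * (\<tau> * R^2))"
  proof (rule absorb_bound[where Z="{0..\<tau>} \<times> UNIV \<times> Basis \<times> Basis" and C="C + R"])
    show "10 * (\<tau> * R^2) < 1" using R_small by simp
    show "(t,x,i,j) \<in> {0..\<tau>} \<times> UNIV \<times> Basis \<times> Basis" using t ij by auto
    show "(\<lambda>(t,x,i,j). norm (v i j t x)) z \<le> C + R" if z: "z \<in> {0..\<tau>} \<times> UNIV \<times> Basis \<times> Basis" for z
    proof -
      obtain t x i j where z': "z = (t,x,i,j)" "t \<in> {0..\<tau>}" "i \<in> Basis" "j \<in> Basis" using z by auto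
      have "norm (pd j (pd i (y t)) x) \<le> C" using C[of "[j,i]" t x] z' by simp
      with eta2[OF z'(2-4), of x] norm_triangle_ineq4[of "pd j (pd i (y t)) x" "pd j (pd i (\<eta> t)) x"]
      show ?thesis by (simp add: z' v_def)
    qed
    fix U and z :: "real \<times> (real^'n) \<times> (real^'n) \<times> (real^'n)"
    assume pre: "\<And>z. z \<in> {0..\<tau>} \<times> UNIV \<times> Basis \<times> Basis \<Longrightarrow> (\<lambda>(t,x,i,j). norm (v i j t x)) z \<le> U"
      and z: "z \<in> {0..\<tau>} \<times> UNIV \<times> Basis \<times> Basis"
    have U: "norm (v i j t x) \<le> U" if "t \<in> {0..\<tau>}" "i \<in> Basis" "j \<in> Basis" for t x i j
      using pre[of "(t,x,i,j)"] that by simp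
    have U0: "0 \<le> U" using U[OF t ij, of x] norm_ge_zero order_trans by blast
    have y2: "norm (pd j (pd i (y t)) x) \<le> U + R" if "t \<in> {0..\<tau>}" "i \<in> Basis" "j \<in> Basis" for t x i j
      using U[OF that, of x] eta2[OF that, of x] norm_triangle_sub[of "pd j (pd i (y t)) x" "pd j (pd i (\<eta> t)) x"]
      by (simp add: v_def)
    obtain t x i j where z': "z = (t,x,i,j)" and t: "t \<in> {0..\<tau>}" and i: "i \<in> Basis" and j: "j \<in> Basis"
      using z by auto
    \<comment> \<open>The residual terms add up to
      \<open>R^2 * N4 + 21 * R^3 + 7 * R^2 + R + (9 * R^2 + R) * U\<close>; raising lower powers by
      \<open>R \<ge> 1\<close> gives 29 and 10.\<close>
    define A where "A = R^2 * N4 + 29 * R^3 + 10 * (R^2 * U)"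
    have A0: "A \<ge> 0" using R0 U0 N4_nonneg by (simp add: A_def)
    have diff: "norm ((u t (x + r *\<^sub>R j + s *\<^sub>R i) - u t (x + r *\<^sub>R j)) - (u t (x + s *\<^sub>R i) - u t x))
        \<le> (R + \<tau> * A) * s * r" if s: "s > 0" and r: "r > 0" for s r x
    proof -
      have sw: "x + r *\<^sub>R j + s *\<^sub>R i = (x + s *\<^sub>R i) + r *\<^sub>R j" for x by simp
      have "norm ((u t (x + r *\<^sub>R j + s *\<^sub>R i) - u t (x + r *\<^sub>R j)) - (u t (x + s *\<^sub>R i) - u t x))
          \<le> R * s * r + (A * (s * r)) * t"
      proof (rule vector_max_principle[OF _ regular_evolution_diff[OF
              regular_evolution_shift[OF regular_evolution_diff[OF regular_evolution_shift[OF reg, of "s *\<^sub>R i"] reg], of "r *\<^sub>R j"]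
              regular_evolution_diff[OF regular_evolution_shift[OF reg, of "s *\<^sub>R i"] reg]],
            where b="\<lambda>t x. y t (x + r *\<^sub>R j + s *\<^sub>R i)"])
        fix t x assume t: "t \<in> {0..\<tau>}"
        show yb: "norm (y t (x + r *\<^sub>R j + s *\<^sub>R i)) \<le> 3 * R" by (rule path_sol_sup_bound'[OF sol \<nu> t])
        define X00 X10 X01 X11 where X: "X00 = x" "X10 = x + s *\<^sub>R i" "X01 = x + r *\<^sub>R j" "X11 = x + r *\<^sub>R j + s *\<^sub>R i"
        have e1: "norm ((pd k (\<eta> t) X11 - pd k (\<eta> t) X01) - (pd k (\<eta> t) X10 - pd k (\<eta> t) X00)) \<le> R * s * r"
          if k: "k \<in> Basis" for k
        proof -
          have "norm (pds [j,i,k] (\<eta> t) x) \<le> R" for x using eta3[of "[j,i,k]" t x] t i j k by simp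
          from eta_second_difference[where \<alpha>="[k]" and x=x and r=r and s=s, OF _ _ t i j this] show ?thesis using k s r by (simp add: X)
        qed
        have e2: "norm ((pd k (pd k (\<eta> t)) X11 - pd k (pd k (\<eta> t)) X01) - (pd k (pd k (\<eta> t)) X10 - pd k (pd k (\<eta> t)) X00))
            \<le> N4 * s * r"
          if k: "k \<in> Basis" for k
        proof -
          have "norm (pds [j,i,k,k] (\<eta> t) x) \<le> N4" for x using eta4[of "[j,i,k,k]" t x] t i j k by simp
          from eta_second_difference[where \<alpha>="[k,k]" and x=x and r=r and s=s, OF _ _ t i j this] show ?thesis using k s r by (simp add: X)
        qed
        have Ya: "norm (y t X11 - y t X01) \<le> 3 * R * s" "norm (y t X10 - y t X00) \<le> 3 * R * s"
          using Dy[OF t i, of "x + r *\<^sub>R j" s] Dy[OF t i, of x s] s by (auto simp: X)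
        have Yb: "norm (y t X11 - y t X10) \<le> 3 * R * r" "norm (y t X01 - y t X00) \<le> 3 * R * r"
          using Dy[OF t j, of "x + s *\<^sub>R i" r] Dy[OF t j, of x r] r by (auto simp: X sw)
        have Yc: "norm ((y t X11 - y t X01) - (y t X10 - y t X00)) \<le> (U + R) * s * r"
          using directional_second_difference_bound[OF dy[OF t i] dy2[OF t i j] y2[OF t i j], of x r s] s r
          by (simp add: X)
        have ga: "norm (pd k (y t) X10 - pd k (y t) X00) \<le> (U + R) * s" if k: "k \<in> Basis" for k
          using directional_mean_value_bound[OF dy2[OF t k i] y2[OF t k i], of x s] s by (simp add: X)
        have gb: "norm (pd k (y t) X01 - pd k (y t) X00) \<le> (U + R) * r" if k: "k \<in> Basis" for k
          using directional_mean_value_bound[OF dy2[OF t k j] y2[OF t k j], of x r] r by (simp add: X)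
        have ff: "norm ((f t X11 (y t X11) - f t X01 (y t X01)) - (f t X10 (y t X10) - f t X00 (y t X00)))
            \<le> R * (s + 3 * R * s) * (r + 3 * R * r) + R * ((U + R) * s * r)"
        proof -
          \<comment> \<open>The four arguments of \<open>f\<close> do not form a parallelogram,
            because \<open>y\<close> is not affine. Replacing \<open>y t X11\<close> by
            \<open>y t X01 + c\<close> makes them one, and the error is a second difference of
            \<open>y\<close>, to which the Lipschitz bound of \<open>f\<close> applies.\<close>
          define c where "c = y t X10 - y t X00"
          have c1: "norm c \<le> 3 * R * s" using Ya(2) by (simp add: c_def)
          have "norm ((f t (X01 + s *\<^sub>R i) (y t X01 + c) - f t X01 (y t X01))
              - (f t (X00 + s *\<^sub>R i) (y t X00 + c) - f t X00 (y t X00)))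
            \<le> R * (norm (s *\<^sub>R i) + norm c) * (norm (X01 - X00) + norm (y t X01 - y t X00))"
            by (rule f_lip2[OF t])
          also have "\<dots> \<le> R * (s + 3 * R * s) * (r + 3 * R * r)"
            using c1 Yb(2) i j s r R0
            by (intro mult_mono add_mono mult_nonneg_nonneg add_nonneg_nonneg) (auto simp: X)
          finally have 1: "norm ((f t X11 (y t X01 + c) - f t X01 (y t X01)) - (f t X10 (y t X10) - f t X00 (y t X00)))
            \<le> R * (s + 3 * R * s) * (r + 3 * R * r)" by (simp add: X c_def)
          have "norm (f t X11 (y t X11) - f t X11 (y t X01 + c)) \<le> R * (norm (X11 - X11) + norm (y t X11 - (y t X01 + c)))"
            by (rule f_lip[OF t])
          also have "\<dots> \<le> R * ((U + R) * s * r)"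
            using Yc R0 by (intro mult_left_mono) (simp_all add: c_def diff_diff_eq)
          finally have 2: "norm (f t X11 (y t X11) - f t X11 (y t X01 + c)) \<le> R * ((U + R) * s * r)" .
          have "norm ((a - b) - d) \<le> norm ((a' - b) - d) + norm (a - a')" for a b d a' :: "real^'n" by norm
          from order_trans[OF this add_mono[OF 1 2]] show ?thesis .
        qed
        have 1: "norm (\<nu> *\<^sub>R (\<Sum>k\<in>Basis. (pd k (pd k (\<eta> t)) X11 - pd k (pd k (\<eta> t)) X01)
            - (pd k (pd k (\<eta> t)) X10 - pd k (pd k (\<eta> t)) X00))) \<le> R * (R * (N4 * s * r))"
          using \<nu> nu0R by (intro norm_scaleR_le norm_sum_Basis_le(2)[OF e2 order_refl dimR]) auto
        have 2: "norm (\<Sum>k\<in>Basis. (y t X11 \<bullet> k) *\<^sub>R ((pd k (\<eta> t) X11 - pd k (\<eta> t) X01)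
            - (pd k (\<eta> t) X10 - pd k (\<eta> t) X00))) \<le> R * ((3 * R) * (R * s * r))"
          using yb by (intro norm_sum_Basis_le(1)[OF e1 _ dimR]) (simp_all add: X)
        have 3: "norm (\<Sum>k\<in>Basis. ((y t X11 - y t X01) \<bullet> k) *\<^sub>R (pd k (y t) X01 - pd k (y t) X00))
            \<le> R * ((3 * R * s) * ((U + R) * r))"
          by (intro norm_sum_Basis_le(1)[OF gb Ya(1) dimR])
        have 4: "norm (\<Sum>k\<in>Basis. ((y t X11 - y t X10) \<bullet> k) *\<^sub>R (pd k (y t) X10 - pd k (y t) X00))
            \<le> R * ((3 * R * r) * ((U + R) * s))"
          by (intro norm_sum_Basis_le(1)[OF ga Yb(1) dimR])
        have 5: "norm (\<Sum>k\<in>Basis. (((y t X11 - y t X01) - (y t X10 - y t X00)) \<bullet> k) *\<^sub>R pd k (y t) X00)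
            \<le> R * (((U + R) * s * r) * (3 * R))"
          by (intro norm_sum_Basis_le(1)[OF y1[OF t] Yc dimR])
        have tri: "norm (a - b - c - d - e + g) \<le> norm a + norm b + norm c + norm d + norm e + norm g"
          for a b c d e g :: "real^'n" by norm
        have "norm (((drift \<nu> y t X11 - drift \<nu> y t X01) - (drift \<nu> y t X10 - drift \<nu> y t X00))
            - \<nu> *\<^sub>R (\<Sum>k\<in>Basis. (u2 k t X11 - u2 k t X01) - (u2 k t X10 - u2 k t X00))
            + (\<Sum>k\<in>Basis. (y t X11 \<bullet> k) *\<^sub>R ((u1 k t X11 - u1 k t X01) - (u1 k t X10 - u1 k t X00))))
          \<le> R * (R * (N4 * s * r)) + R * ((3 * R) * (R * s * r)) + R * ((3 * R * s) * ((U + R) * r))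
            + R * ((3 * R * r) * ((U + R) * s)) + R * (((U + R) * s * r) * (3 * R))
            + (R * (s + 3 * R * s) * (r + 3 * R * r) + R * ((U + R) * s * r))"
          unfolding burgers_drift_def lap_def adv_def u1_def u2_def second_difference_residual
          by (rule order_trans[OF tri add_mono[OF add_mono[OF add_mono[OF add_mono[OF add_mono[OF 1 2] 3] 4] 5] ff]])
        also have "\<dots> = (R^2 * N4 + 21 * R^3 + 7 * R^2 + R + (9 * R^2 + R) * U) * (s * r)"
          by (simp add: algebra_simps power2_eq_square power3_eq_cube)
        also have "\<dots> \<le> A * (s * r)"
        proof -
          have "R \<le> R^3" "R^2 \<le> R^3" "R \<le> R^2"
            using R1 power_increasing[of 1 3 R] power_increasing[of 2 3 R] power_increasing[of 1 2 R] by auto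
          moreover from this have "(9 * R^2 + R) * U \<le> (10 * R^2) * U" using U0 by (intro mult_right_mono) auto
          ultimately show ?thesis using s r unfolding A_def by (intro mult_right_mono) auto
        qed
        finally show "norm (((drift \<nu> y t (x + r *\<^sub>R j + s *\<^sub>R i) - drift \<nu> y t (x + r *\<^sub>R j)) - (drift \<nu> y t (x + s *\<^sub>R i) - drift \<nu> y t x))
            - \<nu> *\<^sub>R (\<Sum>k\<in>Basis. (u2 k t (x + r *\<^sub>R j + s *\<^sub>R i) - u2 k t (x + r *\<^sub>R j)) - (u2 k t (x + s *\<^sub>R i) - u2 k t x))
            + (\<Sum>k\<in>Basis. (y t (x + r *\<^sub>R j + s *\<^sub>R i) \<bullet> k) *\<^sub>R
                ((u1 k t (x + r *\<^sub>R j + s *\<^sub>R i) - u1 k t (x + r *\<^sub>R j)) - (u1 k t (x + s *\<^sub>R i) - u1 k t x))))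
          \<le> A * (s * r)"
          unfolding X .
      next
        show "norm ((u 0 (x + r *\<^sub>R j + s *\<^sub>R i) - u 0 (x + r *\<^sub>R j)) - (u 0 (x + s *\<^sub>R i) - u 0 x)) \<le> R * s * r" for x
          using h_lip2[OF i j, of x r s] s r by (simp add: u_def path_sol_initial[OF sol])
      qed (use \<nu> t in auto)
      also have "\<dots> \<le> R * s * r + (A * (s * r)) * \<tau>"
        using t A0 s r by (intro add_left_mono mult_left_mono) auto
      also have "\<dots> = (R + \<tau> * A) * s * r" by (simp add: algebra_simps)
      finally show ?thesis .
    qed
    \<comment> \<open>The two steps tend to zero one after the other: first \<open>s\<close>, which
      gives a difference bound for \<open>u1 i\<close>, then \<open>r\<close>, which gives the mixed
      partial derivative.\<close>
    have g: "norm (u1 i t (x + r *\<^sub>R j) - u1 i t x) \<le> (R + \<tau> * A) * r" if r: "r > 0" for r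
    proof (rule partial_bound_of_difference_bound[where u="\<lambda>x. u t (x + r *\<^sub>R j) - u t x" and i=i and x=x])
      have d: "((\<lambda>s. u t (x + s *\<^sub>R i)) has_vector_derivative u1 i t x) (at 0)" for x
        using reg t i unfolding regular_evolution_def by blast
      show "((\<lambda>s. u t (x + s *\<^sub>R i + r *\<^sub>R j) - u t (x + s *\<^sub>R i)) has_vector_derivative
          u1 i t (x + r *\<^sub>R j) - u1 i t x) (at 0)"
        using has_vector_derivative_diff[OF d[of "x + r *\<^sub>R j"] d[of x]] by (simp add: add_ac)
      fix s :: real assume s: "s > 0"
      have "norm ((u t (x + s *\<^sub>R i + r *\<^sub>R j) - u t (x + s *\<^sub>R i)) - (u t (x + r *\<^sub>R j) - u t x))
        = norm ((u t (x + r *\<^sub>R j + s *\<^sub>R i) - u t (x + r *\<^sub>R j)) - (u t (x + s *\<^sub>R i) - u t x))"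
        by (simp add: algebra_simps)
      then show "norm ((u t (x + s *\<^sub>R i + r *\<^sub>R j) - u t (x + s *\<^sub>R i)) - (u t (x + r *\<^sub>R j) - u t x))
          \<le> (R + \<tau> * A) * r * s"
        using diff[OF s r, of x] by (simp add: mult_ac)
    qed
    have "((\<lambda>r. u1 i t (x + r *\<^sub>R j)) has_vector_derivative v i j t x) (at 0)"
      unfolding u1_def v_def
      using Cb_hoelder_deriv[OF eta_reg t, of "[i]" j x] i j
      by (intro has_vector_derivative_diff dy2[OF t i j]) auto
    from partial_bound_of_difference_bound[OF this g] have "norm (v i j t x) \<le> R + \<tau> * A" .
    also have "\<dots> = (R + \<tau> * (R^2 * N4 + 29 * R^3)) + 10 * (\<tau> * R^2) * U"
      by (simp add: A_def algebra_simps)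
    finally show "(\<lambda>(t,x,i,j). norm (v i j t x)) z \<le> (R + \<tau> * (R^2 * N4 + 29 * R^3)) + 10 * (\<tau> * R^2) * U"
      by (simp add: z')
  qed
  then show ?thesis
    using eta2[OF t ij, of x] norm_triangle_sub[of "pd j (pd i (y t)) x" "pd j (pd i (\<eta> t)) x"]
    by (simp add: hess_const_def v_def)
qed

lemma hess_const_nonneg: "0 \<le> hess_const"
proof -
  have "10 * (\<tau> * R^2) < 1" using R_small by simp
  then show ?thesis unfolding hess_const_def using R1 tau N4_nonneg
    by (intro add_nonneg_nonneg divide_nonneg_nonneg mult_nonneg_nonneg) auto
qed

text \<open>In the residual only \<open>z\<close> is differentiated, so \<open>y\<close> may be
  inviscid with \<open>l = 1\<close>, and the constant comes from the bounds for \<open>z\<close>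
  alone. The Cauchy property, the continuity in the viscosity and uniqueness all rest on this one
  estimate.\<close>

lemma path_sol_viscosity_difference:
  assumes soly: "path_sol l \<nu> y" and l: "1 \<le> l" "\<nu> \<noteq> 0 \<Longrightarrow> 2 \<le> l" and \<nu>: "0 \<le> \<nu>"
    and solz: "path_sol 2 \<mu> z" and \<mu>: "0 < \<mu>" "\<mu> \<le> \<nu>0" and t: "t \<in> {0..\<tau>}"
  shows "norm (y t x - z t x) \<le> 2 * (\<tau> * R * hess_const) * \<bar>\<nu> - \<mu>\<bar>"
proof -
  have R0: "R \<ge> 0" using R1 by simp
  have y: "Cb_hoelder \<beta> l 0 \<tau> y" using soly by (simp add: burgers_path_sol_def)
  obtain C where "C \<ge> 0"
    and C: "\<And>\<alpha> t x. set \<alpha> \<subseteq> Basis \<Longrightarrow> length \<alpha> \<le> l \<Longrightarrow> t \<in> {0..\<tau>} \<Longrightarrow> norm (pds \<alpha> (y t) x) \<le> C"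
    using Cb_hoelder_bound[OF y] by blast
  define e1 e2 where "e1 = (\<lambda>i t x. pd i (\<eta> t) x)" "e2 = (\<lambda>i t x. pd i (pd i (\<eta> t)) x)"
  note e_def = this
  have regy: "regular_evolution \<nu> \<tau> (\<lambda>t x. y t x - \<eta> t x) (\<lambda>i t x. pd i (y t) x - e1 i t x)
     (\<lambda>i t x. pd i (pd i (y t)) x - e2 i t x) (drift \<nu> y)"
    using path_sol_evolution[OF soly l] by (simp add: e_def)
  have "regular_evolution \<mu> \<tau> (\<lambda>t x. z t x - \<eta> t x) (\<lambda>i t x. pd i (z t) x - e1 i t x)
     (\<lambda>i t x. pd i (pd i (z t)) x - e2 i t x) (drift \<mu> z)"
    using path_sol_evolution[OF solz] by (simp add: e_def)
  \<comment> \<open>As \<open>0 < \<mu>\<close>, the second derivatives of \<open>z\<close> exist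
    outright, so its evolution is regular for the viscosity \<nu> as well, be it zero or
    not.\<close>
  then have regz: "regular_evolution \<nu> \<tau> (\<lambda>t x. z t x - \<eta> t x) (\<lambda>i t x. pd i (z t) x - e1 i t x)
     (\<lambda>i t x. pd i (pd i (z t)) x - e2 i t x) (drift \<mu> z)"
    using \<mu> unfolding regular_evolution_def by blast
  define \<theta> where "\<theta> = \<tau> * (3 * R^2 + R)"
  define K where "K = \<bar>\<nu> - \<mu>\<bar> * (R * hess_const)"
  have K0: "K \<ge> 0" using R0 hess_const_nonneg by (simp add: K_def)
  have \<theta>: "\<theta> \<le> 1 / 2" using R_small by (simp add: \<theta>_def algebra_simps)
  have "(\<lambda>(t,x). norm (y t x - z t x)) (t,x) \<le> (\<tau> * K) / (1 - \<theta>)"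
  proof (rule absorb_bound[where Z="{0..\<tau>} \<times> UNIV" and C="C + 3 * R"])
    show "\<theta> < 1" using \<theta> by simp
    show "(t,x) \<in> {0..\<tau>} \<times> UNIV" using t by simp
    show "(\<lambda>(t,x). norm (y t x - z t x)) p \<le> C + 3 * R" if "p \<in> {0..\<tau>} \<times> UNIV" for p
    proof -
      obtain t x where p: "p = (t,x)" "t \<in> {0..\<tau>}" using \<open>p \<in> _\<close> by auto
      show ?thesis using C[of "[]" t x] path_sol_sup_bound'[OF solz \<mu> p(2), of x] p
        norm_triangle_ineq4[of "y t x" "z t x"] by simp
    qed
    fix U and p :: "real \<times> (real^'n)"
    assume pre: "\<And>p. p \<in> {0..\<tau>} \<times> UNIV \<Longrightarrow> (\<lambda>(t,x). norm (y t x - z t x)) p \<le> U"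
      and "p \<in> {0..\<tau>} \<times> UNIV"
    then obtain t x where p: "p = (t,x)" and t: "t \<in> {0..\<tau>}" by auto
    have U: "norm (y t x - z t x) \<le> U" if "t \<in> {0..\<tau>}" for t x using pre[of "(t,x)"] that by simp
    have U0: "0 \<le> U" using U[OF t, of x] norm_ge_zero order_trans by blast
    define A where "A = K + R * (U * (3 * R)) + R * U"
    have A0: "A \<ge> 0" using K0 U0 R0 by (simp add: A_def)
    have "norm ((y t x - \<eta> t x) - (z t x - \<eta> t x)) \<le> 0 + A * t"
    proof (rule vector_max_principle[OF \<nu> regular_evolution_diff[OF regy regz], where b=y])
      fix t x assume t: "t \<in> {0..\<tau>}"
      show "norm (y t x) \<le> C" using C[of "[]" t x] t by simp
      have h2: "norm (pd k (pd k (z t)) x) \<le> hess_const" if "k \<in> Basis" for k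
        using path_sol_hessian_bound[OF solz \<mu> t that that] .
      have g1: "norm (pd k (z t) x) \<le> 3 * R" if "k \<in> Basis" for k
        using path_sol_gradient_bound'[OF solz \<mu> t that] .
      have 1: "norm ((\<nu> - \<mu>) *\<^sub>R (\<Sum>k\<in>Basis. pd k (pd k (z t)) x)) \<le> K"
        unfolding norm_scaleR K_def
        by (intro mult_left_mono norm_sum_Basis_le(2)[OF h2 order_refl dimR]) auto
      have 2: "norm (\<Sum>k\<in>Basis. ((y t x - z t x) \<bullet> k) *\<^sub>R pd k (z t) x) \<le> R * (U * (3 * R))"
        by (intro norm_sum_Basis_le(1)[OF g1 U[OF t] dimR])
      have 3: "norm (f t x (y t x) - f t x (z t x)) \<le> R * U"
        using order_trans[OF f_lip[OF t, of x "y t x" x "z t x"]] U[OF t, of x] R0 by (simp add: mult_left_mono)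
      have tri: "norm (a - b + c) \<le> norm a + norm b + norm c" for a b c :: "real^'n" by norm
      show "norm ((drift \<nu> y t x - drift \<mu> z t x)
          - \<nu> *\<^sub>R (\<Sum>k\<in>Basis. (pd k (pd k (y t)) x - e2 k t x) - (pd k (pd k (z t)) x - e2 k t x))
          + (\<Sum>k\<in>Basis. (y t x \<bullet> k) *\<^sub>R ((pd k (y t) x - e1 k t x) - (pd k (z t) x - e1 k t x)))) \<le> A"
        unfolding burgers_drift_def lap_def adv_def viscosity_difference_residual A_def
        by (rule order_trans[OF tri add_mono[OF add_mono[OF 1 2] 3]])
    next
      show "norm ((y 0 x - \<eta> 0 x) - (z 0 x - \<eta> 0 x)) \<le> 0" for x
        by (simp add: path_sol_initial[OF soly] path_sol_initial[OF solz])
    qed (rule t)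
    also have "\<dots> \<le> \<tau> * A" using t A0 mult_left_mono[of t \<tau> A] by (simp add: mult.commute)
    also have "\<dots> = \<tau> * K + \<theta> * U" by (simp add: A_def \<theta>_def algebra_simps power2_eq_square)
    finally show "(\<lambda>(t,x). norm (y t x - z t x)) p \<le> \<tau> * K + \<theta> * U" by (simp add: p)
  qed
  also have "\<dots> \<le> 2 * (\<tau> * K)"
  proof -
    have "(\<tau> * K) * 1 \<le> (\<tau> * K) * (2 * (1 - \<theta>))" using \<theta> tau K0 by (intro mult_left_mono) auto
    then show ?thesis using \<theta> by (simp add: pos_divide_le_eq mult_ac)
  qed
  also have "\<dots> = 2 * (\<tau> * R * hess_const) * \<bar>\<nu> - \<mu>\<bar>" by (simp add: K_def mult_ac)
  finally show ?thesis by simp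
qed


section \<open>Passage to the limit of vanishing viscosity\<close>

lemma path_sol_drift_bound:
  assumes sol: "path_sol 2 \<nu> y" and \<nu>: "0 < \<nu>" "\<nu> \<le> \<nu>0" and t: "t \<in> {0..\<tau>}"
  shows "norm (lap (y t) x) \<le> R * hess_const"
    and "norm (drift \<nu> y t x) \<le> R * (R * hess_const) + R * ((3 * R) * (3 * R)) + R"
proof -
  show 1: "norm (lap (y t) x) \<le> R * hess_const" unfolding lap_def
    by (intro norm_sum_Basis_le(2)[OF _ order_refl dimR] path_sol_hessian_bound[OF sol \<nu> t])
  have 2: "norm (adv (y t) x) \<le> R * ((3 * R) * (3 * R))" unfolding adv_def
    by (intro norm_sum_Basis_le(1)[OF _ _ dimR] path_sol_gradient_bound'[OF sol \<nu> t] path_sol_sup_bound'[OF sol \<nu> t])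
  have 3: "norm (\<nu> *\<^sub>R lap (y t) x) \<le> R * (R * hess_const)"
    using \<nu> nu0R by (intro norm_scaleR_le[OF _ _ 1]) auto
  have tri: "norm (a - b + c) \<le> norm a + norm b + norm c" for a b c :: "real^'n" by norm
  show "norm (drift \<nu> y t x) \<le> R * (R * hess_const) + R * ((3 * R) * (3 * R)) + R"
    unfolding burgers_drift_def by (rule order_trans[OF tri add_mono[OF add_mono[OF 3 2] f_bd[OF t]]])
qed

text \<open>Pointwise convergence serves to name the limit; the viscosity estimate makes it uniform,
  and the common Hessian bound transfers this to the gradients by interpolation. The Laplacians stay
  bounded, so the viscous term vanishes, and dominated convergence passes to the limit in the
  integral equation.\<close>

lemma path_sol_inviscid_limit:
  assumes sol: "\<And>k. path_sol 2 (\<nu> k) (Y k)" and pos: "\<And>k. 0 < \<nu> k" and le: "\<And>k. \<nu> k \<le> \<nu>0"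
    and \<nu>0: "\<nu> \<longlonglongrightarrow> 0"
    and lim: "\<And>t x. t \<in> {0..\<tau>} \<Longrightarrow> (\<lambda>k. Y k t x) \<longlonglongrightarrow> y0 t x"
  shows "path_sol 1 0 y0"
proof -
  have R0: "R \<ge> 0" using R1 by simp
  define H where "H = hess_const"
  define D where "D = 2 * (\<tau> * R * H)"
  have H0: "H \<ge> 0" unfolding H_def by (rule hess_const_nonneg)
  have D0: "D \<ge> 0" using H0 R0 tau by (simp add: D_def)
  have reg: "Cb_hoelder \<beta> 2 0 \<tau> (Y k)" for k using sol by (simp add: burgers_path_sol_def)
  have d1: "((\<lambda>s. Y k t (x + s *\<^sub>R i)) has_vector_derivative pd i (Y k t) x) (at 0)"
    if "t \<in> {0..\<tau>}" "i \<in> Basis" for k t i x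
    using Cb_hoelder_deriv[OF reg, of t "[]" i] that by simp
  have d2: "((\<lambda>s. pd i (Y k t) (x + s *\<^sub>R i)) has_vector_derivative pd i (pd i (Y k t)) x) (at 0)"
    if "t \<in> {0..\<tau>}" "i \<in> Basis" for k t i x
    using Cb_hoelder_deriv[OF reg, of t "[i]" i] that by simp
  have hess: "norm (pd i (pd i (Y k t)) x) \<le> H" if "t \<in> {0..\<tau>}" "i \<in> Basis" for k t i x
    unfolding H_def using path_sol_hessian_bound[OF sol pos le] that by blast
  have cauchy: "norm (Y k t x - Y m t x) \<le> D * \<bar>\<nu> k - \<nu> m\<bar>" if "t \<in> {0..\<tau>}" for k m t x
    unfolding D_def H_def
    using path_sol_viscosity_difference[OF sol[of k] _ _ _ sol[of m] pos[of m] le[of m] that, of x] pos[of k] by simp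
  have \<nu>cauchy: "\<exists>N. \<forall>k\<ge>N. \<forall>m\<ge>N. D * \<bar>\<nu> k - \<nu> m\<bar> < e" if e: "e > 0" for e
  proof -
    have "Cauchy (\<lambda>k. D * \<nu> k)" using \<nu>0 by (intro LIMSEQ_imp_Cauchy[of _ "D * 0"] tendsto_intros)
    then obtain N where "\<forall>k\<ge>N. \<forall>m\<ge>N. dist (D * \<nu> k) (D * \<nu> m) < e" using e unfolding Cauchy_def by blast
    then show ?thesis using D0 by (auto simp: dist_real_def right_diff_distrib[symmetric] abs_mult)
  qed
  have ulim: "uniform_limit ({0..\<tau>} \<times> UNIV) (\<lambda>k (t,x). Y k t x) (\<lambda>(t,x). y0 t x) sequentially"
  proof -
    have "uniformly_Cauchy_on ({0..\<tau>} \<times> UNIV) (\<lambda>k (t,x). Y k t x)"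
      unfolding uniformly_Cauchy_on_def
    proof (intro allI impI)
      fix e :: real assume "e > 0"
      then obtain N where "\<forall>k\<ge>N. \<forall>m\<ge>N. D * \<bar>\<nu> k - \<nu> m\<bar> < e" using \<nu>cauchy by blast
      then have "dist (Y k t x) (Y m t x) < e" if "t \<in> {0..\<tau>}" "k \<ge> N" "m \<ge> N" for k m t x
        using cauchy[OF that(1), of k x m] that by (fastforce simp: dist_norm)
      then show "\<exists>M. \<forall>z\<in>{0..\<tau>} \<times> UNIV. \<forall>m\<ge>M. \<forall>n\<ge>M. dist ((\<lambda>(t,x). Y m t x) z) ((\<lambda>(t,x). Y n t x) z) < e"
        by (intro exI[of _ N]) auto
    qed
    then obtain l where l: "uniform_limit ({0..\<tau>} \<times> UNIV) (\<lambda>k (t,x). Y k t x) l sequentially"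
      using Cauchy_uniformly_convergent unfolding uniformly_convergent_on_def by blast
    have "l z = (\<lambda>(t,x). y0 t x) z" if "z \<in> {0..\<tau>} \<times> UNIV" for z
      using tendsto_uniform_limitI[OF l that] lim[of "fst z" "snd z"] that
      by (auto simp: case_prod_beta intro: LIMSEQ_unique)
    then show ?thesis using l uniform_limit_cong'[of "{0..\<tau>} \<times> UNIV" "\<lambda>k (t,x). Y k t x" "\<lambda>k (t,x). Y k t x" l] by blast
  qed
  have cont: "continuous_on ({0..\<tau>} \<times> UNIV) (\<lambda>(t,x). y0 t x)"
    using Cb_hoelder_cont(1)[OF reg, of "[]"]
    by (intro uniform_limit_theorem[OF _ ulim]) auto
  have "\<exists>l. uniform_limit ({0..\<tau>} \<times> UNIV) (\<lambda>k (t,x). pd i (Y k t) x) l sequentially" if i: "i \<in> Basis" for i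
  proof -
    have "uniformly_Cauchy_on ({0..\<tau>} \<times> UNIV) (\<lambda>k (t,x). pd i (Y k t) x)"
      unfolding uniformly_Cauchy_on_def
    proof (intro allI impI)
      fix e :: real assume e: "e > 0"
      \<comment> \<open>This step caps the Hessian part at \<open>e / 2\<close>; the closeness
        \<open>e * s / 8\<close> of the functions then adds \<open>e / 4\<close>, which leaves the
        inequality strict.\<close>
      define s where "s = e / (4 * (H + 1))"
      have s: "s > 0" "2 * H * s \<le> e / 2" using e H0 by (auto simp: s_def field_simps)
      have "e * s / 8 > 0" using e s by simp
      then obtain N where N: "\<forall>k\<ge>N. \<forall>m\<ge>N. D * \<bar>\<nu> k - \<nu> m\<bar> < e * s / 8" using \<nu>cauchy by blast
      have "dist (pd i (Y k t) x) (pd i (Y m t) x) < e" if t: "t \<in> {0..\<tau>}" and km: "k \<ge> N" "m \<ge> N" for k m t x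
      proof -
        have "norm (pd i (Y k t) x - pd i (Y m t) x) \<le> 2 * (e * s / 8) / s + (2 * H) * s"
        proof (rule interpolation_bound[where i=i and x=x and u="\<lambda>x. Y k t x - Y m t x"
              and u'="\<lambda>x. pd i (Y k t) x - pd i (Y m t) x"
              and u''="\<lambda>x. pd i (pd i (Y k t)) x - pd i (pd i (Y m t)) x"])
          show "norm (Y k t x - Y m t x) \<le> e * s / 8" for x
            using cauchy[OF t, of k x m] N km by (meson less_imp_le order_trans)
          show "norm (pd i (pd i (Y k t)) x - pd i (pd i (Y m t)) x) \<le> 2 * H" for x
            using hess[OF t i, of k x] hess[OF t i, of m x]
              norm_triangle_ineq4[of "pd i (pd i (Y k t)) x" "pd i (pd i (Y m t)) x"] by simp
        qed (use s d1[OF t i] d2[OF t i] in \<open>auto intro: has_vector_derivative_diff\<close>)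
        also have "\<dots> < e" using s e by simp
        finally show ?thesis by (simp add: dist_norm)
      qed
      then show "\<exists>M. \<forall>z\<in>{0..\<tau>} \<times> UNIV. \<forall>m\<ge>M. \<forall>n\<ge>M.
          dist ((\<lambda>(t,x). pd i (Y m t) x) z) ((\<lambda>(t,x). pd i (Y n t) x) z) < e"
        by (intro exI[of _ N]) auto
    qed
    then show ?thesis using Cauchy_uniformly_convergent unfolding uniformly_convergent_on_def by blast
  qed
  then obtain p where p: "\<And>i. i \<in> Basis \<Longrightarrow>
      uniform_limit ({0..\<tau>} \<times> UNIV) (\<lambda>k (t,x). pd i (Y k t) x) (p i) sequentially" by metis
  have plim: "(\<lambda>k. pd i (Y k t) x) \<longlonglongrightarrow> p i (t,x)" if "t \<in> {0..\<tau>}" "i \<in> Basis" for i t x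
    using tendsto_uniform_limitI[OF p[OF that(2)], of "(t,x)"] that by simp
  have pcont: "continuous_on ({0..\<tau>} \<times> UNIV) (p i)" if i: "i \<in> Basis" for i
    using Cb_hoelder_cont(1)[OF reg, of "[i]"] i
    by (intro uniform_limit_theorem[OF _ p[OF i]]) auto
  have der: "((\<lambda>s. y0 t (x + s *\<^sub>R i)) has_vector_derivative p i (t,x)) (at 0)"
    if t: "t \<in> {0..\<tau>}" and i: "i \<in> Basis" for t i x
  proof -
    \<comment> \<open>The Taylor remainder is bounded by \<open>H * s\<^sup>2\<close> uniformly in
      \<open>k\<close>, hence survives the limit and identifies \<open>p i\<close> as the derivative
      of \<open>y0\<close> directly.\<close>
    have b: "norm (y0 t (x + s *\<^sub>R i) - y0 t x - s *\<^sub>R p i (t,x)) \<le> H * s\<^sup>2" for s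
    proof (rule tendsto_upperbound)
      show "(\<lambda>k. norm (Y k t (x + s *\<^sub>R i) - Y k t x - s *\<^sub>R pd i (Y k t) x))
          \<longlonglongrightarrow> norm (y0 t (x + s *\<^sub>R i) - y0 t x - s *\<^sub>R p i (t,x))"
        by (intro tendsto_intros lim[OF t] plim[OF t i])
      show "\<forall>\<^sub>F k in sequentially. norm (Y k t (x + s *\<^sub>R i) - Y k t x - s *\<^sub>R pd i (Y k t) x) \<le> H * s\<^sup>2"
        by (intro always_eventually allI directional_taylor_bound[OF d1[OF t i] d2[OF t i] hess[OF t i]])
    qed simp
    show ?thesis unfolding has_vector_derivative_def has_derivative_at_alt
    proof (intro conjI allI impI)
      show "bounded_linear (\<lambda>r. r *\<^sub>R p i (t,x))" by (rule bounded_linear_scaleR_left)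
      fix e :: real assume e: "e > 0"
      show "\<exists>d>0. \<forall>s. norm (s - 0) < d \<longrightarrow>
          norm (y0 t (x + s *\<^sub>R i) - y0 t (x + 0 *\<^sub>R i) - (s - 0) *\<^sub>R p i (t,x)) \<le> e * norm (s - 0)"
      proof (intro exI[of _ "e / (H + 1)"] conjI allI impI)
        show "e / (H + 1) > 0" using e H0 by simp
        fix s :: real assume "norm (s - 0) < e / (H + 1)"
        then have "(H + 1) * \<bar>s\<bar> \<le> e" using H0 by (simp add: field_simps)
        then have "H * \<bar>s\<bar> \<le> e" using H0 by (simp add: algebra_simps)
        then have "H * \<bar>s\<bar> * \<bar>s\<bar> \<le> e * \<bar>s\<bar>" by (intro mult_right_mono) auto
        then show "norm (y0 t (x + s *\<^sub>R i) - y0 t (x + 0 *\<^sub>R i) - (s - 0) *\<^sub>R p i (t,x)) \<le> e * norm (s - 0)"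
          using b[of s] by (simp add: power2_eq_square mult.assoc)
      qed
    qed
  qed
  have pd0: "pd i (y0 t) x = p i (t,x)" if "t \<in> {0..\<tau>}" "i \<in> Basis" for i t x
    unfolding pd_def by (rule vector_derivative_at[OF der[OF that]])
  have b0: "norm (y0 t x) \<le> 3 * R" if t: "t \<in> {0..\<tau>}" for t x
    by (rule tendsto_upperbound[OF tendsto_norm[OF lim[OF t]]])
      (auto intro!: always_eventually path_sol_sup_bound'[OF sol pos le t])
  have b1: "norm (pd i (y0 t) x) \<le> 3 * R" if t: "t \<in> {0..\<tau>}" and i: "i \<in> Basis" for t x i
    unfolding pd0[OF t i]
    by (rule tendsto_upperbound[OF tendsto_norm[OF plim[OF t i]]])
      (auto intro!: always_eventually path_sol_gradient_bound'[OF sol pos le t i])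
  define K where "K = R * (R * hess_const) + R * ((3 * R) * (3 * R)) + R"
  have K: "norm (drift (\<nu> k) (Y k) t x) \<le> K" if "t \<in> {0..\<tau>}" for k t x
    unfolding K_def by (rule path_sol_drift_bound(2)[OF sol pos le that])
  \<comment> \<open>Without the noise the solutions are Lipschitz in time uniformly in
    \<open>k\<close>; it is \<eta> that lowers the time regularity to order
    \<open>\<beta> / 2\<close>.\<close>
  have lipY: "norm ((Y k t x - \<eta> t x) - (Y k s x - \<eta> s x)) \<le> K * \<bar>t - s\<bar>" if ts: "t \<in> {0..\<tau>}" "s \<in> {0..\<tau>}" for k t s x
  proof -
    have "norm ((\<lambda>t. Y k t x - \<eta> t x) t - (\<lambda>t. Y k t x - \<eta> t x) s) \<le> K * norm (t - s)"
    proof (rule differentiable_bound[of "{0..\<tau>}" _ "\<lambda>t h. h *\<^sub>R drift (\<nu> k) (Y k) t x"])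
      show "((\<lambda>t. Y k t x - \<eta> t x) has_derivative (\<lambda>h. h *\<^sub>R drift (\<nu> k) (Y k) r x)) (at r within {0..\<tau>})"
        if "r \<in> {0..\<tau>}" for r
        using path_sol_evolution[OF sol, of k] that unfolding regular_evolution_def has_vector_derivative_def by simp
      show "onorm (\<lambda>h. h *\<^sub>R drift (\<nu> k) (Y k) r x) \<le> K" if "r \<in> {0..\<tau>}" for r
        using mult_left_mono[OF K[OF that, of k x] abs_ge_zero] by (intro onorm_le) (simp add: mult.commute)
    qed (use ts in auto)
    then show ?thesis by simp
  qed
  obtain Ce where Ce: "\<forall>t\<in>{0..\<tau>}. \<forall>s\<in>{0..\<tau>}. \<forall>x. norm (\<eta> t x - \<eta> s x) \<le> Ce * \<bar>t - s\<bar> powr (\<beta> / 2)"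
    using eta_reg unfolding Cb_hoelder_def by blast
  have hoelder: "norm (y0 t x - y0 s x) \<le> (K + Ce) * \<bar>t - s\<bar> powr (\<beta> / 2)"
    if ts: "t \<in> {0..\<tau>}" "s \<in> {0..\<tau>}" for t s x
  proof -
    have "norm ((y0 t x - \<eta> t x) - (y0 s x - \<eta> s x)) \<le> K * \<bar>t - s\<bar>"
    proof (rule tendsto_upperbound)
      show "(\<lambda>k. norm ((Y k t x - \<eta> t x) - (Y k s x - \<eta> s x))) \<longlonglongrightarrow> norm ((y0 t x - \<eta> t x) - (y0 s x - \<eta> s x))"
        by (intro tendsto_intros lim ts)
    qed (use lipY[OF ts] in auto)
    also have "\<dots> \<le> K * \<bar>t - s\<bar> powr (\<beta> / 2)"
    proof (intro mult_left_mono)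
      \<comment> \<open>As \<open>R \<ge> 1\<close>, the interval is shorter than 1, so
        \<open>\<bar>t - s\<bar>\<close> is dominated by its power of exponent
        \<open>\<beta> / 2\<close>.\<close>
      have "\<tau> * 1 \<le> \<tau> * R" using R1 tau by (intro mult_left_mono) auto
      then have "\<bar>t - s\<bar> \<le> 1" using ts R_small(1) by auto
      then have "\<bar>t - s\<bar> powr 1 \<le> \<bar>t - s\<bar> powr (\<beta> / 2)" using beta by (intro powr_mono') auto
      then show "\<bar>t - s\<bar> \<le> \<bar>t - s\<bar> powr (\<beta> / 2)" by simp
      show "0 \<le> K" using K[OF ts(1)] norm_ge_zero order_trans by blast
    qed
    finally have 1: "norm ((y0 t x - \<eta> t x) - (y0 s x - \<eta> s x)) \<le> K * \<bar>t - s\<bar> powr (\<beta> / 2)" .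
    have 2: "norm (\<eta> t x - \<eta> s x) \<le> Ce * \<bar>t - s\<bar> powr (\<beta> / 2)" using Ce ts by blast
    have "norm (a - b) \<le> norm ((a - c) - (b - d)) + norm (c - d)" for a b c d :: "real^'n" by norm
    from order_trans[OF this add_mono[OF 1 2]] show ?thesis by (simp add: algebra_simps)
  qed
  have Cb: "Cb_hoelder \<beta> 1 0 \<tau> y0" unfolding Cb_hoelder_def
  proof (intro conjI ballI allI impI exI[of _ "K + Ce"] hoelder)
    show "has_pds_upto 1 (y0 t)" if "t \<in> {0..\<tau>}" for t
      unfolding has_pds_upto_def using der[OF that] pd0[OF that] by auto
    fix \<alpha> :: "(real^'n) list" assume \<alpha>: "set \<alpha> \<subseteq> Basis \<and> length \<alpha> \<le> 1"
    have cases: "\<alpha> = [] \<or> (\<exists>i\<in>Basis. \<alpha> = [i])" using \<alpha> by (cases \<alpha>) auto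
    show "continuous_on ({0..\<tau>} \<times> UNIV) (\<lambda>(t,x). pds \<alpha> (y0 t) x)" using cases
    proof
      assume "\<exists>i\<in>Basis. \<alpha> = [i]"
      then obtain i where i: "i \<in> Basis" "\<alpha> = [i]" by blast
      have "continuous_on ({0..\<tau>} \<times> UNIV) (\<lambda>z. pds \<alpha> (y0 (fst z)) (snd z))"
        by (rule continuous_on_eq[OF pcont[OF i(1)]]) (auto simp: i pd0[OF _ i(1)])
      then show ?thesis by (simp add: case_prod_beta)
    qed (use cont in simp)
    have "norm (pds \<alpha> (y0 t) x) \<le> 3 * R" if "t \<in> {0..\<tau>}" for t x using cases b0 b1 that by auto
    then show "bounded ((\<lambda>(t,x). pds \<alpha> (y0 t) x) ` ({0..\<tau>} \<times> UNIV))"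
      unfolding bounded_iff by (intro exI[of _ "3 * R"]) auto
  qed
  have driftlim: "(\<lambda>k. drift (\<nu> k) (Y k) t x) \<longlonglongrightarrow> drift 0 y0 t x" if t: "t \<in> {0..\<tau>}" for t x
  proof -
    have "(\<lambda>k. \<nu> k *\<^sub>R lap (Y k t) x) \<longlonglongrightarrow> 0"
    proof (rule Lim_null_comparison)
      show "\<forall>\<^sub>F k in sequentially. norm (\<nu> k *\<^sub>R lap (Y k t) x) \<le> \<nu> k * (R * hess_const)"
        using pos path_sol_drift_bound(1)[OF sol pos le t] by (intro always_eventually allI) (auto simp: less_imp_le abs_of_pos intro!: mult_left_mono)
      show "(\<lambda>k. \<nu> k * (R * hess_const)) \<longlonglongrightarrow> 0" using tendsto_mult_right[OF \<nu>0] by simp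
    qed
    moreover have "(\<lambda>k. adv (Y k t) x) \<longlonglongrightarrow> adv (y0 t) x"
      unfolding adv_def using pd0[OF t] plim[OF t] lim[OF t] by (intro tendsto_sum tendsto_scaleR tendsto_inner) auto
    moreover have "(\<lambda>k. f t x (Y k t x)) \<longlonglongrightarrow> f t x (y0 t x)"
    proof (rule LIM_zero_cancel, rule Lim_null_comparison)
      show "\<forall>\<^sub>F k in sequentially. norm (f t x (Y k t x) - f t x (y0 t x)) \<le> R * norm (Y k t x - y0 t x)"
        using f_lip[OF t, of x _ x] by (intro always_eventually allI) simp
      have "(\<lambda>k. R * norm (Y k t x - y0 t x)) \<longlonglongrightarrow> R * norm (y0 t x - y0 t x)"
        by (intro tendsto_intros lim[OF t])
      then show "(\<lambda>k. R * norm (Y k t x - y0 t x)) \<longlonglongrightarrow> 0" by simp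
    qed
    ultimately have "(\<lambda>k. drift (\<nu> k) (Y k) t x) \<longlonglongrightarrow> 0 - adv (y0 t) x + f t x (y0 t x)"
      unfolding burgers_drift_def by (intro tendsto_add tendsto_diff)
    then show ?thesis by (simp add: burgers_drift_def)
  qed
  have "y0 t x = h x + integral {0..t} (\<lambda>s. drift 0 y0 s x) + \<eta> t x" if t: "t \<in> {0..\<tau>}" for t x
  proof (rule LIMSEQ_unique[OF lim[OF t]])
    have sub: "{0..t} \<subseteq> {0..\<tau>}" using t by auto
    have "(\<lambda>k. integral {0..t} (\<lambda>s. drift (\<nu> k) (Y k) s x)) \<longlonglongrightarrow> integral {0..t} (\<lambda>s. drift 0 y0 s x)"
    proof (rule dominated_convergence(2)[where h="\<lambda>_. K"])
      show "(\<lambda>s. drift (\<nu> k) (Y k) s x) integrable_on {0..t}" for k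
        using continuous_on_subset[OF continuous_on_burgers_drift[OF f_cont reg] sub] by (intro integrable_continuous_interval) auto
      show "norm (drift (\<nu> k) (Y k) s x) \<le> K" if "s \<in> {0..t}" for k s using K sub that by blast
      show "(\<lambda>k. drift (\<nu> k) (Y k) s x) \<longlonglongrightarrow> drift 0 y0 s x" if "s \<in> {0..t}" for s using driftlim sub that by blast
    qed auto
    then have "(\<lambda>k. h x + integral {0..t} (\<lambda>s. drift (\<nu> k) (Y k) s x) + \<eta> t x)
        \<longlonglongrightarrow> h x + integral {0..t} (\<lambda>s. drift 0 y0 s x) + \<eta> t x"
      by (intro tendsto_intros)
    moreover have "Y k t x = h x + integral {0..t} (\<lambda>s. drift (\<nu> k) (Y k) s x) + \<eta> t x" for k
      using sol t unfolding burgers_path_sol_def by blast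
    ultimately show "(\<lambda>k. Y k t x) \<longlonglongrightarrow> h x + integral {0..t} (\<lambda>s. drift 0 y0 s x) + \<eta> t x" by simp
  qed
  with Cb show ?thesis unfolding burgers_path_sol_def by blast
qed

end

section \<open>Measurability and the stopping time\<close>

lemma has_vector_derivative_imp_LIMSEQ:
  fixes g :: "real \<Rightarrow> 'b::real_normed_vector"
  assumes "(g has_vector_derivative D) (at 0)"
  shows "(\<lambda>k. real (Suc k) *\<^sub>R (g (1 / real (Suc k)) - g 0)) \<longlonglongrightarrow> D"
proof (rule LIMSEQ_I)
  fix e :: real assume e: "e > 0"
  then have "e / 2 > 0" by simp
  with assms obtain \<delta> where \<delta>: "\<delta> > 0"
    "\<And>s. \<bar>s\<bar> < \<delta> \<Longrightarrow> norm (g s - g 0 - s *\<^sub>R D) \<le> e / 2 * \<bar>s\<bar>"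
    unfolding has_vector_derivative_def has_derivative_at_alt by (metis diff_zero real_norm_def)
  obtain N where N: "1 / real (Suc N) < \<delta>" using \<delta>(1) nat_approx_posE by blast
  show "\<exists>N. \<forall>k\<ge>N. norm (real (Suc k) *\<^sub>R (g (1 / real (Suc k)) - g 0) - D) < e"
  proof (intro exI[of _ N] allI impI)
    fix k assume "k \<ge> N"
    define c where "c = real (Suc k)"
    have c: "c > 0" by (simp add: c_def)
    have "1 / c \<le> 1 / real (Suc N)" using \<open>k \<ge> N\<close> by (simp add: c_def frac_le)
    then have "norm (g (1 / c) - g 0 - (1 / c) *\<^sub>R D) \<le> e / 2 * \<bar>1 / c\<bar>" using N c by (intro \<delta>(2)) auto
    then have "c * norm (g (1 / c) - g 0 - (1 / c) *\<^sub>R D) \<le> c * (e / 2 * \<bar>1 / c\<bar>)"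
      using c by (intro mult_left_mono) auto
    moreover have "c * norm (g (1 / c) - g 0 - (1 / c) *\<^sub>R D) = norm (c *\<^sub>R (g (1 / c) - g 0) - D)"
    proof -
      have "c *\<^sub>R (g (1 / c) - g 0) - D = c *\<^sub>R (g (1 / c) - g 0 - (1 / c) *\<^sub>R D)"
        using c by (simp add: scaleR_diff_right)
      then show ?thesis using c by simp
    qed
    moreover have "c * (e / 2 * \<bar>1 / c\<bar>) = e / 2" using c by simp
    ultimately show "norm (real (Suc k) *\<^sub>R (g (1 / real (Suc k)) - g 0) - D) < e"
      using e unfolding c_def[symmetric] by linarith
  qed
qed

text \<open>Each partial derivative is the limit of difference quotients along the steps
  \<open>1 / Suc k\<close>; restricting to a sequence of steps keeps the limit measurable.\<close>

lemma measurable_pds: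
  fixes u :: "'w \<Rightarrow> 'x::euclidean_space \<Rightarrow> 'b::euclidean_space"
  assumes m: "\<And>x. (\<lambda>\<omega>. u \<omega> x) \<in> borel_measurable N"
    and d: "\<And>\<omega>. \<omega> \<in> space N \<Longrightarrow> has_pds_upto l (u \<omega>)"
    and "set \<alpha> \<subseteq> Basis" "length \<alpha> \<le> l"
  shows "(\<lambda>\<omega>. pds \<alpha> (u \<omega>) x) \<in> borel_measurable N"
  using assms(3,4)
proof (induction \<alpha> arbitrary: x)
  case Nil then show ?case using m by simp
next
  case (Cons i \<alpha>)
  have IH: "(\<lambda>\<omega>. pds \<alpha> (u \<omega>) x) \<in> borel_measurable N" for x using Cons by auto
  show ?case
  proof (rule borel_measurable_LIMSEQ_metric)
    show "(\<lambda>\<omega>. real (Suc k) *\<^sub>R (pds \<alpha> (u \<omega>) (x + (1 / real (Suc k)) *\<^sub>R i) - pds \<alpha> (u \<omega>) (x + 0 *\<^sub>R i)))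
        \<in> borel_measurable N" for k
      by (intro borel_measurable_scaleR borel_measurable_diff IH borel_measurable_const)
    fix \<omega> assume "\<omega> \<in> space N"
    then have "((\<lambda>s. pds \<alpha> (u \<omega>) (x + s *\<^sub>R i)) has_vector_derivative pds (i # \<alpha>) (u \<omega>) x) (at 0)"
      using d Cons.prems unfolding has_pds_upto_def by auto
    from has_vector_derivative_imp_LIMSEQ[OF this]
    show "(\<lambda>k. real (Suc k) *\<^sub>R (pds \<alpha> (u \<omega>) (x + (1 / real (Suc k)) *\<^sub>R i) - pds \<alpha> (u \<omega>) (x + 0 *\<^sub>R i)))
        \<longlonglongrightarrow> pds (i # \<alpha>) (u \<omega>) x" .
  qed
qed

text \<open>Continuity in time supplies joint measurability: \<open>g\<close> is a limit of
  functions that are constant in time on intervals of length \<open>1 / Suc k\<close>. Measurability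
  of the integral is then part of Fubini's theorem.\<close>

lemma measurable_integral_continuous:
  fixes g :: "real \<Rightarrow> 'w \<Rightarrow> 'b::euclidean_space"
  assumes t: "0 \<le> t" and m: "\<And>s. s \<in> {0..t} \<Longrightarrow> g s \<in> borel_measurable N"
    and c: "\<And>\<omega>. \<omega> \<in> space N \<Longrightarrow> continuous_on {0..t} (\<lambda>s. g s \<omega>)"
  shows "(\<lambda>\<omega>. integral {0..t} (\<lambda>s. g s \<omega>)) \<in> borel_measurable N"
proof -
  \<comment> \<open>The grid points are clamped to \<open>{0..t}\<close>, the only times at which
    \<open>g\<close> is known to be measurable.\<close>
  define r where "r k i = max 0 (min t (real_of_int i / real (Suc k)))" for k :: nat and i
  have r: "r k i \<in> {0..t}" for k i using t by (auto simp: r_def)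
  have G: "(\<lambda>z. indicator {0..t} (snd z) *\<^sub>R g (snd z) (fst z)) \<in> borel_measurable (N \<Otimes>\<^sub>M lborel)"
  proof (rule borel_measurable_LIMSEQ_metric)
    fix k
    have m1: "(\<lambda>z. g (r k i) (fst z)) \<in> borel_measurable (N \<Otimes>\<^sub>M lborel)" for i
      using measurable_compose[OF measurable_fst m[OF r]] .
    have m2: "(\<lambda>z. \<lfloor>real (Suc k) * snd z\<rfloor>) \<in> measurable (N \<Otimes>\<^sub>M lborel) (count_space UNIV)"
      by measurable
    have "(\<lambda>z. g (r k \<lfloor>real (Suc k) * snd z\<rfloor>) (fst z)) \<in> borel_measurable (N \<Otimes>\<^sub>M lborel)"
      by (rule measurable_compose_countable[OF m1 m2])
    then show "(\<lambda>z. indicator {0..t} (snd z) *\<^sub>R g (r k \<lfloor>real (Suc k) * snd z\<rfloor>) (fst z)) \<in> borel_measurable (N \<Otimes>\<^sub>M lborel)"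
      by (intro borel_measurable_scaleR) auto
  next
    fix z :: "'w \<times> real" assume "z \<in> space (N \<Otimes>\<^sub>M lborel)"
    then obtain \<omega> s where z: "z = (\<omega>, s)" "\<omega> \<in> space N" by (auto simp: space_pair_measure)
    show "(\<lambda>k. indicator {0..t} (snd z) *\<^sub>R g (r k \<lfloor>real (Suc k) * snd z\<rfloor>) (fst z))
        \<longlonglongrightarrow> indicator {0..t} (snd z) *\<^sub>R g (snd z) (fst z)"
    proof (cases "s \<in> {0..t}")
      case True
      have near: "\<bar>r k \<lfloor>real (Suc k) * s\<rfloor> - s\<bar> \<le> 1 / real (Suc k)" for k
      proof -
        define c where "c = real (Suc k)"
        have c: "c > 0" by (simp add: c_def)
        have "real_of_int \<lfloor>c * s\<rfloor> \<le> c * s" "c * s < real_of_int \<lfloor>c * s\<rfloor> + 1" by linarith+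
        moreover from this have "(c * s - 1) / c \<le> real_of_int \<lfloor>c * s\<rfloor> / c"
          using c by (intro divide_right_mono) auto
        ultimately have "real_of_int \<lfloor>c * s\<rfloor> / c \<le> s" "s - 1 / c \<le> real_of_int \<lfloor>c * s\<rfloor> / c"
          using c by (simp_all add: diff_divide_distrib pos_divide_le_eq mult.commute)
        then show ?thesis using True unfolding r_def c_def[symmetric] by (auto simp: max_def min_def)
      qed
      have "(\<lambda>k. r k \<lfloor>real (Suc k) * s\<rfloor> - s) \<longlonglongrightarrow> 0"
        by (rule Lim_null_comparison[OF _ LIMSEQ_Suc[OF lim_1_over_n]]) (use near in auto)
      then have "(\<lambda>k. r k \<lfloor>real (Suc k) * s\<rfloor>) \<longlonglongrightarrow> s" by (rule LIM_zero_cancel)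
      from continuous_on_tendsto_compose[OF c[OF z(2)] this True] r
      have "(\<lambda>k. g (r k \<lfloor>real (Suc k) * s\<rfloor>) \<omega>) \<longlonglongrightarrow> g s \<omega>" by auto
      then show ?thesis using True z by simp
    qed (simp add: z)
  qed
  have "(\<lambda>\<omega>. \<integral>s. indicator {0..t} s *\<^sub>R g s \<omega> \<partial>lborel) \<in> borel_measurable N"
    using G by (intro lborel.borel_measurable_lebesgue_integral) (simp add: case_prod_beta)
  moreover have "(\<integral>s. indicator {0..t} s *\<^sub>R g s \<omega> \<partial>lborel) = integral {0..t} (\<lambda>s. g s \<omega>)"
    if "\<omega> \<in> space N" for \<omega>
    using set_borel_integral_eq_integral(2)[OF borel_integrable_atLeastAtMost'[OF c[OF that]]]
    by (simp add: set_lebesgue_integral_def)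
  ultimately show ?thesis by (simp cong: measurable_cong)
qed

text \<open>Writing the running times as \<open>t * q\<close> with \<open>q \<in> [0,1]\<close> keeps the index set countable and independent
  of \<open>t\<close>, so that the supremum over \<open>[0,t]\<close> is visibly adapted and continuous in \<open>t\<close>. Continuity is what
  makes \<open>S\<close> a stopping time, as the filtration is not assumed right-continuous.\<close>
definition noise_sup :: "(real \<times> 'x::euclidean_space) set \<Rightarrow> (real \<Rightarrow> 'x \<Rightarrow> 'b::real_normed_vector) \<Rightarrow> real \<Rightarrow> real" where
  "noise_sup D \<eta> t = (SUP p\<in>multi_indices 3 \<times> D. norm (pds (fst p) (\<eta> (t * fst (snd p))) (snd (snd p))))"

lemma time_scaled:
  assumes "D \<subseteq> {0..1} \<times> UNIV" "t \<in> {0..T}" "p \<in> I \<times> D"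
  shows "t * fst (snd p) \<in> {0..t::real}"
proof -
  have q: "0 \<le> fst (snd p)" "fst (snd p) \<le> 1" using assms(1,3) by auto
  then have "t * fst (snd p) \<le> t * 1" using assms(2) by (intro mult_left_mono) auto
  then show ?thesis using q assms(2) by simp
qed

context
  fixes D :: "(real \<times> 'x::euclidean_space) set" and \<eta> :: "real \<Rightarrow> 'x \<Rightarrow> 'b::real_normed_vector"
    and T \<beta> :: real
  assumes D: "D \<subseteq> {0..1} \<times> UNIV" "{0..1} \<times> UNIV \<subseteq> closure D"
    and \<eta>: "Cb_hoelder \<beta> 4 0 T \<eta>" and \<beta>: "0 < \<beta>"
begin

lemma noise_index_nonempty: "multi_indices 3 \<times> D \<noteq> {}"
proof -
  have "D \<noteq> {}" using D(2) by auto
  moreover have "[] \<in> multi_indices 3" by (simp add: multi_indices_def)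
  ultimately show ?thesis by auto
qed

lemma bdd_above_noise:
  assumes t: "t \<in> {0..T}"
  shows "bdd_above ((\<lambda>p. norm (pds (fst p) (\<eta> (t * fst (snd p))) (snd (snd p)))) ` (multi_indices 3 \<times> D))"
proof -
  obtain C where "C \<ge> 0"
    and C: "\<And>\<alpha> t x. set \<alpha> \<subseteq> Basis \<Longrightarrow> length \<alpha> \<le> 4 \<Longrightarrow> t \<in> {0..T} \<Longrightarrow> norm (pds \<alpha> (\<eta> t) x) \<le> C"
    using Cb_hoelder_bound[OF \<eta>] by blast
  show ?thesis
  proof (rule bdd_aboveI2)
    fix p :: "'x list \<times> real \<times> 'x" assume p: "p \<in> multi_indices 3 \<times> D"
    show "norm (pds (fst p) (\<eta> (t * fst (snd p))) (snd (snd p))) \<le> C"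
      using time_scaled[OF D(1) t p] t p by (intro C) (auto simp: multi_indices_def)
  qed
qed

text \<open>Continuity carries the bound from the countable set \<open>D\<close> to its closure, so
  the countable supremum controls every time up to \<open>t\<close> and every point of
  space.\<close>

lemma norm_pds_le_noise_sup:
  assumes t: "t \<in> {0..T}" and s: "s \<in> {0..t}" and \<alpha>: "set \<alpha> \<subseteq> Basis" "length \<alpha> \<le> 3"
  shows "norm (pds \<alpha> (\<eta> s) x) \<le> noise_sup D \<eta> t"
proof -
  have cl: "closure D = {0..1} \<times> UNIV"
    using D closure_minimal[of D "{0..1} \<times> UNIV"] by (auto intro!: closed_Times)
  have c: "continuous_on ({0..T} \<times> UNIV) (\<lambda>(t,x). pds \<alpha> (\<eta> t) x)"
    using Cb_hoelder_cont(1)[OF \<eta>, of \<alpha>] \<alpha> by simp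
  have "t * q \<le> T" if "q \<in> {0..1}" for q
    using t that mult_left_mono[of q 1 t] by auto
  then have "continuous_on ({0..1} \<times> UNIV) (\<lambda>p. pds \<alpha> (\<eta> (t * fst p)) (snd p))"
    using t continuous_on_compose2[OF c, of "{0..1} \<times> UNIV" "\<lambda>p. (t * fst p, snd p)"]
    by (force intro!: continuous_intros)
  then have c': "continuous_on (closure D) (\<lambda>p. norm (pds \<alpha> (\<eta> (t * fst p)) (snd p)))"
    unfolding cl by (intro continuous_intros)
  \<comment> \<open>For \<open>t = 0\<close> the only admissible \<open>s\<close> is 0, and the
    quotient gets a value by hand.\<close>
  define q where "q = (if t = 0 then 0 else s / t)"
  have q: "q \<in> {0..1}" "t * q = s" using s t by (auto simp: q_def)
  have "(\<lambda>p. norm (pds \<alpha> (\<eta> (t * fst p)) (snd p))) (q, x) \<le> noise_sup D \<eta> t"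
  proof (rule continuous_le_on_closure[OF c'])
    show "(q, x) \<in> closure D" using q cl by auto
    fix p assume "p \<in> D"
    then show "norm (pds \<alpha> (\<eta> (t * fst p)) (snd p)) \<le> noise_sup D \<eta> t"
      unfolding noise_sup_def using \<alpha> cSUP_upper[OF _ bdd_above_noise[OF t], of "(\<alpha>, p)"]
      by (simp add: multi_indices_def)
  qed
  then show ?thesis using q by simp
qed

lemma noise_sup_mono:
  assumes "t \<in> {0..T}" "s \<in> {0..t}"
  shows "noise_sup D \<eta> s \<le> noise_sup D \<eta> t"
proof -
  have s: "s \<in> {0..T}" using assms by auto
  have "norm (pds (fst p) (\<eta> (s * fst (snd p))) (snd (snd p))) \<le> noise_sup D \<eta> t"
    if p: "p \<in> multi_indices 3 \<times> D" for p
    using time_scaled[OF D(1) s p] assms p by (intro norm_pds_le_noise_sup) (auto simp: multi_indices_def)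
  then show ?thesis unfolding noise_sup_def[of D \<eta> s] using noise_index_nonempty by (intro cSUP_least) auto
qed

lemma noise_sup_nonneg:
  assumes "t \<in> {0..T}"
  shows "0 \<le> noise_sup D \<eta> t"
proof -
  have "norm (pds [] (\<eta> 0) 0) \<le> noise_sup D \<eta> t" using assms by (intro norm_pds_le_noise_sup) auto
  then show ?thesis using norm_ge_zero order_trans by blast
qed

text \<open>The finitely many derivatives of order at most 3 are continuous in time uniformly in
  space, one order being spent on interpolation; and suprema of uniformly close families are
  close.\<close>

lemma continuous_on_noise_sup: "continuous_on {0..T} (noise_sup D \<eta>)"
  unfolding continuous_on_iff
proof (intro ballI allI impI)
  fix t e :: real assume t: "t \<in> {0..T}" and e: "e > 0"
  let ?I = "multi_indices 3 :: 'x list set"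
  have fin: "finite ?I" unfolding multi_indices_def by (rule finite_lists_length_le) simp
  have "\<exists>d>0. \<forall>s\<in>{0..T}. \<forall>t\<in>{0..T}. \<bar>t - s\<bar> < d \<longrightarrow> (\<forall>x. norm (pds \<alpha> (\<eta> t) x - pds \<alpha> (\<eta> s) x) \<le> e / 2)"
    if "\<alpha> \<in> ?I" for \<alpha>
    using that e by (intro Cb_hoelder_uniform_in_time[OF \<eta> \<beta>]) (auto simp: multi_indices_def)
  then obtain d where d: "\<And>\<alpha>. \<alpha> \<in> ?I \<Longrightarrow> d \<alpha> > (0::real)"
    "\<And>\<alpha> s t x. \<alpha> \<in> ?I \<Longrightarrow> s \<in> {0..T} \<Longrightarrow> t \<in> {0..T} \<Longrightarrow> \<bar>t - s\<bar> < d \<alpha> \<Longrightarrow> norm (pds \<alpha> (\<eta> t) x - pds \<alpha> (\<eta> s) x) \<le> e / 2"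
    by metis
  define \<delta> where "\<delta> = Min (d ` ?I)"
  have ne: "?I \<noteq> {}" by (auto simp: multi_indices_def intro: exI[of _ "[]"])
  have \<delta>: "\<delta> > 0" unfolding \<delta>_def using d(1) fin ne by (subst Min_gr_iff) auto
  have le: "noise_sup D \<eta> t1 \<le> noise_sup D \<eta> t2 + e / 2"
    if t12: "t1 \<in> {0..T}" "t2 \<in> {0..T}" "\<bar>t1 - t2\<bar> < \<delta>" for t1 t2
    unfolding noise_sup_def[of D \<eta> t1]
  proof (rule cSUP_least[OF noise_index_nonempty])
    fix p :: "'x list \<times> real \<times> 'x" assume p: "p \<in> multi_indices 3 \<times> D"
    obtain \<alpha> q x where p': "p = (\<alpha>, q, x)" by (cases p) auto
    have q: "0 \<le> q" "q \<le> 1" using p D(1) p' by auto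
    have \<alpha>: "\<alpha> \<in> ?I" using p p' by auto
    have "\<bar>t1 * q - t2 * q\<bar> = \<bar>t1 - t2\<bar> * q" using q by (simp add: left_diff_distrib[symmetric] abs_mult)
    also have "\<dots> \<le> \<bar>t1 - t2\<bar> * 1" using q by (intro mult_left_mono) auto
    also have "\<dots> < \<delta>" using t12 by simp
    also have "\<delta> \<le> d \<alpha>" unfolding \<delta>_def using fin \<alpha> by (intro Min_le) auto
    finally have near: "\<bar>t1 * q - t2 * q\<bar> < d \<alpha>" .
    have in1: "t1 * q \<in> {0..t1}" and in2: "t2 * q \<in> {0..t2}"
      using time_scaled[OF D(1) t12(1) p] time_scaled[OF D(1) t12(2) p] p' by auto
    have "norm (pds \<alpha> (\<eta> (t1 * q)) x - pds \<alpha> (\<eta> (t2 * q)) x) \<le> e / 2"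
      using near in1 in2 t12 by (intro d(2)[OF \<alpha>]) auto
    moreover have "norm (pds \<alpha> (\<eta> (t2 * q)) x) \<le> noise_sup D \<eta> t2"
      using in2 t12 \<alpha> by (intro norm_pds_le_noise_sup) (auto simp: multi_indices_def)
    moreover have "norm (pds \<alpha> (\<eta> (t1 * q)) x)
        \<le> norm (pds \<alpha> (\<eta> (t2 * q)) x) + norm (pds \<alpha> (\<eta> (t1 * q)) x - pds \<alpha> (\<eta> (t2 * q)) x)"
      by (rule norm_triangle_sub)
    ultimately show "norm (pds (fst p) (\<eta> (t1 * fst (snd p))) (snd (snd p))) \<le> noise_sup D \<eta> t2 + e / 2"
      by (simp add: p')
  qed
  show "\<exists>d>0. \<forall>s\<in>{0..T}. dist s t < d \<longrightarrow> dist (noise_sup D \<eta> s) (noise_sup D \<eta> t) < e"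
  proof (intro exI[of _ \<delta>] conjI ballI impI)
    fix s assume "s \<in> {0..T}" "dist s t < \<delta>"
    then have "noise_sup D \<eta> s \<le> noise_sup D \<eta> t + e / 2" "noise_sup D \<eta> t \<le> noise_sup D \<eta> s + e / 2"
      using le[of s t] le[of t s] t by (auto simp: dist_real_def abs_minus_commute)
    then show "dist (noise_sup D \<eta> s) (noise_sup D \<eta> t) < e" using e by (auto simp: dist_real_def)
  qed (rule \<delta>)
qed

end

text \<open>The hitting time of level 1, capped at \<open>T\<close>; the case distinction avoids the
  infimum of an empty set.\<close>

definition first_passage :: "real \<Rightarrow> (real \<Rightarrow> real) \<Rightarrow> real" where
  "first_passage T X = (if 1 \<le> X T then Inf {t \<in> {0..T}. 1 \<le> X t} else T)"

text \<open>By the intermediate value theorem the level is attained exactly, so \<open>X\<close>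
  does not exceed it at the passage time. By monotonicity the event of passage up to
  \<open>t\<close> can be read off from \<open>X t\<close> alone. At \<open>t = T\<close> this may
  fail, because passage is then declared in any case.\<close>

lemma first_passage:
  assumes T: "0 < T" and c: "continuous_on {0..T} X" and X0: "X 0 < 1"
    and mono: "\<And>s t. t \<in> {0..T} \<Longrightarrow> s \<in> {0..t} \<Longrightarrow> X s \<le> X t"
  shows "0 < first_passage T X" "first_passage T X \<le> T" "X (first_passage T X) \<le> 1"
    and "\<And>t. 0 \<le> t \<Longrightarrow> t < T \<Longrightarrow> first_passage T X \<le> t \<longleftrightarrow> 1 \<le> X t"
proof -
  let ?A = "{t \<in> {0..T}. 1 \<le> X t}"
  have cl: "closed ?A"
    using continuous_closed_preimage[OF c closed_atLeastAtMost closed_atLeast[of 1]]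
    by (simp add: vimage_def Int_def conj_commute)
  have bdd: "bdd_below ?A" by (intro bdd_belowI[of _ 0]) auto
  have *: "0 < first_passage T X \<and> first_passage T X \<le> T \<and> X (first_passage T X) \<le> 1 \<and>
    (\<forall>t. 0 \<le> t \<longrightarrow> t < T \<longrightarrow> (first_passage T X \<le> t \<longleftrightarrow> 1 \<le> X t))"
  proof (cases "1 \<le> X T")
    case True
    then have ne: "?A \<noteq> {}" using T by auto
    have S: "first_passage T X = Inf ?A" using True by (simp add: first_passage_def)
    have SA: "Inf ?A \<in> ?A" using closed_contains_Inf[OF ne bdd cl] .
    obtain r where r: "0 \<le> r" "r \<le> T" "X r = 1" using IVT'[of X 0 1 T] X0 True T c by auto
    then have "Inf ?A \<le> r" using bdd by (intro cInf_lower) auto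
    then have 1: "X (Inf ?A) \<le> 1" using mono[of r "Inf ?A"] r SA by auto
    have 2: "Inf ?A > 0" using SA X0 by (cases "Inf ?A = 0") auto
    have 3: "Inf ?A \<le> t \<longleftrightarrow> 1 \<le> X t" if "0 \<le> t" "t < T" for t
    proof
      assume "Inf ?A \<le> t"
      then show "1 \<le> X t" using mono[of t "Inf ?A"] SA that by auto
    next
      assume "1 \<le> X t" then show "Inf ?A \<le> t" using that bdd by (intro cInf_lower) auto
    qed
    show ?thesis unfolding S using 1 2 3 SA by auto
  next
    case False
    then have "first_passage T X = T" by (simp add: first_passage_def)
    moreover have "\<not> 1 \<le> X t" if "0 \<le> t" "t < T" for t using mono[of T t] that False by auto
    ultimately show ?thesis using T False by auto
  qed
  then show "0 < first_passage T X" "first_passage T X \<le> T" "X (first_passage T X) \<le> 1"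
    "\<And>t. 0 \<le> t \<Longrightarrow> t < T \<Longrightarrow> first_passage T X \<le> t \<longleftrightarrow> 1 \<le> X t" by auto
qed

text \<open>On the product space the partial derivatives of \<open>f\<close> up to order 2 have a
  common bound; first and second differences then cost one and two factors of the dimension
  \<open>n\<close>.\<close>

lemma Cb_hoelder_lipschitz_constants:
  fixes f :: "real \<Rightarrow> 'x::euclidean_space \<Rightarrow> 'z::euclidean_space \<Rightarrow> 'b::real_normed_vector"
  assumes f: "Cb_hoelder \<beta> 2 0 T (\<lambda>t (x, z). f t x z)"
  obtains C where "C \<ge> 0"
    "\<And>t x z. t \<in> {0..T} \<Longrightarrow> norm (f t x z) \<le> C"
    "\<And>t x z x' z'. t \<in> {0..T} \<Longrightarrow> norm (f t x z - f t x' z') \<le> C * (norm (x - x') + norm (z - z'))"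
    "\<And>t x z x' z' a c. t \<in> {0..T} \<Longrightarrow>
      norm ((f t (x + a) (z + c) - f t x z) - (f t (x' + a) (z' + c) - f t x' z'))
        \<le> C * (norm a + norm c) * (norm (x - x') + norm (z - z'))"
proof -
  define F where "F t p = f t (fst p) (snd p)" for t p
  have F: "Cb_hoelder \<beta> 2 0 T F" using f by (simp add: F_def[abs_def] case_prod_beta')
  obtain B where B0: "B \<ge> 0"
    and B: "\<And>\<alpha> t x. set \<alpha> \<subseteq> Basis \<Longrightarrow> length \<alpha> \<le> 2 \<Longrightarrow> t \<in> {0..T} \<Longrightarrow> norm (pds \<alpha> (F t) x) \<le> B"
    using Cb_hoelder_bound[OF F] by blast
  define n where "n = real DIM('x \<times> 'z)"
  define C where "C = B + n * B + n\<^sup>2 * B"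
  have n0: "n \<ge> 0" by (simp add: n_def)
  have C: "C \<ge> 0" "B \<le> C" "n * B \<le> C" "n\<^sup>2 * B \<le> C" using B0 n0 by (auto simp: C_def)
  have np: "norm (a, c) \<le> norm a + norm c" for a :: 'x and c :: 'z by (rule norm_Pair_le)
  have d1: "((\<lambda>s. F t (x + s *\<^sub>R i)) has_vector_derivative pds [i] (F t) x) (at 0)"
    if "t \<in> {0..T}" "i \<in> Basis" for t i x
    using Cb_hoelder_deriv[OF F that(1), of "[]" i x] that(2) by simp
  have d2: "((\<lambda>s. pds [i] (F t) (x + s *\<^sub>R j)) has_vector_derivative pds [j, i] (F t) x) (at 0)"
    if "t \<in> {0..T}" "i \<in> Basis" "j \<in> Basis" for t i j x
    using Cb_hoelder_deriv[OF F that(1), of "[i]" j x] that by simp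
  have b1: "norm (pds [i] (F t) x) \<le> B" if "t \<in> {0..T}" "i \<in> Basis" for t i x using that by (intro B) auto
  have b2: "norm (pds [j, i] (F t) x) \<le> B" if "t \<in> {0..T}" "i \<in> Basis" "j \<in> Basis" for t i j x
    using that by (intro B) auto
  show ?thesis
  proof (rule that[OF C(1)])
    fix t assume t: "t \<in> {0..T}"
    show "norm (f t x z) \<le> C" for x z using B[of "[]" t "(x,z)"] t C by (simp add: F_def)
    show "norm (f t x z - f t x' z') \<le> C * (norm (x - x') + norm (z - z'))" for x z x' z'
    proof -
      have "norm (F t ((x',z') + (x - x', z - z')) - F t (x',z')) \<le> n * B * norm (x - x', z - z')"
        unfolding n_def by (intro lipschitz_of_bounded_partials[OF d1[OF t] b1[OF t]])
      also have "\<dots> \<le> C * (norm (x - x') + norm (z - z'))" using C B0 n0 np by (intro mult_mono) auto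
      finally show ?thesis by (simp add: F_def)
    qed
    show "norm ((f t (x + a) (z + c) - f t x z) - (f t (x' + a) (z' + c) - f t x' z'))
        \<le> C * (norm a + norm c) * (norm (x - x') + norm (z - z'))" for x z x' z' a c
    proof -
      have "norm ((F t ((x',z') + (x - x', z - z') + (a,c)) - F t ((x',z') + (x - x', z - z')))
          - (F t ((x',z') + (a,c)) - F t (x',z'))) \<le> n\<^sup>2 * B * norm (a,c) * norm (x - x', z - z')"
        unfolding n_def by (intro second_difference_bound[OF d1[OF t] d2[OF t] b2[OF t]])
      also have "\<dots> \<le> C * (norm a + norm c) * (norm (x - x') + norm (z - z'))"
        using C B0 n0 np by (intro mult_mono mult_nonneg_nonneg add_nonneg_nonneg) auto
      finally show ?thesis by (simp add: F_def)
    qed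
  qed
qed

text \<open>Uniqueness is tested up to the minimum of two stopping times, so the setting has to
  survive shortening of the interval; \<open>small\<close> only improves.\<close>

lemma burgers_path_subinterval:
  assumes "burgers_path \<tau> R N4 \<beta> \<nu>0 f h \<eta>" "0 \<le> \<tau>'" "\<tau>' \<le> \<tau>"
  shows "burgers_path \<tau>' R N4 \<beta> \<nu>0 f h \<eta>"
proof -
  interpret burgers_path \<tau> R N4 \<beta> \<nu>0 f h \<eta> by fact
  have sub: "t \<in> {0..\<tau>}" if "t \<in> {0..\<tau>'}" for t using that assms by auto
  show ?thesis
  proof
    have "\<tau>' * R^3 \<le> \<tau> * R^3" using assms R1 by (intro mult_right_mono) auto
    then show "100 * \<tau>' * R^3 \<le> 1" using small by simp
    show "continuous_on ({0..\<tau>'} \<times> UNIV) (\<lambda>(t, p). f t (fst p) (snd p))"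
      using sub by (intro continuous_on_subset[OF f_cont]) auto
    fix t x z x' z' a c assume "t \<in> {0..\<tau>'}"
    then have t: "t \<in> {0..\<tau>}" by (rule sub)
    show "norm (f t x z) \<le> R" by (rule f_bd[OF t])
    show "norm (f t x z - f t x' z') \<le> R * (norm (x - x') + norm (z - z'))" by (rule f_lip[OF t])
    show "norm ((f t (x + a) (z + c) - f t x z) - (f t (x' + a) (z' + c) - f t x' z'))
        \<le> R * (norm a + norm c) * (norm (x - x') + norm (z - z'))" by (rule f_lip2[OF t])
  next
    fix \<alpha> :: "(real^'a) list" and t x assume \<alpha>: "set \<alpha> \<subseteq> Basis" and "t \<in> {0..\<tau>'}"
    then have t: "t \<in> {0..\<tau>}" using sub by blast
    show "norm (pds \<alpha> (\<eta> t) x) \<le> R" if "length \<alpha> \<le> 3" by (rule eta3[OF \<alpha> that t])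
    show "norm (pds \<alpha> (\<eta> t) x) \<le> N4" if "length \<alpha> \<le> 4" by (rule eta4[OF \<alpha> that t])
  next
    show "Cb_hoelder \<beta> 4 0 \<tau>' \<eta>" by (rule Cb_hoelder_subinterval[OF eta_reg assms(3)])
  qed (rule assms R1 nu0R dimR beta h_bd h_lip h_lip2; assumption?)+
qed

section \<open>The completed filtration and adaptedness of the noise\<close>

lemma space_FB: "space (FB M B F0 t) = space M"
  by (simp add: FB_def space_measure_of_conv)

lemma sets_FB:
  assumes "F0 \<subseteq> sets M"
  shows "sets (FB M B F0 t) = sigma_sets (space M) (nat_sets M B t \<union> F0 \<union> null_sets M)"
proof -
  have "nat_sets M B t \<subseteq> Pow (space M)" by (auto simp: nat_sets_def)
  moreover have "F0 \<subseteq> Pow (space M)" using assms sets.space_closed[of M] by (rule subset_trans)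
  moreover have "null_sets M \<subseteq> Pow (space M)" using sets.space_closed[of M] null_setsD2 by blast
  ultimately have "nat_sets M B t \<union> F0 \<union> null_sets M \<subseteq> Pow (space M)" by blast
  then show ?thesis by (simp add: FB_def)
qed

lemma sets_FB_mono:
  assumes "F0 \<subseteq> sets M" "s \<le> t"
  shows "sets (FB M B F0 s) \<subseteq> sets (FB M B F0 t)"
  unfolding sets_FB[OF assms(1)]
proof (rule sigma_sets_mono')
  have "nat_sets M B s \<subseteq> nat_sets M B t"
    unfolding nat_sets_def using assms(2) order_trans by blast
  then show "nat_sets M B s \<union> F0 \<union> null_sets M \<subseteq> nat_sets M B t \<union> F0 \<union> null_sets M" by blast
qed

lemma null_sets_FB:
  assumes "F0 \<subseteq> sets M" "N \<in> null_sets M"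
  shows "N \<in> sets (FB M B F0 t)"
  unfolding sets_FB[OF assms(1)] using assms(2) by (intro sigma_sets.Basic) auto

lemma sets_sigma_F0_FB:
  assumes "F0 \<subseteq> sets M"
  shows "sets (sigma (space M) F0) \<subseteq> sets (FB M B F0 t)"
proof -
  have "F0 \<subseteq> Pow (space M)" using assms sets.space_closed[of M] by (rule subset_trans)
  then have "sets (sigma (space M) F0) = sigma_sets (space M) F0" by simp
  also have "\<dots> \<subseteq> sigma_sets (space M) (nat_sets M B t \<union> F0 \<union> null_sets M)"
    by (rule sigma_sets_mono') auto
  finally show ?thesis by (simp add: sets_FB[OF assms])
qed

text \<open>The noise can be read off from a solution: \<open>\<eta> = y - h - \<integral> drift\<close>. This yields its
  adaptedness outside a null set without using the construction of the stochastic integral.\<close>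
lemma noise_adapted:
  fixes F :: "real \<Rightarrow> 'w measure" and y \<eta> :: "'w \<Rightarrow> real \<Rightarrow> real^'n \<Rightarrow> real^'n"
  assumes space: "\<And>t. space (F t) = G" and mono: "\<And>s t. s \<le> t \<Longrightarrow> sets (F s) \<subseteq> sets (F t)"
    and ym: "\<And>t x. t \<in> {0..T} \<Longrightarrow> (\<lambda>\<omega>. y \<omega> t x) \<in> borel_measurable (F t)"
    and hm: "\<And>t x. (\<lambda>\<omega>. h \<omega> x) \<in> borel_measurable (F t)"
    and sol: "\<And>\<omega>. \<omega> \<in> G \<Longrightarrow> burgers_path_sol \<beta> f (h \<omega>) (\<eta> \<omega>) T 2 \<nu> (y \<omega>)"
    and fc: "continuous_on ({0..T} \<times> UNIV) (\<lambda>(t, p). f t (fst p) (snd p))"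
    and t: "t \<in> {0..T}"
  shows "(\<lambda>\<omega>. \<eta> \<omega> t x) \<in> borel_measurable (F t)"
proof -
  have mon: "g \<in> borel_measurable (F t)" if "s \<le> t" "g \<in> borel_measurable (F s)" for s t and g :: "'w \<Rightarrow> real^'n"
    using measurable_mono[OF order_refl refl mono[OF that(1)]] space that(2) by blast
  have reg: "Cb_hoelder \<beta> 2 0 T (y \<omega>)" if "\<omega> \<in> G" for \<omega> using sol[OF that] by (simp add: burgers_path_sol_def)
  have pm: "(\<lambda>\<omega>. pds \<alpha> (y \<omega> s) x) \<in> borel_measurable (F s)"
    if "s \<in> {0..T}" "set \<alpha> \<subseteq> Basis" "length \<alpha> \<le> 2" for s \<alpha> x
    using that ym reg space
    by (intro measurable_pds[where l=2]) (auto simp: Cb_hoelder_def)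
  have dm: "(\<lambda>\<omega>. burgers_drift f \<nu> (y \<omega>) s x) \<in> borel_measurable (F s)" if s: "s \<in> {0..T}" for s
  proof -
    have 1: "(\<lambda>\<omega>. pd k (y \<omega> s) x) \<in> borel_measurable (F s)"
      and 2: "(\<lambda>\<omega>. pd k (pd k (y \<omega> s)) x) \<in> borel_measurable (F s)" if "k \<in> Basis" for k
      using pm[OF s, of "[k]" x] pm[OF s, of "[k,k]" x] that by auto
    have "continuous_on UNIV (\<lambda>z. f s x z)"
      using continuous_on_compose2[OF fc, of UNIV "\<lambda>z. (s, (x, z))"] s by (force intro!: continuous_intros)
    then have 3: "(\<lambda>\<omega>. f s x (y \<omega> s x)) \<in> borel_measurable (F s)"
      using measurable_compose[OF ym[OF s, of x] borel_measurable_continuous_onI] by blast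
    show ?thesis unfolding burgers_drift_def lap_def adv_def
      using 1 2 3 ym[OF s, of x]
      by (intro borel_measurable_add borel_measurable_diff borel_measurable_scaleR borel_measurable_sum
          borel_measurable_inner borel_measurable_const) auto
  qed
  have "(\<lambda>\<omega>. integral {0..t} (\<lambda>s. burgers_drift f \<nu> (y \<omega>) s x)) \<in> borel_measurable (F t)"
  proof (rule measurable_integral_continuous)
    show "(\<lambda>\<omega>. burgers_drift f \<nu> (y \<omega>) s x) \<in> borel_measurable (F t)" if "s \<in> {0..t}" for s
      using that t by (intro mon[OF _ dm]) auto
    fix \<omega> assume "\<omega> \<in> space (F t)"
    then have "\<omega> \<in> G" using space by simp
    from continuous_on_burgers_drift[OF fc reg[OF this], of \<nu> x]
    show "continuous_on {0..t} (\<lambda>s. burgers_drift f \<nu> (y \<omega>) s x)"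
      using t by (auto elim: continuous_on_subset)
  qed (use t in auto)
  then have "(\<lambda>\<omega>. y \<omega> t x - h \<omega> x - integral {0..t} (\<lambda>s. burgers_drift f \<nu> (y \<omega>) s x)) \<in> borel_measurable (F t)"
    by (intro borel_measurable_diff ym[OF t] hm)
  moreover have "\<eta> \<omega> t x = y \<omega> t x - h \<omega> x - integral {0..t} (\<lambda>s. burgers_drift f \<nu> (y \<omega>) s x)"
    if "\<omega> \<in> space (F t)" for \<omega>
    using sol[of \<omega>] that space t unfolding burgers_path_sol_def by (simp add: algebra_simps)
  ultimately show ?thesis by (simp cong: measurable_cong)
qed

text \<open>One constant serves all pairs of solutions along a given path. It can thus be chosen as
  a function of \<omega> before any solution is named, and solutions known only almost surely can be
  inserted afterwards.\<close>

definition viscosity_modulus :: "real \<Rightarrow> (real \<Rightarrow> real^'n \<Rightarrow> real^'n \<Rightarrow> real^'n) \<Rightarrow> (real^'n \<Rightarrow> real^'n) \<Rightarrow>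
    (real \<Rightarrow> real^'n \<Rightarrow> real^'n) \<Rightarrow> real \<Rightarrow> real \<Rightarrow> real \<Rightarrow> bool" where
  "viscosity_modulus \<beta> f h \<eta> \<nu>0 \<tau> C \<longleftrightarrow> 0 \<le> C \<and>
     (\<forall>l \<nu> y \<mu> z t x. burgers_path_sol \<beta> f h \<eta> \<tau> l \<nu> y \<longrightarrow> 1 \<le> l \<longrightarrow> (\<nu> \<noteq> 0 \<longrightarrow> 2 \<le> l) \<longrightarrow> 0 \<le> \<nu> \<longrightarrow>
        burgers_path_sol \<beta> f h \<eta> \<tau> 2 \<mu> z \<longrightarrow> 0 < \<mu> \<longrightarrow> \<mu> \<le> \<nu>0 \<longrightarrow> t \<in> {0..\<tau>} \<longrightarrow>
        norm (y t x - z t x) \<le> C * \<bar>\<nu> - \<mu>\<bar>)"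

lemma viscosity_modulusD:
  assumes "viscosity_modulus \<beta> f h \<eta> \<nu>0 \<tau> C" "burgers_path_sol \<beta> f h \<eta> \<tau> l \<nu> y"
    "burgers_path_sol \<beta> f h \<eta> \<tau> 2 \<mu> z" "0 < \<mu>" "\<mu> \<le> \<nu>0" "t \<in> {0..\<tau>}"
    "1 \<le> l" "\<nu> \<noteq> 0 \<longrightarrow> 2 \<le> l" "0 \<le> \<nu>"
  shows "norm (y t x - z t x) \<le> C * \<bar>\<nu> - \<mu>\<bar>"
  by (rule conjunct2[OF assms(1)[unfolded viscosity_modulus_def], rule_format, OF assms(2,7) _ assms(9,3-6)])
    (use assms(8) in simp)

lemma viscosity_modulus_exists:
  assumes "burgers_path \<tau> R N4 \<beta> \<nu>0 f h \<eta>"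
  shows "\<exists>C. viscosity_modulus \<beta> f h \<eta> \<nu>0 \<tau> C"
proof -
  interpret burgers_path \<tau> R N4 \<beta> \<nu>0 f h \<eta> by fact
  show ?thesis unfolding viscosity_modulus_def
  proof (intro exI[of _ "2 * (\<tau> * R * hess_const)"] conjI allI impI)
    show "0 \<le> 2 * (\<tau> * R * hess_const)" using hess_const_nonneg R1 tau by simp
    fix l \<nu> y \<mu> z t x
    assume "path_sol l \<nu> y" "1 \<le> l" "\<nu> \<noteq> 0 \<longrightarrow> 2 \<le> l" "0 \<le> \<nu>" "path_sol 2 \<mu> z" "0 < \<mu>" "\<mu> \<le> \<nu>0" "t \<in> {0..\<tau>}"
    then show "norm (y t x - z t x) \<le> 2 * (\<tau> * R * hess_const) * \<bar>\<nu> - \<mu>\<bar>"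
      by (intro path_sol_viscosity_difference[where l=l]) auto
  qed
qed

theorem mainTheorem3:
  fixes M :: "'w measure"
    and T \<beta> \<nu>0 :: real
    and B :: "real \<Rightarrow> 'w \<Rightarrow> real^'d"
    and F0 :: "'w set set"
    and f :: "real \<Rightarrow> real^'n \<Rightarrow> real^'n \<Rightarrow> real^'n"
    and g :: "'w \<Rightarrow> real \<Rightarrow> real^'n \<Rightarrow> real^'n^'d"
    and h :: "'w \<Rightarrow> real^'n \<Rightarrow> real^'n"
    and \<eta> :: "'w \<Rightarrow> real \<Rightarrow> real^'n \<Rightarrow> real^'n"
    and \<Omega>0 :: "'w set"
    and y :: "real \<Rightarrow> 'w \<Rightarrow> real \<Rightarrow> real^'n \<Rightarrow> real^'n"
  assumes T_pos: "T > 0"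
    and beta: "0 < \<beta>" "\<beta> < 1"
    and BM: "std_BM M B"
    and F0: "sigma_algebra (space M) F0" "F0 \<subseteq> sets M"
    and F0_indep: "prob_space.indep_set M F0
          (sigma_sets (space M) {B s -` A \<inter> space M | s A. 0 \<le> s \<and> A \<in> sets borel})"
    \<comment> \<open>(A1)\<close>
    and A1_reg: "Cb_hoelder \<beta> 2 0 T (\<lambda>t (x, z). f t x z)"
    and A1_lin: "\<exists>L. \<forall>t\<in>{0..T}. \<forall>x z z'. norm (f t x z) \<le> L * (1 + norm z) \<and>
                    norm (f t x z - f t x z') \<le> L * norm (z - z')"
    and A1_loc: "\<forall>D>0. \<exists>C. \<forall>\<alpha>. set \<alpha> \<subseteq> Basis \<and> 1 \<le> length \<alpha> \<and> length \<alpha> \<le> 2 \<longrightarrow>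
                   (\<forall>t\<in>{0..T}. \<forall>x z. (\<forall>i. \<bar>z $ i\<bar> \<le> D) \<longrightarrow>
                      norm (pds \<alpha> (\<lambda>(x', z'). f t x' z') (x, z)) \<le> C)"
    and A1_supp: "compact (closure {x. f 0 x 0 \<noteq> 0})"
    \<comment> \<open>(A2)\<close>
    and A2_adapt: "\<forall>s\<in>{0..T}. \<forall>x. (\<lambda>\<omega>. g \<omega> s x) \<in> borel_measurable (FB M B F0 s)"
    and A2_Hk: "\<forall>\<omega>\<in>space M. \<forall>s\<in>{0..T}. in_Hk (CARD('n) div 2 + 5) (g \<omega> s)"
    and A2_int: "\<exists>p. p > 4 / (1 - \<beta>) \<and>
          (\<integral>\<^sup>+\<omega>. (\<integral>\<^sup>+s\<in>{0..T}. ennreal (Hk_norm (CARD('n) div 2 + 5) (g \<omega> s) powr p) \<partial>lborel) \<partial>M) < \<infinity>"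
    \<comment> \<open>(A3)\<close>
    and A3_meas: "\<forall>x. (\<lambda>\<omega>. h \<omega> x) \<in> borel_measurable (sigma (space M) F0)"
    and A3_reg: "\<forall>\<omega>. C2beta_b \<beta> (h \<omega>)"
    \<comment> \<open>\<Omega>_0 and the regular version \<eta> of the stochastic integral\<close>
    and Omega0: "\<Omega>0 \<in> sets M" "prob_space.prob M \<Omega>0 = 1"
    and eta_version: "is_stoch_int_version M (FB M B F0) B T g \<eta>"
    and eta_reg: "\<forall>\<omega>\<in>\<Omega>0. Cb_hoelder \<beta> 4 0 T (\<eta> \<omega>)"
    \<comment> \<open>uniform bound on h\<close>
    and h_bdd: "\<exists>K. \<forall>\<omega>\<in>\<Omega>0. \<forall>\<alpha>. set \<alpha> \<subseteq> Basis \<and> length \<alpha> \<le> 2 \<longrightarrow>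
                   (\<forall>x. norm (pds \<alpha> (h \<omega>) x) \<le> K)"
    \<comment> \<open>the viscous solutions\<close>
    and nu0: "\<nu>0 > 0"
    and y_sol: "\<forall>\<nu>\<in>{0<..\<nu>0}. burgers_sol M (FB M B F0) T \<beta> 2 \<nu> f h \<eta> (\<lambda>_. T) (y \<nu>)"
  shows "\<exists>S y0.
     stopping_time (FB M B F0) S \<and> (\<forall>\<omega>. 0 \<le> S \<omega> \<and> S \<omega> \<le> T) \<and> (AE \<omega> in M. S \<omega> > 0) \<and>
     burgers_sol M (FB M B F0) T \<beta> 1 0 f h \<eta> S y0 \<and>
     (\<forall>S' y0'. stopping_time (FB M B F0) S' \<and> (\<forall>\<omega>. 0 \<le> S' \<omega> \<and> S' \<omega> \<le> T) \<and>
         (AE \<omega> in M. S' \<omega> > 0) \<and> burgers_sol M (FB M B F0) T \<beta> 1 0 f h \<eta> S' y0' \<longrightarrow>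
         (AE \<omega> in M. \<forall>t\<in>{0..min (S \<omega>) (S' \<omega>)}. \<forall>x. y0' \<omega> t x = y0 \<omega> t x)) \<and>
     (\<exists>Y :: real \<Rightarrow> 'w \<Rightarrow> real \<Rightarrow> real^'n \<Rightarrow> real^'n.
         (\<forall>\<nu>\<in>{0<..\<nu>0}. AE \<omega> in M. \<forall>t\<in>{0..S \<omega>}. \<forall>x. Y \<nu> \<omega> t x = y \<nu> \<omega> t x) \<and>
         (AE \<omega> in M. \<forall>t\<in>{0..S \<omega>}. \<forall>x. Y 0 \<omega> t x = y0 \<omega> t x) \<and>
         (\<forall>\<omega>\<in>space M. \<forall>\<nu>\<in>{0..\<nu>0}.
             continuous_on ({0..S \<omega>} \<times> UNIV) (\<lambda>(t, x). Y \<nu> \<omega> t x) \<and>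
             bounded ((\<lambda>(t, x). Y \<nu> \<omega> t x) ` ({0..S \<omega>} \<times> UNIV))) \<and>
         (\<forall>\<omega>\<in>space M. \<forall>\<nu>\<in>{0..\<nu>0}. \<forall>\<epsilon>>0. \<exists>\<delta>>0. \<forall>\<nu>'\<in>{0..\<nu>0}. \<bar>\<nu>' - \<nu>\<bar> < \<delta> \<longrightarrow>
             (\<forall>t\<in>{0..S \<omega>}. \<forall>x. dist (Y \<nu>' \<omega> t x) (Y \<nu> \<omega> t x) < \<epsilon>)) \<and>
         (AE \<omega> in M. \<forall>\<epsilon>>0. \<exists>\<delta>>0. \<forall>\<nu>\<in>{0<..\<nu>0}. \<nu> < \<delta> \<longrightarrow>
             (\<forall>t\<in>{0..S \<omega>}. \<forall>x. dist (Y \<nu> \<omega> t x) (y0 \<omega> t x) < \<epsilon>)))"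
proof -

  \<comment> \<open>Deterministic constants, the exceptional set and the trace filtration\<close>
  interpret prob_space M using BM by (simp add: std_BM_def)
  define F where "F = FB M B F0"
  obtain Cf where Cf: "Cf \<ge> 0"
    "\<And>t x z. t \<in> {0..T} \<Longrightarrow> norm (f t x z) \<le> Cf"
    "\<And>t x z x' z'. t \<in> {0..T} \<Longrightarrow> norm (f t x z - f t x' z') \<le> Cf * (norm (x - x') + norm (z - z'))"
    "\<And>t x z x' z' a c. t \<in> {0..T} \<Longrightarrow>
      norm ((f t (x + a) (z + c) - f t x z) - (f t (x' + a) (z' + c) - f t x' z'))
        \<le> Cf * (norm a + norm c) * (norm (x - x') + norm (z - z'))"
    by (rule Cb_hoelder_lipschitz_constants[OF A1_reg]) blast
  have fc: "continuous_on ({0..T} \<times> UNIV) (\<lambda>(t, p). f t (fst p) (snd p))"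
    using Cb_hoelder_cont(1)[OF A1_reg, of "[]"] by (simp add: case_prod_beta')
  obtain K where K: "\<And>\<omega> \<alpha> x. \<omega> \<in> \<Omega>0 \<Longrightarrow> set \<alpha> \<subseteq> Basis \<Longrightarrow> length \<alpha> \<le> 2 \<Longrightarrow> norm (pds \<alpha> (h \<omega>) x) \<le> K"
    using h_bdd by blast
  \<comment> \<open>All deterministic contributions to \<open>R\<close>. The bound \<open>K\<close>
    for \<open>h\<close> is uniform in \<omega>, so randomness enters \<open>R\<close> through the
    noise alone.\<close>
  define Rc where "Rc = 1 + \<nu>0 + real DIM(real^'n) + Cf + \<bar>K\<bar>"
  have Rc: "1 \<le> Rc" "\<nu>0 \<le> Rc" "real DIM(real^'n) \<le> Rc" "Cf \<le> Rc" "K \<le> Rc"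
    using nu0 Cf(1) by (auto simp: Rc_def)
  obtain D :: "(real \<times> (real^'n)) set" where D: "countable D" "D \<subseteq> {0..1} \<times> UNIV" "{0..1} \<times> UNIV \<subseteq> closure D"
    using separable[of "{0..1::real} \<times> (UNIV :: (real^'n) set)"] by blast
  define Q where "Q = {0<..\<nu>0} \<inter> \<rat>"
  have Qc: "countable Q" unfolding Q_def by (intro countable_Int2 countable_rat)
  define sol where "sol \<omega> \<tau> l \<nu> w = burgers_path_sol \<beta> f (h \<omega>) (\<eta> \<omega>) \<tau> l \<nu> w" for \<omega> \<tau> l \<nu> w
  have burgers_sol_iff: "burgers_sol M (FB M B F0) T \<beta> l \<nu> f h \<eta> S w \<longleftrightarrow>
      (\<forall>t\<in>{0..T}. \<forall>x. (\<lambda>\<omega>. if t \<le> S \<omega> then w \<omega> t x else 0) \<in> borel_measurable (F t)) \<and>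
      (AE \<omega> in M. sol \<omega> (S \<omega>) l \<nu> (w \<omega>))" for l \<nu> S w
    unfolding burgers_sol_def sol_def burgers_path_sol_def burgers_drift_def F_def ..
  have AEsol: "AE \<omega> in M. sol \<omega> T 2 \<nu> (y \<nu> \<omega>)" if "\<nu> \<in> {0<..\<nu>0}" for \<nu>
    using y_sol that unfolding burgers_sol_iff by blast
  have ym: "(\<lambda>\<omega>. y \<nu> \<omega> t x) \<in> borel_measurable (F t)" if "\<nu> \<in> {0<..\<nu>0}" "t \<in> {0..T}" for \<nu> t x
  proof -
    have "(\<lambda>\<omega>. if t \<le> T then y \<nu> \<omega> t x else 0) \<in> borel_measurable (F t)"
      using y_sol that unfolding burgers_sol_iff by blast
    then show ?thesis using that by simp
  qed
  have "AE \<omega> in M. \<omega> \<in> \<Omega>0" using Omega0(2) by (rule AE_prob_1)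
  moreover have "AE \<omega> in M. \<forall>\<nu>\<in>Q. sol \<omega> T 2 \<nu> (y \<nu> \<omega>)"
    using AEsol Qc by (intro AE_ball_countable') (auto simp: Q_def)
  ultimately have "AE \<omega> in M. \<omega> \<in> \<Omega>0 \<and> (\<forall>\<nu>\<in>Q. sol \<omega> T 2 \<nu> (y \<nu> \<omega>))" by (rule AE_conjI)
  then obtain N where N: "{\<omega> \<in> space M. \<not> (\<omega> \<in> \<Omega>0 \<and> (\<forall>\<nu>\<in>Q. sol \<omega> T 2 \<nu> (y \<nu> \<omega>)))} \<subseteq> N"
    "emeasure M N = 0" "N \<in> sets M" by (rule AE_E)
  have Nnull: "N \<in> null_sets M" using N by auto
  define G where "G = space M - N"
  have G: "\<omega> \<in> \<Omega>0" "\<And>\<nu>. \<nu> \<in> Q \<Longrightarrow> sol \<omega> T 2 \<nu> (y \<nu> \<omega>)" "\<omega> \<in> space M" if "\<omega> \<in> G" for \<omega>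
    using N(1) that by (auto simp: G_def)
  have AEG: "AE \<omega> in M. \<omega> \<in> G"
    using AE_not_in[OF Nnull] AE_space by eventually_elim (simp add: G_def)
  have spF: "space (F t) = space M" for t by (simp add: F_def space_FB)
  have Fmono: "sets (F s) \<subseteq> sets (F t)" if "s \<le> t" for s t
    unfolding F_def using F0(2) that by (rule sets_FB_mono)
  have GF: "G \<in> sets (F t)" for t
  proof -
    \<comment> \<open>Null sets belong to each \<open>F t\<close>, so removing \<open>N\<close> does
      not disturb adaptedness, not even at time 0.\<close>
    have "N \<in> sets (F t)" unfolding F_def using F0(2) Nnull by (rule null_sets_FB)
    then show ?thesis unfolding G_def spF[of t, symmetric] by (rule sets.compl_sets)
  qed
  \<comment> \<open>On \<open>G\<close> regularity and the equations for rational viscosities hold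
    at every \<omega>, so in the trace on \<open>G\<close> measurability can be argued
    pointwise.\<close>
  define FG where "FG t = restrict_space (F t) G" for t
  have spFG: "space (FG t) = G" for t
    using sets.sets_into_space[OF GF[of t]] by (auto simp: FG_def space_restrict_space spF)
  have FGmono: "sets (FG s) \<subseteq> sets (FG t)" if "s \<le> t" for s t
    unfolding FG_def sets_restrict_space using Fmono[OF that] by (rule image_mono)
  have toFG: "g \<in> borel_measurable (FG t)" if "g \<in> borel_measurable (F t)" for g :: "'w \<Rightarrow> real^'n" and t
    unfolding FG_def using that by (rule measurable_restrict_space1)
  have FGm: "g \<in> borel_measurable (FG t)" if "g \<in> borel_measurable (FG s)" "s \<le> t" for g :: "'w \<Rightarrow> real^'n" and s t
    using measurable_mono[OF order_refl refl FGmono[OF that(2)]] spFG that(1) by blast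
  have hm: "(\<lambda>\<omega>. h \<omega> x) \<in> borel_measurable (FG t)" for t x
  proof (rule toFG)
    have "sets (sigma (space M) F0) \<subseteq> sets (F t)" unfolding F_def using F0(2) by (rule sets_sigma_F0_FB)
    moreover have "space (sigma (space M) F0) = space (F t)" by (simp add: spF space_measure_of_conv)
    ultimately show "(\<lambda>\<omega>. h \<omega> x) \<in> borel_measurable (F t)"
      using measurable_mono[OF order_refl refl] A3_meas by blast
  qed
  \<comment> \<open>A single rational viscosity suffices to recover the noise from its
    solution.\<close>
  obtain \<nu>1 where \<nu>1: "\<nu>1 \<in> Q"
  proof -
    obtain r where "r \<in> \<rat>" "0 < r" "r < \<nu>0" using Rats_dense_in_real[OF nu0] by blast
    then show ?thesis using that[of r] by (simp add: Q_def)
  qed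
  have \<eta>m: "(\<lambda>\<omega>. \<eta> \<omega> t x) \<in> borel_measurable (FG t)" if "t \<in> {0..T}" for t x
  proof (rule noise_adapted[where F=FG and G=G and y="y \<nu>1" and \<nu>=\<nu>1, OF spFG FGmono _ hm _ fc that])
    show "(\<lambda>\<omega>. y \<nu>1 \<omega> t x) \<in> borel_measurable (FG t)" if "t \<in> {0..T}" for t x
      using \<nu>1 that by (intro toFG ym) (auto simp: Q_def)
    show "burgers_path_sol \<beta> f (h \<omega>) (\<eta> \<omega>) T 2 \<nu>1 (y \<nu>1 \<omega>)" if "\<omega> \<in> G" for \<omega>
      using G(2)[OF that \<nu>1] by (simp add: sol_def)
  qed
  have \<eta>reg: "Cb_hoelder \<beta> 4 0 T (\<eta> \<omega>)" if "\<omega> \<in> G" for \<omega> using eta_reg G(1)[OF that] by blast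

  \<comment> \<open>The stopping time\<close>
  define X where "X \<omega> t = 100 * t * (Rc + noise_sup D (\<eta> \<omega>) t) ^ 3" for \<omega> t
  \<comment> \<open>That \<open>X\<close> is at most 1 is the condition \<open>small\<close> for
    \<open>R\<close> equal to \<open>Rc\<close> plus the noise supremum. Off \<open>G\<close> the
    value \<open>T\<close> keeps \<omega> out of every event \<open>S \<omega> \<le> t\<close> with
    \<open>t < T\<close>.\<close>
  define S where "S \<omega> = (if \<omega> \<in> G then first_passage T (X \<omega>) else T)" for \<omega>
  have Xc: "continuous_on {0..T} (X \<omega>)" if "\<omega> \<in> G" for \<omega>
    unfolding X_def by (intro continuous_intros continuous_on_noise_sup[OF D(2,3) \<eta>reg[OF that] beta(1)])
  have Xmono: "X \<omega> s \<le> X \<omega> t" if "\<omega> \<in> G" "t \<in> {0..T}" "s \<in> {0..t}" for \<omega> s t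
  proof -
    have "noise_sup D (\<eta> \<omega>) s \<le> noise_sup D (\<eta> \<omega>) t"
      by (rule noise_sup_mono[OF D(2,3) \<eta>reg[OF that(1)] beta(1) that(2,3)])
    moreover have "0 \<le> noise_sup D (\<eta> \<omega>) s"
      using that by (intro noise_sup_nonneg[OF D(2,3) \<eta>reg[OF that(1)] beta(1)]) auto
    ultimately show ?thesis unfolding X_def using that Rc(1)
      by (intro mult_mono power_mono mult_nonneg_nonneg zero_le_power) auto
  qed
  \<comment> \<open>The factor \<open>t\<close> makes \<open>X\<close> vanish at time 0 whatever the
    noise; this is why \<open>S\<close> is positive.\<close>
  have X0: "X \<omega> 0 < 1" for \<omega> by (simp add: X_def)
  have S_fp: "S \<omega> = first_passage T (X \<omega>)" if "\<omega> \<in> G" for \<omega> using that by (simp add: S_def)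
  have S_G: "0 < S \<omega>" "X \<omega> (S \<omega>) \<le> 1" "\<And>t. 0 \<le> t \<Longrightarrow> t < T \<Longrightarrow> S \<omega> \<le> t \<longleftrightarrow> 1 \<le> X \<omega> t" "S \<omega> \<le> T"
    if "\<omega> \<in> G" for \<omega>
  proof -
    note P = first_passage[OF T_pos Xc[OF that] X0]
    show "0 < S \<omega>" unfolding S_fp[OF that] by (rule P(1)) (rule Xmono[OF that])
    show "S \<omega> \<le> T" unfolding S_fp[OF that] by (rule P(2)) (rule Xmono[OF that])
    show "X \<omega> (S \<omega>) \<le> 1" unfolding S_fp[OF that] by (rule P(3)) (rule Xmono[OF that])
    show "S \<omega> \<le> t \<longleftrightarrow> 1 \<le> X \<omega> t" if t: "0 \<le> t" "t < T" for t
      unfolding S_fp[OF \<open>\<omega> \<in> G\<close>] by (rule P(4)) (use t Xmono[OF \<open>\<omega> \<in> G\<close>] in auto)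
  qed
  have S_le: "0 \<le> S \<omega>" "S \<omega> \<le> T" for \<omega>
    using S_G(1,4)[of \<omega>] T_pos by (cases "\<omega> \<in> G"; simp add: S_def)+
  have Xm: "(\<lambda>\<omega>. X \<omega> t) \<in> borel_measurable (FG t)" if t: "t \<in> {0..T}" for t
  proof -
    have "(\<lambda>\<omega>. noise_sup D (\<eta> \<omega>) t) \<in> borel_measurable (FG t)" unfolding noise_sup_def
    proof (rule borel_measurable_cSUP)
      have "finite (multi_indices 3 :: (real^'n) list set)"
        unfolding multi_indices_def by (rule finite_lists_length_le) simp
      then show "countable ((multi_indices 3 :: (real^'n) list set) \<times> D)" using D(1) by (intro countable_SIGMA) (auto intro: countable_finite)
      show "bdd_above ((\<lambda>p. norm (pds (fst p) (\<eta> \<omega> (t * fst (snd p))) (snd (snd p)))) ` (multi_indices 3 \<times> D))"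
        if "\<omega> \<in> space (FG t)" for \<omega>
        using that spFG by (intro bdd_above_noise[OF D(2,3) \<eta>reg beta(1) t]) auto
      fix p :: "(real^'n) list \<times> real \<times> (real^'n)" assume p: "p \<in> multi_indices 3 \<times> D"
      have tp: "t * fst (snd p) \<in> {0..t}" by (rule time_scaled[OF D(2) t p])
      have "(\<lambda>\<omega>. pds (fst p) (\<eta> \<omega> (t * fst (snd p))) (snd (snd p))) \<in> borel_measurable (FG (t * fst (snd p)))"
        using tp t p \<eta>reg spFG
        by (intro measurable_pds[where l=4] \<eta>m) (auto simp: multi_indices_def Cb_hoelder_def)
      then have "(\<lambda>\<omega>. pds (fst p) (\<eta> \<omega> (t * fst (snd p))) (snd (snd p))) \<in> borel_measurable (FG t)"
        by (rule FGm) (use tp in auto)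
      then show "(\<lambda>\<omega>. norm (pds (fst p) (\<eta> \<omega> (t * fst (snd p))) (snd (snd p)))) \<in> borel_measurable (FG t)"
        by (rule measurable_compose[OF _ borel_measurable_norm])
    qed
    then show ?thesis unfolding X_def by (intro borel_measurable_times borel_measurable_power borel_measurable_add borel_measurable_const)
  qed
  have stop: "stopping_time F S"
    unfolding stopping_time_def
  proof
    fix t
    have "{\<omega> \<in> space (F t). S \<omega> \<le> t} \<in> sets (F t)"
    \<comment> \<open>For \<open>t < 0\<close> the event is empty and for \<open>t \<ge> T\<close>
      it is the whole space, as \<open>S\<close> has values in \<open>{0..T}\<close>; only the
      middle range involves \<open>X\<close>.\<close>
    proof (cases "0 \<le> t \<and> t < T")
      case True
      then have t: "t \<in> {0..T}" by auto
      have "{\<omega> \<in> space (FG t). 1 \<le> X \<omega> t} \<in> sets (FG t)"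
        using borel_measurable_le[OF borel_measurable_const Xm[OF t]] .
      then have "{\<omega> \<in> G. 1 \<le> X \<omega> t} \<in> sets (F t)"
        using sets_restrict_space_iff[of G "F t"] GF[of t] sets.sets_into_space[OF GF[of t]]
        by (simp add: spFG FG_def Int_absorb2)
      moreover have "{\<omega> \<in> space (F t). S \<omega> \<le> t} = {\<omega> \<in> G. 1 \<le> X \<omega> t}"
        using True S_G(3) by (auto simp: spF G_def S_def)
      ultimately show ?thesis by simp
    next
      case False
      show ?thesis
      proof (cases "t < 0")
        case True
        then have "{\<omega> \<in> space (F t). S \<omega> \<le> t} = {}" using S_le(1) by (auto simp: not_le intro: less_le_trans)
        then show ?thesis by (simp only: sets.empty_sets)
      next
        case f: False
        then have "{\<omega> \<in> space (F t). S \<omega> \<le> t} = space (F t)" using False order_trans[OF S_le(2), of t] by auto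
        then show ?thesis by (simp only: sets.top)
      qed
    qed
    then show "Measurable.pred (F t) (\<lambda>\<omega>. S \<omega> \<le> t)" by (simp add: pred_def)
  qed

  \<comment> \<open>The pathwise setting up to the stopping time\<close>
  have bp: "\<exists>R N4. burgers_path (S \<omega>) R N4 \<beta> \<nu>0 f (h \<omega>) (\<eta> \<omega>)" if \<omega>: "\<omega> \<in> G" for \<omega>
  proof -
    define R where "R = Rc + noise_sup D (\<eta> \<omega>) (S \<omega>)"
    have ST: "S \<omega> \<in> {0..T}" using S_le by simp
    have ns: "0 \<le> noise_sup D (\<eta> \<omega>) (S \<omega>)"
      by (rule noise_sup_nonneg[OF D(2,3) \<eta>reg[OF \<omega>] beta(1) ST])
    have RR: "Rc \<le> R" using ns by (simp add: R_def)
    have sub: "t \<in> {0..T}" if "t \<in> {0..S \<omega>}" for t using that ST by auto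
    obtain N4 where "N4 \<ge> 0" and N4: "\<And>\<alpha> t x. set \<alpha> \<subseteq> Basis \<Longrightarrow> length \<alpha> \<le> 4 \<Longrightarrow> t \<in> {0..T} \<Longrightarrow> norm (pds \<alpha> (\<eta> \<omega> t) x) \<le> N4"
      using Cb_hoelder_bound[OF \<eta>reg[OF \<omega>]] by blast
    have hreg: "has_pds_upto 2 (h \<omega>)" using A3_reg by (simp add: C2beta_b_def)
    have hd1: "((\<lambda>s. h \<omega> (x + s *\<^sub>R i)) has_vector_derivative pds [i] (h \<omega>) x) (at 0)" if "i \<in> Basis" for i x
    proof -
      have "((\<lambda>s. pds [] (h \<omega>) (x + s *\<^sub>R i)) has_vector_derivative pds [i] (h \<omega>) x) (at 0)"
        using hreg that unfolding has_pds_upto_def by (metis empty_set empty_subsetI list.size(3) zero_less_numeral)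
      then show ?thesis by simp
    qed
    have hd2: "((\<lambda>s. pds [i] (h \<omega>) (x + s *\<^sub>R j)) has_vector_derivative pds [j,i] (h \<omega>) x) (at 0)"
      if ij: "i \<in> Basis" "j \<in> Basis" for i j x
    proof -
      have "set [i] \<subseteq> Basis \<and> j \<in> Basis \<and> length [i] < 2" using ij by simp
      then show ?thesis using hreg unfolding has_pds_upto_def by blast
    qed
    have hK: "norm (pds \<alpha> (h \<omega>) x) \<le> R" if "set \<alpha> \<subseteq> Basis" "length \<alpha> \<le> 2" for \<alpha> x
      using K[OF G(1)[OF \<omega>] that, of x] Rc(5) RR by linarith
    have "burgers_path (S \<omega>) R N4 \<beta> \<nu>0 f (h \<omega>) (\<eta> \<omega>)"
    proof
      show "0 \<le> S \<omega>" by (rule S_le)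
      show "1 \<le> R" "\<nu>0 \<le> R" "real DIM(real^'n) \<le> R" using Rc RR by auto
      show "100 * S \<omega> * R ^ 3 \<le> 1" using S_G(2)[OF \<omega>] by (simp add: X_def R_def)
      show "0 < \<beta>" "\<beta> < 2" using beta by auto
      show "continuous_on ({0..S \<omega>} \<times> UNIV) (\<lambda>(t, p). f t (fst p) (snd p))"
        using sub by (intro continuous_on_subset[OF fc]) auto
      show "norm (h \<omega> x) \<le> R" for x using hK[of "[]" x] by simp
      show "norm (h \<omega> (x + s *\<^sub>R i) - h \<omega> x) \<le> R * \<bar>s\<bar>" if "i \<in> Basis" for i x s
        using that by (intro directional_mean_value_bound[OF hd1[OF that]] hK) auto
      show "norm ((h \<omega> (x + r *\<^sub>R j + s *\<^sub>R i) - h \<omega> (x + r *\<^sub>R j)) - (h \<omega> (x + s *\<^sub>R i) - h \<omega> x)) \<le> R * \<bar>s\<bar> * \<bar>r\<bar>"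
        if "i \<in> Basis" "j \<in> Basis" for i j x r s
        using that by (intro directional_second_difference_bound[OF hd1[OF that(1)] hd2[OF that]] hK) auto
      show "Cb_hoelder \<beta> 4 0 (S \<omega>) (\<eta> \<omega>)" by (rule Cb_hoelder_subinterval[OF \<eta>reg[OF \<omega>] S_le(2)])
    next
      fix t and x z x' z' a c :: "real^'n" assume "t \<in> {0..S \<omega>}"
      then have t: "t \<in> {0..T}" by (rule sub)
      have CR: "Cf \<le> R" using Rc RR by simp
      show "norm (f t x z) \<le> R" using Cf(2)[OF t, of x z] CR by simp
      have "Cf * (norm (x - x') + norm (z - z')) \<le> R * (norm (x - x') + norm (z - z'))"
        using CR by (intro mult_right_mono) auto
      then show "norm (f t x z - f t x' z') \<le> R * (norm (x - x') + norm (z - z'))"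
        using Cf(3)[OF t, of x z x' z'] by linarith
      have "Cf * (norm a + norm c) * (norm (x - x') + norm (z - z')) \<le> R * (norm a + norm c) * (norm (x - x') + norm (z - z'))"
        using CR by (intro mult_right_mono) auto
      then show "norm ((f t (x + a) (z + c) - f t x z) - (f t (x' + a) (z' + c) - f t x' z'))
          \<le> R * (norm a + norm c) * (norm (x - x') + norm (z - z'))"
        using Cf(4)[OF t, of x a z c x' z'] by linarith
    next
      fix \<alpha> :: "(real^'n) list" and t x assume \<alpha>: "set \<alpha> \<subseteq> Basis" and t: "t \<in> {0..S \<omega>}"
      show "norm (pds \<alpha> (\<eta> \<omega> t) x) \<le> R" if "length \<alpha> \<le> 3"
        using norm_pds_le_noise_sup[OF D(2,3) \<eta>reg[OF \<omega>] beta(1) ST t \<alpha> that, of x] Rc(1) by (simp add: R_def)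
      show "norm (pds \<alpha> (\<eta> \<omega> t) x) \<le> N4" if "length \<alpha> \<le> 4" by (rule N4[OF \<alpha> that sub[OF t]])
    qed
    then show ?thesis by blast
  qed

  \<comment> \<open>Rational approximation and the version continuous in the viscosity\<close>
  have "\<exists>r. r \<in> Q \<and> \<bar>r - \<nu>\<bar> < 1 / real (Suc k)" if "\<nu> \<in> {0..\<nu>0}" for \<nu> k
  proof -
    \<comment> \<open>The interval is trimmed to lie between 0 and \<open>\<nu>0\<close>, so that
      approximants in \<open>Q\<close> exist also at the two end points.\<close>
    have "max 0 (\<nu> - 1 / real (Suc k)) < min \<nu>0 (\<nu> + 1 / real (Suc k))"
    proof -
      define c where "c = 1 / real (Suc k)"
      have "c > 0" by (simp add: c_def)
      then show ?thesis using that nu0 unfolding c_def[symmetric] by (auto simp: max_def min_def)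
    qed
    from Rats_dense_in_real[OF this] obtain r where "r \<in> \<rat>" "max 0 (\<nu> - 1 / real (Suc k)) < r"
      "r < min \<nu>0 (\<nu> + 1 / real (Suc k))" by blast
    then show ?thesis unfolding Q_def by (intro exI[of _ r]) auto
  qed
  then obtain q where q: "\<And>\<nu> k. \<nu> \<in> {0..\<nu>0} \<Longrightarrow> q \<nu> k \<in> Q"
    "\<And>\<nu> k. \<nu> \<in> {0..\<nu>0} \<Longrightarrow> \<bar>q \<nu> k - \<nu>\<bar> < 1 / real (Suc k)" by metis
  have qlim: "q \<nu> \<longlonglongrightarrow> \<nu>" if "\<nu> \<in> {0..\<nu>0}" for \<nu>
  proof (rule LIM_zero_cancel, rule Lim_null_comparison[OF _ LIMSEQ_Suc[OF lim_1_over_n]])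
    show "\<forall>\<^sub>F k in sequentially. norm (q \<nu> k - \<nu>) \<le> 1 / real (Suc k)"
      using q(2)[OF that] by (intro always_eventually allI) (simp add: less_imp_le)
  qed
  have Qpos: "0 < \<nu>" "\<nu> \<le> \<nu>0" "\<nu> \<in> {0<..\<nu>0}" "\<nu> \<in> {0..\<nu>0}" if "\<nu> \<in> Q" for \<nu> using that by (auto simp: Q_def)
  have solS: "sol \<omega> (S \<omega>) 2 \<nu> (y \<nu> \<omega>)" if "\<omega> \<in> G" "\<nu> \<in> Q" for \<omega> \<nu>
    using burgers_path_sol_subinterval[OF _ S_le(2)] G(2)[OF that] unfolding sol_def by blast
  have "\<exists>C. viscosity_modulus \<beta> f (h \<omega>) (\<eta> \<omega>) \<nu>0 (S \<omega>) C" if "\<omega> \<in> G" for \<omega>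
    using bp[OF that] by (elim exE) (rule viscosity_modulus_exists)
  then obtain C where C': "\<And>\<omega>. \<omega> \<in> G \<Longrightarrow> viscosity_modulus \<beta> f (h \<omega>) (\<eta> \<omega>) \<nu>0 (S \<omega>) (C \<omega>)" by metis
  have C0: "C \<omega> \<ge> 0" if "\<omega> \<in> G" for \<omega> using C'[OF that] by (simp add: viscosity_modulus_def)
  have C: "norm (w t x - y \<mu> \<omega> t x) \<le> C \<omega> * \<bar>\<nu> - \<mu>\<bar>"
    if "\<omega> \<in> G" "sol \<omega> (S \<omega>) 2 \<nu> w" "0 \<le> \<nu>" "\<mu> \<in> Q" "t \<in> {0..S \<omega>}" for \<omega> \<nu> w \<mu> t x
    by (rule viscosity_modulusD[OF C'[OF that(1)] that(2)[unfolded sol_def] solS[OF that(1,4), unfolded sol_def]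
          Qpos(1,2)[OF that(4)] that(5)]) (use that(3) in auto)

  \<comment> \<open>The value 0 off \<open>G\<close> makes continuity in space-time and in \<nu>
    hold for every \<omega> instead of almost every one. \<open>Y 0\<close> is the candidate for the
    inviscid solution.\<close>
  define Y where "Y \<nu> \<omega> t x = (if \<omega> \<in> G \<and> t \<in> {0..S \<omega>} then lim (\<lambda>k. y (q \<nu> k) \<omega> t x) else 0)" for \<nu> \<omega> t x
  have yq: "norm (y (q \<nu> k) \<omega> t x - y \<mu> \<omega> t x) \<le> C \<omega> * \<bar>q \<nu> k - \<mu>\<bar>"
    if "\<omega> \<in> G" "\<nu> \<in> {0..\<nu>0}" "t \<in> {0..S \<omega>}" "\<mu> \<in> Q" for \<omega> \<nu> t x k \<mu>
    using C[OF that(1) solS[OF that(1) q(1)[OF that(2), of k]] _ that(4,3)] Qpos(1)[OF q(1)[OF that(2), of k]] by simp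
  have conv: "(\<lambda>k. y (q \<nu> k) \<omega> t x) \<longlonglongrightarrow> Y \<nu> \<omega> t x"
    if c: "\<omega> \<in> G" "\<nu> \<in> {0..\<nu>0}" "t \<in> {0..S \<omega>}" for \<omega> \<nu> t x
  proof -
    have "Cauchy (\<lambda>k. y (q \<nu> k) \<omega> t x)"
    proof (rule metric_CauchyI)
      fix e :: real assume "e > 0"
      \<comment> \<open>The viscosities multiplied by \<open>C \<omega>\<close> form a real Cauchy
        sequence whose differences dominate those of the solutions.\<close>
      have "Cauchy (\<lambda>k. C \<omega> * q \<nu> k)"
        using qlim[OF c(2)] by (intro LIMSEQ_imp_Cauchy[of _ "C \<omega> * \<nu>"] tendsto_intros)
      from metric_CauchyD[OF this \<open>e > 0\<close>] obtain M0 where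
        M0: "\<And>m n. m \<ge> M0 \<Longrightarrow> n \<ge> M0 \<Longrightarrow> dist (C \<omega> * q \<nu> m) (C \<omega> * q \<nu> n) < e" by blast
      have "dist (y (q \<nu> m) \<omega> t x) (y (q \<nu> n) \<omega> t x) < e" if mn: "m \<ge> M0" "n \<ge> M0" for m n
        using yq[OF c(1-3) q(1)[OF c(2), of n], of m x] M0[OF mn] C0[OF \<open>\<omega> \<in> G\<close>]
        by (simp add: dist_norm right_diff_distrib[symmetric] abs_mult)
      then show "\<exists>M0. \<forall>m\<ge>M0. \<forall>n\<ge>M0. dist (y (q \<nu> m) \<omega> t x) (y (q \<nu> n) \<omega> t x) < e" by blast
    qed
    then show ?thesis using c by (simp add: Y_def Cauchy_convergent_iff convergent_LIMSEQ_iff)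
  qed
  have Yy: "norm (Y \<nu> \<omega> t x - y \<mu> \<omega> t x) \<le> C \<omega> * \<bar>\<nu> - \<mu>\<bar>"
    if "\<omega> \<in> G" "\<nu> \<in> {0..\<nu>0}" "t \<in> {0..S \<omega>}" "\<mu> \<in> Q" for \<omega> \<nu> t x \<mu>
  proof (rule LIMSEQ_le)
    show "(\<lambda>k. norm (y (q \<nu> k) \<omega> t x - y \<mu> \<omega> t x)) \<longlonglongrightarrow> norm (Y \<nu> \<omega> t x - y \<mu> \<omega> t x)"
      by (intro tendsto_intros conv that)
    show "(\<lambda>k. C \<omega> * \<bar>q \<nu> k - \<mu>\<bar>) \<longlonglongrightarrow> C \<omega> * \<bar>\<nu> - \<mu>\<bar>"
      by (intro tendsto_intros qlim that)
  qed (use yq[OF that] in auto)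
  have YY: "norm (Y \<nu> \<omega> t x - Y \<mu> \<omega> t x) \<le> C \<omega> * \<bar>\<nu> - \<mu>\<bar>"
    if "\<omega> \<in> G" "\<nu> \<in> {0..\<nu>0}" "t \<in> {0..S \<omega>}" "\<mu> \<in> {0..\<nu>0}" for \<omega> \<nu> t x \<mu>
  proof (rule LIMSEQ_le)
    show "(\<lambda>k. norm (Y \<nu> \<omega> t x - y (q \<mu> k) \<omega> t x)) \<longlonglongrightarrow> norm (Y \<nu> \<omega> t x - Y \<mu> \<omega> t x)"
      by (intro tendsto_intros conv that)
    show "(\<lambda>k. C \<omega> * \<bar>\<nu> - q \<mu> k\<bar>) \<longlonglongrightarrow> C \<omega> * \<bar>\<nu> - \<mu>\<bar>"
      by (intro tendsto_intros qlim that)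
  qed (use Yy[OF that(1-3) q(1)[OF that(4)]] in auto)
  \<comment> \<open>Adding 1 to \<open>C \<omega>\<close> keeps the threshold meaningful when the
    constant is 0.\<close>
  have Ysmall: "dist (Y \<nu>' \<omega> t x) (Y \<nu> \<omega> t x) < \<epsilon>"
    if "\<omega> \<in> G" "\<nu> \<in> {0..\<nu>0}" "\<nu>' \<in> {0..\<nu>0}" "t \<in> {0..S \<omega>}" "\<epsilon> > 0" "\<bar>\<nu>' - \<nu>\<bar> < \<epsilon> / (C \<omega> + 1)" for \<omega> \<nu> \<nu>' t x \<epsilon>
  proof -
    have c: "C \<omega> \<ge> 0" by (rule C0[OF that(1)])
    have "norm (Y \<nu>' \<omega> t x - Y \<nu> \<omega> t x) \<le> C \<omega> * \<bar>\<nu>' - \<nu>\<bar>" by (rule YY[OF that(1,3,4,2)])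
    also have "\<dots> \<le> (C \<omega> + 1) * \<bar>\<nu>' - \<nu>\<bar>" by (intro mult_right_mono) auto
    also have "\<dots> < (C \<omega> + 1) * (\<epsilon> / (C \<omega> + 1))" using that(6) c by (intro mult_strict_left_mono) auto
    also have "\<dots> = \<epsilon>" using c by simp
    finally show ?thesis by (simp add: dist_norm)
  qed
  have z0: "0 \<in> {0..\<nu>0}" using nu0 by simp
  have sol0: "sol \<omega> (S \<omega>) 1 0 (Y 0 \<omega>)" if \<omega>: "\<omega> \<in> G" for \<omega>
  proof -
    obtain R N4 where "burgers_path (S \<omega>) R N4 \<beta> \<nu>0 f (h \<omega>) (\<eta> \<omega>)" using bp[OF \<omega>] by blast
    then show ?thesis unfolding sol_def
      using solS[OF \<omega> q(1)[OF z0]] Qpos(1,2)[OF q(1)[OF z0]]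
      by (intro burgers_path.path_sol_inviscid_limit[where \<nu>="q 0" and Y="\<lambda>k. y (q 0 k) \<omega>"] qlim[OF z0] conv[OF \<omega> z0])
        (auto simp: sol_def)
  qed

  \<comment> \<open>Adaptedness of the inviscid solution\<close>
  have before: "{\<omega> \<in> space (F t). S \<omega> < t} \<in> sets (F t)" for t
  proof -
    \<comment> \<open>Needed because the cut-off \<open>t \<le> S \<omega>\<close> is the complement
      of \<open>S \<omega> < t\<close>, which is a countable union of events decided strictly before
      \<open>t\<close>.\<close>
    have "{\<omega> \<in> space (F t). S \<omega> < t} = (\<Union>k. {\<omega> \<in> space (F t). S \<omega> \<le> t - 1 / real (Suc k)})"
    proof (intro equalityI subsetI)
      fix \<omega> assume "\<omega> \<in> {\<omega> \<in> space (F t). S \<omega> < t}"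
      then have w: "\<omega> \<in> space (F t)" "0 < t - S \<omega>" by auto
      from nat_approx_posE[OF w(2)] obtain k where "1 / real (Suc k) < t - S \<omega>" by blast
      then show "\<omega> \<in> (\<Union>k. {\<omega> \<in> space (F t). S \<omega> \<le> t - 1 / real (Suc k)})"
        using w(1) by (auto intro!: exI[of _ k])
    next
      fix \<omega> assume "\<omega> \<in> (\<Union>k. {\<omega> \<in> space (F t). S \<omega> \<le> t - 1 / real (Suc k)})"
      then obtain k where k: "\<omega> \<in> space (F t)" "S \<omega> \<le> t - 1 / real (Suc k)" by blast
      have "1 / real (Suc k) > 0" by simp
      then have "S \<omega> < t" using k(2) by linarith
      then show "\<omega> \<in> {\<omega> \<in> space (F t). S \<omega> < t}" using k(1) by simp
    qed
    moreover have "{\<omega> \<in> space (F t). S \<omega> \<le> t - 1 / real (Suc k)} \<in> sets (F t)" for k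
    proof -
      have A: "{\<omega> \<in> space (F (t - 1 / real (Suc k))). S \<omega> \<le> t - 1 / real (Suc k)} \<in> sets (F (t - 1 / real (Suc k)))"
        using stopping_timeD[OF stop, of "t - 1 / real (Suc k)"] by (simp only: pred_def)
      have "sets (F (t - 1 / real (Suc k))) \<subseteq> sets (F t)" by (rule Fmono) simp
      from subsetD[OF this A] show ?thesis unfolding spF .
    qed
    ultimately show ?thesis by (metis (no_types, lifting) sets.countable_UN rangeI image_subset_iff)
  qed
  have adapted0: "(\<lambda>\<omega>. if t \<le> S \<omega> then Y 0 \<omega> t x else 0) \<in> borel_measurable (F t)" if t: "t \<in> {0..T}" for t x
  proof -
    have "{\<omega> \<in> space (F t). \<omega> \<in> G \<and> t \<le> S \<omega>} = G - {\<omega> \<in> space (F t). S \<omega> < t}"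
      using sets.sets_into_space[OF GF[of t]] by auto
    then have A: "{\<omega> \<in> space (F t). \<omega> \<in> G \<and> t \<le> S \<omega>} \<in> sets (F t)"
      using sets.Diff[OF GF before] by simp
    \<comment> \<open>The approximating solutions are adapted on the whole space, and
      \<open>lim\<close> of them is measurable as a total function; the cut-off only has to be a
      measurable set.\<close>
    have "(\<lambda>\<omega>. if \<omega> \<in> G \<and> t \<le> S \<omega> then lim (\<lambda>k. y (q 0 k) \<omega> t x) else 0) \<in> borel_measurable (F t)"
      using A by (intro measurable_If borel_measurable_lim_metric ym Qpos(3) q(1) z0 t) auto
    moreover have "(\<lambda>\<omega>. if t \<le> S \<omega> then Y 0 \<omega> t x else 0) =
        (\<lambda>\<omega>. if \<omega> \<in> G \<and> t \<le> S \<omega> then lim (\<lambda>k. y (q 0 k) \<omega> t x) else 0)"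
      using t by (auto simp: Y_def)
    ultimately show ?thesis by simp
  qed
  have bsol: "burgers_sol M (FB M B F0) T \<beta> 1 0 f h \<eta> S (Y 0)"
    unfolding burgers_sol_iff using adapted0 AEG sol0 by auto

  \<comment> \<open>Uniqueness for the inviscid equation\<close>
  have uniq: "AE \<omega> in M. \<forall>t\<in>{0..min (S \<omega>) (S' \<omega>)}. \<forall>x. y0' \<omega> t x = Y 0 \<omega> t x"
    if S': "\<And>\<omega>. 0 \<le> S' \<omega>" and b': "burgers_sol M (FB M B F0) T \<beta> 1 0 f h \<eta> S' y0'" for S' y0'
  proof -
    have "AE \<omega> in M. sol \<omega> (S' \<omega>) 1 0 (y0' \<omega>)" using b' unfolding burgers_sol_iff by blast
    with AEG show ?thesis
    proof eventually_elim
      case (elim \<omega>)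
      let ?\<tau> = "min (S \<omega>) (S' \<omega>)"
      obtain R N4 where "burgers_path (S \<omega>) R N4 \<beta> \<nu>0 f (h \<omega>) (\<eta> \<omega>)" using bp[OF elim(1)] by blast
      then have bp': "burgers_path ?\<tau> R N4 \<beta> \<nu>0 f (h \<omega>) (\<eta> \<omega>)"
        by (rule burgers_path_subinterval) (use S_le S' in auto)
      obtain C1 where C1: "viscosity_modulus \<beta> f (h \<omega>) (\<eta> \<omega>) \<nu>0 ?\<tau> C1"
        using viscosity_modulus_exists[OF bp'] by (elim exE)
      show ?case
      proof (intro ballI allI)
        fix t x assume t: "t \<in> {0..?\<tau>}"
        \<comment> \<open>Two inviscid solutions are not compared directly, since neither is known
          to have a bounded Hessian. Instead both turn out to be limits of the same viscous
          solutions.\<close>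
        have b: "norm (y (q 0 k) \<omega> t x - y0' \<omega> t x) \<le> C1 * \<bar>0 - q 0 k\<bar>" for k
        proof -
          have s1: "burgers_path_sol \<beta> f (h \<omega>) (\<eta> \<omega>) ?\<tau> 1 0 (y0' \<omega>)"
            using elim(2) unfolding sol_def by (rule burgers_path_sol_subinterval) simp
          have s2: "burgers_path_sol \<beta> f (h \<omega>) (\<eta> \<omega>) ?\<tau> 2 (q 0 k) (y (q 0 k) \<omega>)"
            using solS[OF elim(1) q(1)[OF z0]] unfolding sol_def by (rule burgers_path_sol_subinterval) simp
          show ?thesis unfolding norm_minus_commute[of "y (q 0 k) \<omega> t x"]
            by (rule viscosity_modulusD[OF C1 s1 s2 Qpos(1,2)[OF q(1)[OF z0]] t]) auto
        qed
        have "(\<lambda>k. C1 * \<bar>0 - q 0 k\<bar>) \<longlonglongrightarrow> C1 * \<bar>0 - 0\<bar>"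
          by (intro tendsto_intros qlim z0)
        then have "(\<lambda>k. C1 * \<bar>0 - q 0 k\<bar>) \<longlonglongrightarrow> 0" by simp
        with always_eventually[OF allI[OF b]] have "(\<lambda>k. y (q 0 k) \<omega> t x - y0' \<omega> t x) \<longlonglongrightarrow> 0"
          by (rule Lim_null_comparison)
        then have "(\<lambda>k. y (q 0 k) \<omega> t x) \<longlonglongrightarrow> y0' \<omega> t x" by (rule LIM_zero_cancel)
        moreover have "(\<lambda>k. y (q 0 k) \<omega> t x) \<longlonglongrightarrow> Y 0 \<omega> t x" using t by (intro conv elim z0) auto
        ultimately show "y0' \<omega> t x = Y 0 \<omega> t x" by (rule LIMSEQ_unique)
      qed
    qed
  qed

  \<comment> \<open>Agreement with the given solutions and continuity in the viscosity\<close>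
  have version: "AE \<omega> in M. \<forall>t\<in>{0..S \<omega>}. \<forall>x. Y \<nu> \<omega> t x = y \<nu> \<omega> t x" if \<nu>: "\<nu> \<in> {0<..\<nu>0}" for \<nu>
    \<comment> \<open>The null set off which \<open>y \<nu>\<close> solves its equation may depend
      on \<nu>; this is harmless, as the agreement is asserted for one \<nu> at a time.\<close>
    using AEsol[OF \<nu>] AEG
  proof eventually_elim
    case (elim \<omega>)
    have \<nu>': "\<nu> \<in> {0..\<nu>0}" "0 \<le> \<nu>" using \<nu> by auto
    have s: "sol \<omega> (S \<omega>) 2 \<nu> (y \<nu> \<omega>)"
      using elim(1) S_le(2) unfolding sol_def by (rule burgers_path_sol_subinterval)
    show ?case
    proof (intro ballI allI)
      fix t x assume t: "t \<in> {0..S \<omega>}"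
      have b: "norm (y (q \<nu> k) \<omega> t x - y \<nu> \<omega> t x) \<le> C \<omega> * \<bar>\<nu> - q \<nu> k\<bar>" for k
        unfolding norm_minus_commute[of "y (q \<nu> k) \<omega> t x"] by (rule C[OF elim(2) s \<nu>'(2) q(1)[OF \<nu>'(1)] t])
      have "(\<lambda>k. C \<omega> * \<bar>\<nu> - q \<nu> k\<bar>) \<longlonglongrightarrow> C \<omega> * \<bar>\<nu> - \<nu>\<bar>"
        by (intro tendsto_intros qlim \<nu>')
      then have "(\<lambda>k. C \<omega> * \<bar>\<nu> - q \<nu> k\<bar>) \<longlonglongrightarrow> 0" by simp
      with always_eventually[OF allI[OF b]] have "(\<lambda>k. y (q \<nu> k) \<omega> t x - y \<nu> \<omega> t x) \<longlonglongrightarrow> 0"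
        by (rule Lim_null_comparison)
      then have "(\<lambda>k. y (q \<nu> k) \<omega> t x) \<longlonglongrightarrow> y \<nu> \<omega> t x" by (rule LIM_zero_cancel)
      with conv[OF elim(2) \<nu>'(1) t, of x] show "Y \<nu> \<omega> t x = y \<nu> \<omega> t x" by (rule LIMSEQ_unique)
    qed
  qed

  have Ycb: "continuous_on ({0..S \<omega>} \<times> UNIV) (\<lambda>(t, x). Y \<nu> \<omega> t x) \<and>
      bounded ((\<lambda>(t, x). Y \<nu> \<omega> t x) ` ({0..S \<omega>} \<times> UNIV))" if \<nu>: "\<nu> \<in> {0..\<nu>0}" for \<nu> \<omega>
  proof (cases "\<omega> \<in> G")
    case False
    then have "(\<lambda>(t, x). Y \<nu> \<omega> t x) = (\<lambda>_. 0)" by (auto simp: Y_def)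
    then show ?thesis by (simp add: image_constant_conv)
  next
    case \<omega>: True
    have reg: "Cb_hoelder \<beta> 2 0 (S \<omega>) (y (q \<nu> k) \<omega>)" for k
      using solS[OF \<omega> q(1)[OF \<nu>]] by (simp add: sol_def burgers_path_sol_def)
    have "uniform_limit ({0..S \<omega>} \<times> UNIV) (\<lambda>k (t, x). y (q \<nu> k) \<omega> t x) (\<lambda>(t, x). Y \<nu> \<omega> t x) sequentially"
    proof (rule uniform_limitI)
      fix e :: real assume "e > 0"
      have "(\<lambda>k. C \<omega> * \<bar>\<nu> - q \<nu> k\<bar>) \<longlonglongrightarrow> C \<omega> * \<bar>\<nu> - \<nu>\<bar>" by (intro tendsto_intros qlim \<nu>)
      then have "\<forall>\<^sub>F k in sequentially. C \<omega> * \<bar>\<nu> - q \<nu> k\<bar> < e" using \<open>e > 0\<close> by (intro order_tendstoD) auto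
      then show "\<forall>\<^sub>F k in sequentially. \<forall>z\<in>{0..S \<omega>} \<times> UNIV.
          dist ((\<lambda>(t, x). y (q \<nu> k) \<omega> t x) z) ((\<lambda>(t, x). Y \<nu> \<omega> t x) z) < e"
      proof eventually_elim
        case (elim k)
        show ?case
        proof
          fix z :: "real \<times> (real^'n)" assume "z \<in> {0..S \<omega>} \<times> UNIV"
          then obtain t x where z: "z = (t, x)" "t \<in> {0..S \<omega>}" by auto
          then show "dist ((\<lambda>(t, x). y (q \<nu> k) \<omega> t x) z) ((\<lambda>(t, x). Y \<nu> \<omega> t x) z) < e"
            using Yy[OF \<omega> \<nu> z(2) q(1)[OF \<nu>], of x k] elim by (simp add: dist_norm norm_minus_commute)
        qed
      qed
    qed
    then have "continuous_on ({0..S \<omega>} \<times> UNIV) (\<lambda>(t, x). Y \<nu> \<omega> t x)"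
      using Cb_hoelder_cont(1)[OF reg, of "[]"] by (intro uniform_limit_theorem) auto
    moreover have "bounded ((\<lambda>(t, x). Y \<nu> \<omega> t x) ` ({0..S \<omega>} \<times> UNIV))"
    proof -
      obtain B1 where "B1 \<ge> 0" and B1: "\<And>\<alpha> t x. set \<alpha> \<subseteq> Basis \<Longrightarrow> length \<alpha> \<le> 2 \<Longrightarrow> t \<in> {0..S \<omega>} \<Longrightarrow>
          norm (pds \<alpha> (y (q \<nu> 0) \<omega> t) x) \<le> B1"
        using Cb_hoelder_bound[OF reg[of 0]] by blast
      have "norm (Y \<nu> \<omega> t x) \<le> B1 + C \<omega> * \<bar>\<nu> - q \<nu> 0\<bar>" if t: "t \<in> {0..S \<omega>}" for t x
        using Yy[OF \<omega> \<nu> t q(1)[OF \<nu>], of x 0] B1[of "[]" t x] t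
          norm_triangle_sub[of "Y \<nu> \<omega> t x" "y (q \<nu> 0) \<omega> t x"] by simp
      then show ?thesis unfolding bounded_iff by (intro exI[of _ "B1 + C \<omega> * \<bar>\<nu> - q \<nu> 0\<bar>"]) auto
    qed
    ultimately show ?thesis by blast
  qed
  have Ymod: "\<exists>\<delta>>0. \<forall>\<nu>'\<in>{0..\<nu>0}. \<bar>\<nu>' - \<nu>\<bar> < \<delta> \<longrightarrow> (\<forall>t\<in>{0..S \<omega>}. \<forall>x. dist (Y \<nu>' \<omega> t x) (Y \<nu> \<omega> t x) < \<epsilon>)"
    if \<nu>: "\<nu> \<in> {0..\<nu>0}" and \<epsilon>: "\<epsilon> > 0" for \<nu> \<omega> \<epsilon>
  proof (cases "\<omega> \<in> G")
    case False
    then show ?thesis using \<epsilon> by (intro exI[of _ 1]) (simp add: Y_def)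
  next
    case True
    then have "\<epsilon> / (C \<omega> + 1) > 0" using \<epsilon> C0[OF True] by simp
    then show ?thesis using Ysmall[OF True \<nu> _ _ \<epsilon>] by blast
  qed
  have Yzero: "AE \<omega> in M. \<forall>\<epsilon>>0. \<exists>\<delta>>0. \<forall>\<nu>\<in>{0<..\<nu>0}. \<nu> < \<delta> \<longrightarrow>
      (\<forall>t\<in>{0..S \<omega>}. \<forall>x. dist (Y \<nu> \<omega> t x) (Y 0 \<omega> t x) < \<epsilon>)"
  proof (rule AE_I2, intro allI impI)
    fix \<omega> and \<epsilon> :: real assume "\<epsilon> > 0"
    from Ymod[OF z0 this, of \<omega>] obtain \<delta> where "\<delta> > 0"
      "\<And>\<nu>' t x. \<nu>' \<in> {0..\<nu>0} \<Longrightarrow> \<bar>\<nu>' - 0\<bar> < \<delta> \<Longrightarrow> t \<in> {0..S \<omega>} \<Longrightarrow> dist (Y \<nu>' \<omega> t x) (Y 0 \<omega> t x) < \<epsilon>" by blast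
    then show "\<exists>\<delta>>0. \<forall>\<nu>\<in>{0<..\<nu>0}. \<nu> < \<delta> \<longrightarrow> (\<forall>t\<in>{0..S \<omega>}. \<forall>x. dist (Y \<nu> \<omega> t x) (Y 0 \<omega> t x) < \<epsilon>)"
      by (intro exI[of _ \<delta>]) auto
  qed
  have Spos: "AE \<omega> in M. S \<omega> > 0" using AEG by eventually_elim (rule S_G(1))
  show ?thesis
  proof (intro exI[of _ S] exI[of _ "Y 0"] exI[of _ Y] conjI allI ballI impI)
    show "AE \<omega> in M. \<forall>t\<in>{0..min (S \<omega>) (S' \<omega>)}. \<forall>x. y0' \<omega> t x = Y 0 \<omega> t x"
      if "stopping_time (FB M B F0) S' \<and> (\<forall>\<omega>. 0 \<le> S' \<omega> \<and> S' \<omega> \<le> T) \<and>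
         (AE \<omega> in M. S' \<omega> > 0) \<and> burgers_sol M (FB M B F0) T \<beta> 1 0 f h \<eta> S' y0'" for S' y0'
      by (rule uniq) (use that in auto)
    show "AE \<omega> in M. \<forall>t\<in>{0..S \<omega>}. \<forall>x. Y 0 \<omega> t x = Y 0 \<omega> t x" by simp
  qed (rule stop[unfolded F_def] S_le Spos bsol version conjunct1[OF Ycb] conjunct2[OF Ycb] Ymod Yzero; assumption)+
qed

end
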